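(* Let $f_\pm\colon\mathbb R\to\mathbb R$ be smooth, and let $u_0\in\mathbb R$ satisfy $f_+'(u_0)=f_-'(u_0)$, $f_+''(u_0)>f_-''(u_0)$, $f_+'''(u_0)>0$. For small $\varepsilon>0$ let $u_+$ be the unique root in $(u_0,u_0+2\varepsilon)$ of the equation $$f_+'(u+\varepsilon)-f_-'(u-\varepsilon)-2\varepsilon f_+''(u+\varepsilon)=0.$$ Then for all sufficiently small $\varepsilon>0$ there exists an SW-fissure with a spine function $T$ defined on some interval $[v_-+\varepsilon,u_++\varepsilon]$ such that: 1. $T(u_0+\varepsilon)=0$ and $T(u_++\varepsilon)=\varepsilon$; 2. $v_-<u_0-\varepsilon$ and $T(v_-+\varepsilon)=-\varepsilon$; 3. the function $$B(x)=\begin{cases}\dfrac{\varepsilon-x_2}{\varepsilon-T}A+\dfrac{x_2-T}{\varepsilon-T}f_+, & x_2\ge T(u),\\[2mm] \dfrac{\varepsilon+x_2}{\varepsilon+T}A+\dfrac{T-x_2}{\varepsilon+T}f_-, & x_2\le T(u),\end{cases}\qquad u=u(x),$$ with $$A=\frac{\varepsilon^2-T^2}{2\varepsilon T}\Big[(\varepsilon+T)f_+'-(\varepsilon-T)f_-'\Big]+\frac{(\varepsilon+T)f_++(\varepsilon-T)f_-}{2\varepsilon},$$ is a Bellman candidate on the region $\Omega^{SW}_\varepsilon(v_-,u_+)$ foliated by this fissure; 4. there exists $\delta=\delta(\varepsilon)>0$ such that the function equal to $$\frac{\varepsilon+x_2}{2\varepsilon}f_+(x_1-x_2+\varepsilon)+\frac{\varepsilon-x_2}{2\varepsilon}f_-(x_1-x_2-\varepsilon)\quad\text{on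 }\Omega^R_\varepsilon(u_+,u_++\delta),$$ $$\frac{\varepsilon+x_2}{2\varepsilon}f_+(x_1+x_2-\varepsilon)+\frac{\varepsilon-x_2}{2\varepsilon}f_-(x_1+x_2+\varepsilon)\quad\text{on }\Omega^L_\varepsilon(v_--\delta,v_-),$$ and to the function $B$ of item 3 on $\Omega^{SW}_\varepsilon(v_-,u_+)$, is a $C^1$-smooth Bellman candidate on the union of these three regions.
   Context: Let $\Omega_\varepsilon=\{(x_1,x_2)\in\mathbb R^2: -\varepsilon\le x_2\le\varepsilon\}$, $\partial\Omega_\varepsilon=\{x_2=\pm\varepsilon\}$. For $a<b$ put $\Omega^{R}_\varepsilon(a,b)=\{x\in\Omega_\varepsilon: a\le x_1-x_2\le b\}$ and $\Omega^{L}_\varepsilon(a,b)=\{x\in\Omega_\varepsilon: a\le x_1+x_2\le b\}$. The functions $f_\pm$ do not depend on $\varepsilon$. The root $u_+$ exists and is unique for small $\varepsilon$. A function on a two-dimensional domain is diagonally concave if it is concave along every segment of the domain lying on a line $x_1+x_2=\mathrm{const}$ or $x_1-x_2=\mathrm{const}$. A function $B$ on a subdomain $\Omega\subset\Omega_\varepsilon$ is a Bellman candidate on $\Omega$ if: (1) $B$ is diagonally concave on $\Omega$; (2) $B(x_1,\pm\varepsilon)=f_\pm(x_1)$ at the points of $\Omega\cap\partial\Omega_\varepsilon$; (3) for every $y\in\Omega$, either there is a straight line segment in one of the directions $x_1\pm x_2=\mathrm{const}$ connecting $y$ with some point of $\partial\Omega_\varepsilon$ on which $B$ is linear, or $B$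 is linear in both directions $x_1\pm x_2=\mathrm{const}$ in a neighborhood of $y$. Left horizontal herringbone: given a $C^1$ spine function $T$ on an interval, with values in $[-\varepsilon,\varepsilon]$, $|T'|\le1$ and $|T'|<1$ except possibly at finitely many points, from each spine point $(u,T(u))$ start two ribs: the upper rib, the segment to $(u+T(u)-\varepsilon,\varepsilon)$, and the lower rib, the segment to $(u-T(u)-\varepsilon,-\varepsilon)$ (a rib degenerates to a point when $T(u)=\varepsilon$, resp. $T(u)=-\varepsilon$). A fissure is a horizontal herringbone whose spine connects the two opposite boundaries of the strip; an SW-fissure is a left herringbone whose spine goes, from left to right, from the bottom boundary $x_2=-\varepsilon$ to the top boundary $x_2=\varepsilon$. The region $\Omega^{SW}_\varepsilon(v_-,u_+)$ is the union of all ribs, i.e. $\{x\in\Omega_\varepsilon: x_1+x_2\ge v_-,\ x_1-x_2\le u_+\}$. For $x$ in this region, $u=u(x)$ is the parameter of the rib containing $x$: $x_1+x_2=u+T(u)$ on upper ribs ($x_2\ge T(u)$), $x_1-x_2=u-T(u)$ on lower ribs ($x_2\le T(u)$). In the formulas for $B$ and $A$ in item 3, $A,T$ are evaluated at $u$, $f_+$ and its derivatives at $u+T(u)-\varepsilon$, $f_-$ and its derivatives at $u-T(u)-\varepsilon$. At $u=u_0+\varepsilon$ (where $T=0$) $A$ is understood as extended by continuity; on the degenerate ribs at the endpoints of the spine $B$ equals the boundary value. *)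

theory Defs
  imports "HOL-Analysis.Analysis"
begin

definition smooth :: "(real \<Rightarrow> real) \<Rightarrow> bool" where
  "smooth f \<longleftrightarrow> (\<forall>n. (deriv ^^ n) f differentiable_on UNIV)"

subsection \<open>The strip and its subdomains\<close>

definition strip :: "real \<Rightarrow> (real \<times> real) set" where
  "strip \<epsilon> = {x. - \<epsilon> \<le> snd x \<and> snd x \<le> \<epsilon>}"

definition strip_boundary :: "real \<Rightarrow> (real \<times> real) set" where
  "strip_boundary \<epsilon> = {x. snd x = \<epsilon> \<or> snd x = - \<epsilon>}"

definition Omega_R :: "real \<Rightarrow> real \<Rightarrow> real \<Rightarrow> (real \<times> real) set" where
  "Omega_R \<epsilon> a b = {x \<in> strip \<epsilon>. a \<le> fst x - snd x \<and> fst x - snd x \<le> b}"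

definition Omega_L :: "real \<Rightarrow> real \<Rightarrow> real \<Rightarrow> (real \<times> real) set" where
  "Omega_L \<epsilon> a b = {x \<in> strip \<epsilon>. a \<le> fst x + snd x \<and> fst x + snd x \<le> b}"

definition Omega_SW :: "real \<Rightarrow> real \<Rightarrow> real \<Rightarrow> (real \<times> real) set" where
  "Omega_SW \<epsilon> v u = {x \<in> strip \<epsilon>. v \<le> fst x + snd x \<and> fst x - snd x \<le> u}"

subsection \<open>Bellman candidates\<close>

definition same_diagonal :: "real \<times> real \<Rightarrow> real \<times> real \<Rightarrow> bool" where
  "same_diagonal x y \<longleftrightarrow> fst x + snd x = fst y + snd y \<or> fst x - snd x = fst y - snd y"

definition diagonally_concave_on :: "(real \<times> real) set \<Rightarrow> (real \<times> real \<Rightarrow> real) \<Rightarrow> bool" where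
  "diagonally_concave_on S B \<longleftrightarrow>
     (\<forall>x y. same_diagonal x y \<and> closed_segment x y \<subseteq> S \<longrightarrow> concave_on (closed_segment x y) B)"

text \<open>As usual in this subject, a function is linear on a segment if it is affine there.\<close>

definition linear_on_segment :: "(real \<times> real \<Rightarrow> real) \<Rightarrow> real \<times> real \<Rightarrow> real \<times> real \<Rightarrow> bool" where
  "linear_on_segment B x y \<longleftrightarrow>
     (\<forall>t\<in>{0..1}. B ((1 - t) *\<^sub>R x + t *\<^sub>R y) = (1 - t) * B x + t * B y)"

text \<open>Neighborhoods are taken relative to the subdomain \<open>S\<close>. The segment joining \<open>y\<close> to
  the boundary may be degenerate if \<open>y\<close> itself is a boundary point.\<close>

definition bellman_candidate ::
    "real \<Rightarrow> (real \<Rightarrow> real) \<Rightarrow> (real \<Rightarrow> real) \<Rightarrow> (real \<times> real) set \<Rightarrow> (real \<times> real \<Rightarrow> real) \<Rightarrow> bool" where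
  "bellman_candidate \<epsilon> fp fm S B \<longleftrightarrow>
     S \<subseteq> strip \<epsilon> \<and>
     diagonally_concave_on S B \<and>
     (\<forall>s. (s, \<epsilon>) \<in> S \<longrightarrow> B (s, \<epsilon>) = fp s) \<and>
     (\<forall>s. (s, - \<epsilon>) \<in> S \<longrightarrow> B (s, - \<epsilon>) = fm s) \<and>
     (\<forall>y\<in>S.
        (\<exists>z\<in>strip_boundary \<epsilon>. same_diagonal y z \<and> closed_segment y z \<subseteq> S \<and> linear_on_segment B y z) \<or>
        (\<exists>r>0. \<forall>a b. same_diagonal a b \<and> closed_segment a b \<subseteq> ball y r \<inter> S \<longrightarrow>
                  linear_on_segment B a b))"

text \<open>\<open>C\<^sup>1\<close>-smoothness up to the boundary: \<open>D\<close> is the gradient.\<close>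

definition C1_on :: "(real \<times> real) set \<Rightarrow> (real \<times> real \<Rightarrow> real) \<Rightarrow> bool" where
  "C1_on S B \<longleftrightarrow>
     (\<exists>D :: real \<times> real \<Rightarrow> real \<times> real. continuous_on S D \<and>
        (\<forall>x\<in>S. (B has_derivative (\<lambda>h. D x \<bullet> h)) (at x within S)))"

subsection \<open>Left horizontal herringbones\<close>

definition spine_function :: "real \<Rightarrow> real \<Rightarrow> real \<Rightarrow> (real \<Rightarrow> real) \<Rightarrow> bool" where
  "spine_function \<epsilon> a b T \<longleftrightarrow>
     a < b \<and> T ` {a..b} \<subseteq> {- \<epsilon>..\<epsilon>} \<and>
     (\<exists>T'. continuous_on {a..b} T' \<and>
        (\<forall>u\<in>{a..b}. (T has_real_derivative T' u) (at u within {a..b}) \<and> \<bar>T' u\<bar> \<le> 1) \<and>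
        finite {u\<in>{a..b}. \<not> \<bar>T' u\<bar> < 1})"

definition SW_fissure :: "real \<Rightarrow> real \<Rightarrow> real \<Rightarrow> (real \<Rightarrow> real) \<Rightarrow> bool" where
  "SW_fissure \<epsilon> a b T \<longleftrightarrow> spine_function \<epsilon> a b T \<and> T a = - \<epsilon> \<and> T b = \<epsilon>"

definition upper_rib :: "real \<Rightarrow> (real \<Rightarrow> real) \<Rightarrow> real \<Rightarrow> (real \<times> real) set" where
  "upper_rib \<epsilon> T u = closed_segment (u, T u) (u + T u - \<epsilon>, \<epsilon>)"

definition lower_rib :: "real \<Rightarrow> (real \<Rightarrow> real) \<Rightarrow> real \<Rightarrow> (real \<times> real) set" where
  "lower_rib \<epsilon> T u = closed_segment (u, T u) (u - T u - \<epsilon>, - \<epsilon>)"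

definition ribs :: "real \<Rightarrow> (real \<Rightarrow> real) \<Rightarrow> real \<Rightarrow> (real \<times> real) set" where
  "ribs \<epsilon> T u = upper_rib \<epsilon> T u \<union> lower_rib \<epsilon> T u"

definition foliates :: "real \<Rightarrow> (real \<Rightarrow> real) \<Rightarrow> real set \<Rightarrow> (real \<times> real) set \<Rightarrow> bool" where
  "foliates \<epsilon> T I S \<longleftrightarrow> (\<Union>u\<in>I. ribs \<epsilon> T u) = S \<and> (\<forall>x\<in>S. \<exists>!u. u \<in> I \<and> x \<in> ribs \<epsilon> T u)"

definition rib_parameter :: "real \<Rightarrow> (real \<Rightarrow> real) \<Rightarrow> real set \<Rightarrow> real \<times> real \<Rightarrow> real" where
  "rib_parameter \<epsilon> T I x = (THE u. u \<in> I \<and> x \<in> ribs \<epsilon> T u)"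

text \<open>The value on the spine is given by an explicit formula where \<open>T\<close> does not vanish, and by
  continuity where it does. This determines \<open>A\<close> on \<open>I\<close> whenever the
  zeros of \<open>T\<close> are limit points of its nonzero set.\<close>

definition spine_value ::
    "real \<Rightarrow> (real \<Rightarrow> real) \<Rightarrow> (real \<Rightarrow> real) \<Rightarrow> (real \<Rightarrow> real) \<Rightarrow> real set \<Rightarrow> (real \<Rightarrow> real) \<Rightarrow> bool" where
  "spine_value \<epsilon> fp fm T I A \<longleftrightarrow>
     continuous_on I A \<and>
     (\<forall>u\<in>I. T u \<noteq> 0 \<longrightarrow>
        A u = (\<epsilon>\<^sup>2 - (T u)\<^sup>2) / (2 * \<epsilon> * T u) *
                ((\<epsilon> + T u) * deriv fp (u + T u - \<epsilon>) - (\<epsilon> - T u) * deriv fm (u - T u - \<epsilon>))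
            + ((\<epsilon> + T u) * fp (u + T u - \<epsilon>) + (\<epsilon> - T u) * fm (u - T u - \<epsilon>)) / (2 * \<epsilon>))"

text \<open>The inner case distinctions assign the boundary value on degenerate ribs, where the
  interpolation formula would read \<open>0 / 0\<close>.\<close>

definition herringbone_fun ::
    "real \<Rightarrow> (real \<Rightarrow> real) \<Rightarrow> (real \<Rightarrow> real) \<Rightarrow> (real \<Rightarrow> real) \<Rightarrow> real set \<Rightarrow> (real \<Rightarrow> real) \<Rightarrow>
     real \<times> real \<Rightarrow> real" where
  "herringbone_fun \<epsilon> fp fm T I A x =
     (let u = rib_parameter \<epsilon> T I x in
      if snd x \<ge> T u then
        (if T u = \<epsilon> then fp (fst x)
         else (\<epsilon> - snd x) / (\<epsilon> - T u) * A u + (snd x - T u) / (\<epsilon> - T u) * fp (u + T u - \<epsilon>))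
      else
        (if T u = - \<epsilon> then fm (fst x)
         else (\<epsilon> + snd x) / (\<epsilon> + T u) * A u + (T u - snd x) / (\<epsilon> + T u) * fm (u - T u - \<epsilon>)))"

subsection \<open>Tangent domains\<close>

definition tangent_R :: "real \<Rightarrow> (real \<Rightarrow> real) \<Rightarrow> (real \<Rightarrow> real) \<Rightarrow> real \<times> real \<Rightarrow> real" where
  "tangent_R \<epsilon> fp fm x =
     (\<epsilon> + snd x) / (2 * \<epsilon>) * fp (fst x - snd x + \<epsilon>) + (\<epsilon> - snd x) / (2 * \<epsilon>) * fm (fst x - snd x - \<epsilon>)"

definition tangent_L :: "real \<Rightarrow> (real \<Rightarrow> real) \<Rightarrow> (real \<Rightarrow> real) \<Rightarrow> real \<times> real \<Rightarrow> real" where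
  "tangent_L \<epsilon> fp fm x =
     (\<epsilon> + snd x) / (2 * \<epsilon>) * fp (fst x + snd x - \<epsilon>) + (\<epsilon> - snd x) / (2 * \<epsilon>) * fm (fst x + snd x + \<epsilon>)"

definition is_u_plus :: "(real \<Rightarrow> real) \<Rightarrow> (real \<Rightarrow> real) \<Rightarrow> real \<Rightarrow> real \<Rightarrow> real \<Rightarrow> bool" where
  "is_u_plus fp fm u0 \<epsilon> u \<longleftrightarrow>
     u0 < u \<and> u < u0 + 2 * \<epsilon> \<and>
     deriv fp (u + \<epsilon>) - deriv fm (u - \<epsilon>) - 2 * \<epsilon> * (deriv ^^ 2) fp (u + \<epsilon>) = 0"

end

theory Submission
  imports Defs
begin

text \<open>
  Parametrise the spine by \<open>t = T\<close> and write \<open>P\<close> and \<open>P - 2t\<close> for the arguments of \<open>f\<^sub>+\<close> and \<open>f\<^sub>-\<close> at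
  the spine point. If \<open>B\<close> is to be \<open>C\<^sup>1\<close> and diagonally concave, its second derivatives must match
  across the spine, which says that the slopes of \<open>B\<close> along the two ribs have a common derivative
  \<open>\<kappa> = (f\<^sub>+'(P) - f\<^sub>-'(P - 2t)) / (2t)\<close> with \<open>(\<epsilon> - t) \<kappa>' = (\<kappa> - f\<^sub>+''(P)) P'\<close> and
  \<open>(\<epsilon> + t) \<kappa>' = (\<kappa> - f\<^sub>-''(P - 2t)) (P' - 2)\<close>. The point \<open>t = 0\<close> is a star node of this
  equation and \<open>t = \<epsilon>\<close> is a saddle whose position is given by the root \<open>u\<^sub>+\<close>, so the spine is
  an unstable manifold. Putting \<open>\<kappa> = f\<^sub>+''(P) + (\<epsilon> - t) m\<close> makes the node
  disappear: \<open>(P, m)\<close> satisfies a system which is regular at \<open>t = 0\<close>, and whose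
  solution through the saddle is the fixed point of an integral operator that is a contraction on
  the whole interval \<open>[-\<epsilon>, \<epsilon>]\<close> when \<open>\<epsilon>\<close> is small. The relation
  \<open>2t\<kappa> = f\<^sub>+'(P) - f\<^sub>-'(P - 2t)\<close> propagates from \<open>t = \<epsilon>\<close>, and at \<open>t = 0\<close> it forces \<open>P = u\<^sub>0\<close>.

  Diagonal concavity follows because transversally to the ribs the second derivative of \<open>B\<close> equals
  \<open>-\<bar>x\<^sub>2 - t\<bar>\<close> times the derivative of \<open>\<kappa>\<close> in the coordinate constant along the rib, and
  \<open>\<kappa>' = m P' \<ge> 0\<close>; the sign of \<open>m\<close> is that of \<open>f\<^sub>+'''(u\<^sub>0)\<close>.
\<close>

subsection \<open>Preliminaries from real analysis\<close>

text \<open>Eliminating \<open>\<kappa>\<close> through the relation \<open>2t\<kappa> = ...\<close>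
  means dividing by \<open>t\<close>; hence the singularity at \<open>t = 0\<close>. Here
  \<open>\<kappa>\<close> stays an unknown of its own. The difference of its two equations says that
  \<open>2t\<kappa> - f\<^sub>+'(P) + f\<^sub>-'(P - 2t)\<close> has derivative 0, so the relation
  is a first integral, to be checked at one point. At \<open>t = \<epsilon>\<close> a bounded
  \<open>m\<close> forces \<open>\<kappa> = f\<^sub>+''(P)\<close>, and the relation becomes the
  equation of \<open>u\<^sub>+\<close>.

  No continuation argument is needed to reach \<open>t = -\<epsilon>\<close>: all arguments stay
  within \<open>8\<epsilon>\<close> of \<open>u\<^sub>0\<close>, where
  \<open>f\<^sub>+'' - f\<^sub>-''\<close> keeps a fixed gap.

  The tangent domains are treated as prolongations of the two families of ribs, so one function on
  the whole strip serves items 3 and 4. Only its concavity is local. Of the four inequalities it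
  requires near the ends of the spine three are strict there and persist by continuity; the fourth
  is an equality at \<open>u\<^sub>+\<close> and persists because the left side of the equation of
  \<open>u\<^sub>+\<close> increases.\<close>

lemma integral_fixed_point:
  fixes F :: "real \<Rightarrow> real \<Rightarrow> 'a::euclidean_space \<Rightarrow> 'a"
  assumes "0 \<le> R" and cont: "continuous_on ({0..1} \<times> {0..R} \<times> UNIV) (\<lambda>(l, s, y). F l s y)"
    and bound: "\<And>l s y. l \<in> {0..1} \<Longrightarrow> s \<in> {0..R} \<Longrightarrow> norm (F l s y) \<le> M"
    and lip: "\<And>l s y z. l \<in> {0..1} \<Longrightarrow> s \<in> {0..R} \<Longrightarrow> norm (F l s y - F l s z) \<le> c * norm (y - z)"
    and "0 \<le> c" "c < 1"
  shows "\<exists>y. continuous_on {0..R} y \<and> (\<forall>s\<in>{0..R}. ((\<lambda>l. F l s (y (l * s))) has_integral y s) {0..1})"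
proof -
  \<comment> \<open>Clamping \<open>s\<close> extends the equation to the whole line, so that the
    fixed point can be sought in the complete space of bounded continuous functions;
    \<open>l * cl s\<close> stays in [0, R].\<close>
  define cl where "cl s = max 0 (min s R)" for s :: real
  have cl: "cl s \<in> {0..R}" for s using \<open>0 \<le> R\<close> by (auto simp: cl_def)
  have cl_id: "cl s = s" if "s \<in> {0..R}" for s using that by (auto simp: cl_def)
  have ccl: "continuous_on A cl" for A unfolding cl_def by (intro continuous_intros)
  define G where "G y s l = F l (cl s) (apply_bcontfun y (l * cl s))" for y :: "real \<Rightarrow>\<^sub>C 'a" and s l
  have contG: "continuous_on (UNIV \<times> cbox 0 1) (\<lambda>(s, l). G y s l)" for y
  proof -
    have "continuous_on (UNIV \<times> cbox 0 1)
      ((\<lambda>(l, s, y). F l s y) \<circ> (\<lambda>(s, l). (l, cl s, apply_bcontfun y (l * cl s))))"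
    proof (rule continuous_on_compose)
      show "continuous_on (UNIV \<times> cbox 0 1) (\<lambda>(s, l). (l, cl s, apply_bcontfun y (l * cl s)))"
        unfolding split_def
        by (intro continuous_intros continuous_on_compose2[OF ccl[of UNIV]]
            continuous_on_compose2[OF continuous_on_apply_bcontfun[of UNIV]]) auto
      show "continuous_on ((\<lambda>(s, l). (l, cl s, apply_bcontfun y (l * cl s))) ` (UNIV \<times> cbox 0 1))
         (\<lambda>(l, s, y). F l s y)"
        by (rule continuous_on_subset[OF cont]) (use cl in auto)
    qed
    then show ?thesis by (simp add: G_def o_def split_def)
  qed
  have intG: "G y s integrable_on {0..1}" for y s
  proof -
    have "continuous_on {0..1} (G y s)"
    proof -
      have "continuous_on {0..1} ((\<lambda>(s, l). G y s l) \<circ> (\<lambda>l. (s, l)))"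
        by (rule continuous_on_compose) (auto intro!: continuous_intros continuous_on_subset[OF contG])
      then show ?thesis by (simp add: o_def)
    qed
    then show ?thesis by (simp add: integrable_continuous_real)
  qed
  define P where "P y s = integral {0..1} (G y s)" for y s
  have P_bcont: "P y \<in> bcontfun" for y
  proof (rule bcontfun_normI)
    show "continuous_on UNIV (P y)"
      using integral_continuous_on_param[OF contG[of y]] by (simp add: P_def[abs_def])
    show "norm (P y s) \<le> M" for s
    proof -
      have "norm (F 0 0 0) \<le> M" using bound[of 0 0 0] \<open>0 \<le> R\<close> by simp
      then have "0 \<le> M" by (rule order_trans[OF norm_ge_zero])
      moreover have "(G y s has_integral P y s) (cbox 0 1)"
        using intG[of y s] by (simp add: P_def has_integral_integral)
      moreover have "norm (G y s l) \<le> M" if "l \<in> cbox 0 1" for l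
        using bound[OF _ cl] that by (simp add: G_def)
      ultimately show ?thesis
        using has_integral_bound[of M "G y s" "P y s" 0 1] by simp
    qed
  qed
  define \<Phi> where "\<Phi> y = Bcontfun (P y)" for y
  have ap: "apply_bcontfun (\<Phi> y) = P y" for y
    by (simp add: \<Phi>_def Bcontfun_inverse P_bcont)
  have lipP: "dist (P y s) (P z s) \<le> c * dist y z" for y z s
  proof -
    have "norm (G y s l - G z s l) \<le> c * dist y z" if "l \<in> {0..1}" for l
      using lip[OF that cl[of s], of "apply_bcontfun y (l * cl s)" "apply_bcontfun z (l * cl s)"]
        dist_bounded[of y "l * cl s" z] \<open>0 \<le> c\<close>
      by (auto simp: G_def dist_norm[symmetric] intro: order_trans mult_left_mono)
    moreover have "((\<lambda>l. G y s l - G z s l) has_integral integral {0..1} (\<lambda>l. G y s l - G z s l)) (cbox 0 1)"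
      using integrable_diff[OF intG[of y s] intG[of z s]] by (simp add: has_integral_integral)
    moreover have "0 \<le> c * dist y z" using \<open>0 \<le> c\<close> by simp
    ultimately have "norm (integral {0..1} (\<lambda>l. G y s l - G z s l)) \<le> c * dist y z"
      using has_integral_bound[of "c * dist y z" "\<lambda>l. G y s l - G z s l" _ 0 1] by simp
    then show ?thesis using integral_diff[OF intG[of y s] intG[of z s]] by (simp add: P_def dist_norm)
  qed
  have "\<exists>!y. \<Phi> y = y"
    by (rule banach_fix_type[OF \<open>0 \<le> c\<close> \<open>c < 1\<close>]) (auto intro!: dist_bound simp: ap lipP)
  then obtain y where y: "\<Phi> y = y" by auto
  have "((\<lambda>l. F l s (apply_bcontfun y (l * s))) has_integral apply_bcontfun y s) {0..1}" if "s \<in> {0..R}" for s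
    using intG[of y s] ap[of y] that
    by (metis (no_types, lifting) G_def P_def cl_id has_integral_integral has_integral_eq y)
  then show ?thesis
    by (intro exI[of _ "apply_bcontfun y"]) auto
qed

lemma MVT_real_derivative:
  fixes f :: "real \<Rightarrow> real"
  assumes "a < b" "continuous_on {a..b} f"
    and der: "\<And>x. a < x \<Longrightarrow> x < b \<Longrightarrow> (f has_real_derivative f' x) (at x)"
  obtains x where "a < x" "x < b" "f b - f a = (b - a) * f' x"
proof -
  obtain l x where x: "a < x" "x < b" "(f has_real_derivative l) (at x)" "f b - f a = (b - a) * l"
    using MVT[OF assms(1,2)] der real_differentiable_def by blast
  then show ?thesis using DERIV_unique[OF x(3) der] that by auto
qed

lemma concave_on_interval_derivI:
  fixes f :: "real \<Rightarrow> real"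
  assumes cont: "continuous_on {a..b} f"
    and der: "\<And>x. a < x \<Longrightarrow> x < b \<Longrightarrow> (f has_real_derivative f' x) (at x)"
    and anti: "\<And>x y. a < x \<Longrightarrow> x \<le> y \<Longrightarrow> y < b \<Longrightarrow> f' y \<le> f' x"
    and "a \<le> b" "0 \<le> t" "t \<le> 1"
  shows "(1 - t) * f a + t * f b \<le> f ((1 - t) * a + t * b)"
proof (cases "a = b \<or> t = 0 \<or> t = 1")
  case True
  then show ?thesis by (auto simp: algebra_simps)
next
  case False
  then have ab: "a < b" "0 < t" "t < 1" using assms by auto
  define z where "z = (1 - t) * a + t * b"
  have za: "z - a = t * (b - a)" and zb: "b - z = (1 - t) * (b - a)"
    by (auto simp: z_def algebra_simps)
  have "0 < t * (b - a)" "0 < (1 - t) * (b - a)" using ab by auto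
  then have "0 < z - a" "0 < b - z" by (simp_all only: za zb)
  then have z: "a < z" "z < b" by auto
  obtain x where x: "a < x" "x < z" "f z - f a = (z - a) * f' x"
    by (rule MVT_real_derivative[of a z f f'])
      (use z der in \<open>auto intro: continuous_on_subset[OF cont]\<close>)
  obtain y where y: "z < y" "y < b" "f b - f z = (b - z) * f' y"
    by (rule MVT_real_derivative[of z b f f'])
      (use z der in \<open>auto intro: continuous_on_subset[OF cont]\<close>)
  have "f' y \<le> f' x" using anti x y by auto
  then have "t * (1 - t) * (b - a) * f' y \<le> t * (1 - t) * (b - a) * f' x"
    using ab by (intro mult_left_mono) auto
  then have "t * (f b - f z) \<le> (1 - t) * (f z - f a)"
    unfolding x(3) y(3) za zb by (simp add: algebra_simps)
  then show ?thesis unfolding z_def[symmetric] by (simp add: algebra_simps)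
qed

text \<open>The oriented integral is an antiderivative on the whole line, also left of 0. The slopes
  \<open>k\<close> and \<open>l\<close> below are normalised by subtracting its value at a base
  point.\<close>

definition antiderivative :: "(real \<Rightarrow> real) \<Rightarrow> real \<Rightarrow> real" where
  "antiderivative f x = (LBINT y=0..x. f y)"

lemma antiderivative_derivative:
  assumes "continuous_on UNIV f"
  shows "(antiderivative f has_real_derivative f x) (at x)"
proof -
  have "((\<lambda>u. LBINT y=0..u. f y) has_vector_derivative f x) (at x within {-\<bar>x\<bar> - 1..\<bar>x\<bar> + 1})"
    using interval_integral_FTC2[of "-\<bar>x\<bar> - 1" 0 "\<bar>x\<bar> + 1" f x] continuous_on_subset[OF assms]
    by (auto simp: zero_ereal_def)
  moreover have "at x within {-\<bar>x\<bar> - 1..\<bar>x\<bar> + 1} = at x"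
    by (rule at_within_Icc_at) auto
  ultimately show ?thesis
    by (simp add: has_real_derivative_iff_has_vector_derivative antiderivative_def[abs_def])
qed

text \<open>Constant continuation outside the range keeps the inverse continuous on the whole line.
  Past an end of the spine it returns the height of that end, which encodes the tangent domains
  without case distinctions.\<close>

definition clamped_inverse :: "real \<Rightarrow> real \<Rightarrow> (real \<Rightarrow> real) \<Rightarrow> real \<Rightarrow> real" where
  "clamped_inverse a b f y = inv_into {a..b} f (max (f a) (min y (f b)))"

lemma clamped_inverse:
  fixes f :: "real \<Rightarrow> real"
  assumes "a \<le> b" and cont: "continuous_on {a..b} f" and mono: "strict_mono_on {a..b} f"
  shows "continuous_on UNIV (clamped_inverse a b f)" and "clamped_inverse a b f y \<in> {a..b}"
    and "x \<in> {a..b} \<Longrightarrow> clamped_inverse a b f (f x) = x"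
    and "y \<in> {f a..f b} \<Longrightarrow> f (clamped_inverse a b f y) = y"
    and "y \<le> f a \<Longrightarrow> clamped_inverse a b f y = a" and "f b \<le> y \<Longrightarrow> clamped_inverse a b f y = b"
proof -
  have inj: "inj_on f {a..b}" using mono by (simp add: strict_mono_on_imp_inj_on)
  have hf: "inv_into {a..b} f (f x) = x" if "x \<in> {a..b}" for x using inj that by simp
  have fab: "f a \<le> f b" using mono \<open>a \<le> b\<close>
    by (metis atLeastAtMost_iff order_refl order_less_le strict_mono_on_def)
  have img: "f ` {a..b} = {f a..f b}"
  proof
    show "f ` {a..b} \<subseteq> {f a..f b}" using mono
      by (auto simp: strict_mono_on_def order_le_less)
    show "{f a..f b} \<subseteq> f ` {a..b}"
      using IVT'[of f a _ b] cont \<open>a \<le> b\<close> by (force simp: image_iff)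
  qed
  have conth: "continuous_on {f a..f b} (inv_into {a..b} f)"
    using continuous_on_inv[OF cont, of "inv_into {a..b} f"] hf img by auto
  have cl: "max (f a) (min y (f b)) \<in> {f a..f b}" for y using fab by auto
  show "continuous_on UNIV (clamped_inverse a b f)" unfolding clamped_inverse_def[abs_def]
    by (rule continuous_on_compose2[OF conth]) (use cl in \<open>auto intro!: continuous_intros\<close>)
  show "clamped_inverse a b f y \<in> {a..b}"
    unfolding clamped_inverse_def by (rule inv_into_into) (use cl img in auto)
  show "clamped_inverse a b f (f x) = x" if "x \<in> {a..b}"
  proof -
    have "f x \<in> {f a..f b}" using img that by auto
    then show ?thesis using hf[OF that] by (auto simp: clamped_inverse_def)
  qed
  show "f (clamped_inverse a b f y) = y" if "y \<in> {f a..f b}"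
    using that img by (auto simp: clamped_inverse_def intro!: f_inv_into_f)
  show "clamped_inverse a b f y = a" if "y \<le> f a"
    using that hf[of a] \<open>a \<le> b\<close> fab by (auto simp: clamped_inverse_def max_def min_def)
  show "clamped_inverse a b f y = b" if "f b \<le> y"
    using that hf[of b] \<open>a \<le> b\<close> fab by (auto simp: clamped_inverse_def max_def min_def)
qed

lemma has_real_derivative_inverse_within:
  fixes f g :: "real \<Rightarrow> real"
  assumes "(f has_real_derivative D) (at x within S)" "D \<noteq> 0" "x \<in> S"
    and "continuous (at (f x) within f ` S) g" and "\<And>x. x \<in> S \<Longrightarrow> g (f x) = x"
  shows "(g has_real_derivative inverse D) (at (f x) within f ` S)"
proof -
  have "(g has_derivative ((*) (inverse D))) (at (f x) within f ` S)"
    by (rule has_derivative_inverse_within[where f' = "(*) D"])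
      (use assms in \<open>auto simp: has_field_derivative_def o_def linear_times\<close>)
  then show ?thesis by (simp add: has_field_derivative_def)
qed

lemma has_derivative_within_Un:
  assumes "(f has_derivative f') (at x within A)" "(f has_derivative f') (at x within B)"
  shows "(f has_derivative f') (at x within A \<union> B)"
  using assms by (auto simp: has_derivative_within intro: Lim_Un)

text \<open>Off a closed set the filter \<open>at x within A\<close> is trivial. With
  \<open>has_derivative_within_Un\<close> this lets a function glued over two closed sets be
  differentiated piece by piece.\<close>

lemma has_derivative_within_not_closure:
  assumes "closed A" "x \<notin> A" "bounded_linear f'"
  shows "(f has_derivative f') (at x within A)"
proof -
  have "at x within A = bot" using assms(1,2)
    by (metis closed_limpt trivial_limit_within)
  then show ?thesis using assms(3) by (simp add: has_derivative_def)
qed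

subsection \<open>The spine as a fixed point\<close>

text \<open>The substitution \<open>s = l * r\<close> turns the average into the integral of
  \<open>h\<close> over \<open>[0, r]\<close>.\<close>

lemma scaled_integral_derivative:
  fixes h :: "real \<Rightarrow> real"
  assumes h: "continuous_on {0..R} h"
    and y: "\<And>r. r \<in> {0..R} \<Longrightarrow> ((\<lambda>l. r * h (l * r)) has_integral y r) {0..1}"
    and "r \<in> {0..R}"
  shows "(y has_real_derivative h r) (at r within {0..R})"
proof -
  define H where "H r = integral {0..r} h" for r
  have H: "(H has_real_derivative h r) (at r within {0..R})" if "r \<in> {0..R}" for r
    unfolding H_def[abs_def] by (rule integral_has_real_derivative[OF h that])
  have "y r = H r" if r: "r \<in> {0..R}" for r
  proof -
    have "((\<lambda>l. h (l * r) * r) has_integral H (1 * r) - H (0 * r)) {0..1}"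
    proof (rule fundamental_theorem_of_calculus)
      fix l :: real assume l: "l \<in> {0..1}"
      have "((\<lambda>l. l * r) has_real_derivative r) (at l within {0..1})"
        by (auto intro!: derivative_eq_intros)
      moreover have lr: "l * r \<in> {0..R}" if "l \<in> {0..1}" for l
        using that r mult_left_le_one_le[of r l] by auto
      moreover have "(H has_real_derivative h (l * r)) (at (l * r) within (\<lambda>l. l * r) ` {0..1})"
        by (rule has_field_derivative_subset[OF H[OF lr[OF l]]]) (use lr in auto)
      ultimately have "((\<lambda>l. H (l * r)) has_real_derivative h (l * r) * r) (at l within {0..1})"
        using DERIV_image_chain[of H "h (l * r)" "\<lambda>l. l * r" l "{0..1}" r] by (simp add: o_def)
      then show "((\<lambda>l. H (l * r)) has_vector_derivative h (l * r) * r) (at l within {0..1})"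
        by (simp add: has_real_derivative_iff_has_vector_derivative)
    qed simp
    then have "((\<lambda>l. r * h (l * r)) has_integral H r) {0..1}" by (simp add: H_def mult.commute)
    then show ?thesis using y[OF r] has_integral_unique by blast
  qed
  then show ?thesis
    using has_field_derivative_transform_within[OF H[OF \<open>r \<in> {0..R}\<close>] zero_less_one \<open>r \<in> {0..R}\<close>] by simp
qed

text \<open>\<open>r ^ (n + 1) * y r\<close> is the integral of \<open>s ^ n * h s\<close> over
  \<open>[0, r]\<close>. Thus \<open>y\<close> is the solution of
  \<open>r * y' = h - (n + 1) * y\<close> that stays bounded at \<open>r = 0\<close>; the case
  \<open>n = 2\<close> gives the equation for \<open>m\<close>.\<close>

lemma weighted_scaled_integral_derivative:
  fixes h :: "real \<Rightarrow> real"
  assumes h: "continuous_on {0..R} h"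
    and y: "\<And>r. r \<in> {0..R} \<Longrightarrow> ((\<lambda>l. l ^ n * h (l * r)) has_integral y r) {0..1}"
    and r: "0 < r" "r < R"
  shows "(y has_real_derivative (h r - (real n + 1) * y r) / r) (at r)"
proof -
  define z where "z r = r ^ Suc n * y r" for r
  have "((\<lambda>l. r * ((l * r) ^ n * h (l * r))) has_integral z r) {0..1}" if "r \<in> {0..R}" for r
    using has_integral_mult_right[OF y[OF that], of "r ^ Suc n"]
    by (simp add: z_def power_mult_distrib mult_ac)
  then have "(z has_real_derivative r ^ n * h r) (at r within {0..R})"
    using r by (intro scaled_integral_derivative[where h = "\<lambda>r. r ^ n * h r"])
      (auto intro!: continuous_intros h)
  then have z: "(z has_real_derivative r ^ n * h r) (at r)"
    using r at_within_Icc_at[of 0 r R] by simp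
  have "((\<lambda>r. z r / r ^ Suc n) has_real_derivative
     (r ^ n * h r * r ^ Suc n - z r * (real (Suc n) * r ^ n)) / (r ^ Suc n * r ^ Suc n)) (at r)"
    using r by (intro DERIV_divide z DERIV_power[of "\<lambda>r. r", THEN DERIV_cong]) (auto simp: DERIV_ident)
  moreover have "(r ^ n * h r * r ^ Suc n - z r * (real (Suc n) * r ^ n)) / (r ^ Suc n * r ^ Suc n)
      = (h r - (real n + 1) * y r) / r"
    using r by (simp add: z_def field_simps)
  moreover have "eventually (\<lambda>r. z r / r ^ Suc n = y r) (nhds r)"
    using r by (intro eventually_nhds_in_open[of "{0<..}", THEN eventually_mono]) (auto simp: z_def)
  ultimately show ?thesis
    using DERIV_cong_ev[of r r "\<lambda>r. z r / r ^ Suc n" y] by simp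
qed

text \<open>Here \<open>P = u0 + \<epsilon> x(r)\<close> with \<open>r = 1 - t / \<epsilon> \<in> [0, 2]\<close>, and
  \<open>theta\<close> is \<open>P' - 2\<close>. The system reads \<open>x' = - (2 + theta)\<close>, \<open>r m' = rhs - 3 m\<close>; its solutions
  that stay bounded at the singular point \<open>r = 0\<close> are those of
  \<open>m(r) = \<integral>\<^sub>0\<^sup>1 l\<^sup>2 rhs(l r) dl\<close>. The scaling of \<open>x\<close> gives \<open>rhs\<close> and
  \<open>theta\<close> Lipschitz constants of order \<open>\<epsilon>\<close>.\<close>

locale spine_equation =
  fixes f2 f3 g2 :: "real \<Rightarrow> real" and u0 \<epsilon> \<alpha> B c :: real
  assumes eps: "0 < \<epsilon>" "\<epsilon> \<le> 1" and alpha: "0 < \<alpha>" and c: "0 < c"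
    and cont: "continuous_on {u0 - 8 * \<epsilon>..u0 + 8 * \<epsilon>} f2"
      "continuous_on {u0 - 8 * \<epsilon>..u0 + 8 * \<epsilon>} f3" "continuous_on {u0 - 8 * \<epsilon>..u0 + 8 * \<epsilon>} g2"
    and lip: "\<And>x y. x \<in> {u0 - 8 * \<epsilon>..u0 + 8 * \<epsilon>} \<Longrightarrow> y \<in> {u0 - 8 * \<epsilon>..u0 + 8 * \<epsilon>} \<Longrightarrow>
      \<bar>f2 x - f2 y\<bar> \<le> B * \<bar>x - y\<bar> \<and> \<bar>g2 x - g2 y\<bar> \<le> B * \<bar>x - y\<bar> \<and> \<bar>f3 x - f3 y\<bar> \<le> B * \<bar>x - y\<bar>"
    and bound: "\<And>x. x \<in> {u0 - 8 * \<epsilon>..u0 + 8 * \<epsilon>} \<Longrightarrow> \<bar>f2 x\<bar> \<le> B \<and> \<bar>g2 x\<bar> \<le> B \<and> c / 2 \<le> f3 x \<and> f3 x \<le> 2 * c"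
    and gap: "\<And>x y. x \<in> {u0 - 8 * \<epsilon>..u0 + 8 * \<epsilon>} \<Longrightarrow> y \<in> {u0 - 8 * \<epsilon>..u0 + 8 * \<epsilon>} \<Longrightarrow> \<alpha> \<le> f2 x - g2 y"
begin

text \<open>This is \<open>\<kappa> - f\<^sub>-''(P - 2t)\<close> in scaled variables:
  \<open>\<epsilon> * r = \<epsilon> - t\<close> and
  \<open>\<epsilon> * (1 - r) = t\<close>.\<close>

definition denom :: "real \<Rightarrow> real \<Rightarrow> real \<Rightarrow> real" where
  "denom r x m = f2 (u0 + \<epsilon> * x) + \<epsilon> * r * m - g2 (u0 + \<epsilon> * (x - 2 * (1 - r)))"

text \<open>With \<open>\<kappa>' = m * P'\<close> the second equation for \<open>\<kappa>'\<close>
  is linear in \<open>P'\<close>; this is its solution for \<open>P' - 2\<close>, where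
  \<open>\<epsilon> * (2 - r) = \<epsilon> + t\<close>.\<close>

definition theta :: "real \<Rightarrow> real \<Rightarrow> real \<Rightarrow> real" where
  "theta r x m = 2 * (\<epsilon> * (2 - r) * m) / (denom r x m - \<epsilon> * (2 - r) * m)"

text \<open>Differentiating \<open>\<kappa> = f\<^sub>+''(P) + (\<epsilon> - t) * m\<close> in
  \<open>t\<close> and inserting \<open>\<kappa>' = m * P'\<close> gives
  \<open>(\<epsilon> - t) * m' = 3 * m - rhs\<close>.\<close>

definition rhs :: "real \<Rightarrow> real \<Rightarrow> real \<Rightarrow> real" where
  "rhs r x m = 2 * f3 (u0 + \<epsilon> * x) + (f3 (u0 + \<epsilon> * x) - m) * theta r x m"

text \<open>The 16 is 4, from \<open>2 * (\<epsilon> + t) \<le> 4 * \<epsilon>\<close>, over two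
  denominators that are each at least \<open>\<alpha> / 2\<close>. The bracket bounds the cross
  difference of the numerators.\<close>

definition theta_lip :: real where
  "theta_lip = 16 / \<alpha>\<^sup>2 * (2 * c * (2 * B + 2) + 2 * B + 4 * c)"

text \<open>The sum of the two coordinate differences is at most twice the norm. This doubles the
  Lipschitz constant of \<open>rhs\<close>, and that of \<open>theta\<close>, which is also
  multiplied by \<open>r \<le> 2\<close>.\<close>

definition contraction_const :: real where
  "contraction_const = 4 * theta_lip + 2 * (2 * B + (B + 1) * (16 * c / \<alpha>) + 2 * c * theta_lip)"

section \<open>Bounds and Lipschitz constants on the box \<open>x\<close> in [-5, 5],
  \<open>m\<close> in [0, 2c]\<close>

lemma mem:
  assumes "x \<in> {-5..5}" shows "u0 + \<epsilon> * x \<in> {u0 - 8 * \<epsilon>..u0 + 8 * \<epsilon>}"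
proof -
  have "\<epsilon> * (-5) \<le> \<epsilon> * x" "\<epsilon> * x \<le> \<epsilon> * 5" using assms eps by (intro mult_left_mono; simp)+
  then show ?thesis using eps by auto
qed

lemma mem':
  assumes "x \<in> {-5..5}" "r \<in> {0..2}"
  shows "u0 + \<epsilon> * (x - 2 * (1 - r)) \<in> {u0 - 8 * \<epsilon>..u0 + 8 * \<epsilon>}"
proof -
  have "\<epsilon> * (-8) \<le> \<epsilon> * (x - 2 * (1 - r))" "\<epsilon> * (x - 2 * (1 - r)) \<le> \<epsilon> * 8"
    using assms eps by (intro mult_left_mono; simp)+
  then show ?thesis by auto
qed

lemma B_nonneg: "0 \<le> B" using bound[of u0] eps by auto

lemma theta_lip_nonneg: "0 \<le> theta_lip" using B_nonneg c by (auto simp: theta_lip_def)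

lemma em_le:
  assumes "r \<in> {0..2}" "m \<in> {0..2 * c}"
  shows "0 \<le> \<epsilon> * (2 - r) * m" "\<epsilon> * (2 - r) * m \<le> 4 * \<epsilon> * c"
    "0 \<le> \<epsilon> * r * m" "\<epsilon> * r * m \<le> 4 * \<epsilon> * c"
proof -
  have "(2 - r) * m \<le> 2 * (2 * c)" "r * m \<le> 2 * (2 * c)" using assms c by (intro mult_mono; auto)+
  then have "\<epsilon> * ((2 - r) * m) \<le> \<epsilon> * (2 * (2 * c))" "\<epsilon> * (r * m) \<le> \<epsilon> * (2 * (2 * c))"
    using eps by (auto intro!: mult_left_mono simp del: mult_le_cancel_left)
  then show "\<epsilon> * (2 - r) * m \<le> 4 * \<epsilon> * c" "\<epsilon> * r * m \<le> 4 * \<epsilon> * c" by (auto simp: mult_ac)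
  show "0 \<le> \<epsilon> * (2 - r) * m" "0 \<le> \<epsilon> * r * m" using assms eps by auto
qed

lemma denom_ge:
  assumes "r \<in> {0..2}" "x \<in> {-5..5}" "m \<in> {0..2 * c}"
  shows "\<alpha> \<le> denom r x m"
  using gap[OF mem[OF assms(2)] mem'[OF assms(2,1)]] em_le(3)[OF assms(1,3)] unfolding denom_def by linarith

lemma denom_le:
  assumes "r \<in> {0..2}" "x \<in> {-5..5}" "m \<in> {0..2 * c}"
  shows "denom r x m \<le> 2 * B + 4 * c"
proof -
  have "\<epsilon> * c \<le> 1 * c" using eps c by (intro mult_right_mono) auto
  then show ?thesis
    using bound[OF mem[of x]] bound[OF mem'[of x r]] em_le[of r m] assms by (auto simp: denom_def)
qed

lemma denom_lip:
  assumes "r \<in> {0..2}" "x \<in> {-5..5}" "m \<in> {0..2 * c}" "x' \<in> {-5..5}" "m' \<in> {0..2 * c}"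
  shows "\<bar>denom r x m - denom r x' m'\<bar> \<le> \<epsilon> * (2 * B + 2) * (\<bar>x - x'\<bar> + \<bar>m - m'\<bar>)"
proof -
  have "\<bar>f2 (u0 + \<epsilon> * x) - f2 (u0 + \<epsilon> * x')\<bar> \<le> B * \<bar>\<epsilon> * (x - x')\<bar>"
    using lip[OF mem[of x] mem[of x']] assms by (auto simp: algebra_simps)
  moreover have "\<bar>g2 (u0 + \<epsilon> * (x - 2 * (1 - r))) - g2 (u0 + \<epsilon> * (x' - 2 * (1 - r)))\<bar> \<le> B * \<bar>\<epsilon> * (x - x')\<bar>"
    using lip[OF mem'[of x r] mem'[of x' r]] assms by (auto simp: algebra_simps)
  moreover have "\<bar>\<epsilon> * r * m - \<epsilon> * r * m'\<bar> \<le> \<epsilon> * 2 * \<bar>m - m'\<bar>"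
  proof -
    have "\<epsilon> * r * m - \<epsilon> * r * m' = \<epsilon> * r * (m - m')" by (simp add: algebra_simps)
    then have "\<bar>\<epsilon> * r * m - \<epsilon> * r * m'\<bar> = \<epsilon> * r * \<bar>m - m'\<bar>" using assms eps by (simp add: abs_mult)
    also have "\<dots> \<le> \<epsilon> * 2 * \<bar>m - m'\<bar>" using assms eps by (intro mult_right_mono) auto
    finally show ?thesis .
  qed
  ultimately have "\<bar>denom r x m - denom r x' m'\<bar> \<le> 2 * (B * \<bar>\<epsilon> * (x - x')\<bar>) + \<epsilon> * 2 * \<bar>m - m'\<bar>"
    unfolding denom_def by linarith
  also have "\<dots> = \<epsilon> * (2 * B) * \<bar>x - x'\<bar> + \<epsilon> * 2 * \<bar>m - m'\<bar>" using eps by (simp add: abs_mult)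
  also have "\<dots> \<le> \<epsilon> * (2 * B + 2) * \<bar>x - x'\<bar> + \<epsilon> * (2 * B + 2) * \<bar>m - m'\<bar>"
    using B_nonneg eps by (intro add_mono mult_right_mono) auto
  finally show ?thesis by (simp add: distrib_left)
qed

end

text \<open>The constant 64 yields \<open>theta \<le> 1 / 4\<close>, which keeps the solution inside
  the box: \<open>x\<close> starts in [1, 3] and falls by at most 9/2, and \<open>m\<close> stays
  between \<open>c / 6\<close> and \<open>3 / 2 * c\<close>. The second condition makes the integral
  operator a contraction with factor 1/2.\<close>

locale small_spine_equation = spine_equation +
  assumes small: "64 * \<epsilon> * c \<le> \<alpha>" "\<epsilon> * contraction_const \<le> 1 / 2"
begin

lemma denom_ge2:
  assumes "r \<in> {0..2}" "x \<in> {-5..5}" "m \<in> {0..2 * c}"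
  shows "\<alpha> / 2 \<le> denom r x m - \<epsilon> * (2 - r) * m"
  using denom_ge[OF assms] em_le(2)[OF assms(1,3)] small(1) alpha by linarith

lemma theta_bounds:
  assumes "r \<in> {0..2}" "x \<in> {-5..5}" "m \<in> {0..2 * c}"
  shows "0 \<le> theta r x m" "theta r x m \<le> 16 * \<epsilon> * c / \<alpha>" "theta r x m \<le> 1 / 4"
proof -
  have d: "\<alpha> / 2 \<le> denom r x m - \<epsilon> * (2 - r) * m" by (rule denom_ge2[OF assms])
  show "0 \<le> theta r x m" unfolding theta_def
    using d alpha em_le[of r m] assms by (intro divide_nonneg_nonneg) auto
  have "2 * (\<epsilon> * (2 - r) * m) \<le> 2 * (4 * \<epsilon> * c)" using em_le[of r m] assms by linarith
  then have "theta r x m \<le> (2 * (4 * \<epsilon> * c)) / (\<alpha> / 2)"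
    unfolding theta_def using d alpha em_le[of r m] assms c eps by (intro frac_le) (auto simp del: mult_le_cancel_left_pos)
  then show *: "theta r x m \<le> 16 * \<epsilon> * c / \<alpha>" by simp
  have "16 * \<epsilon> * c / \<alpha> \<le> 1 / 4" using small alpha by (simp add: field_simps)
  then show "theta r x m \<le> 1 / 4" using * by simp
qed

text \<open>On a common denominator the products of \<open>m\<close> and \<open>m'\<close> with
  \<open>\<epsilon> * (2 - r)\<close> cancel, and the numerator is a multiple of
  \<open>m * D' - m' * D\<close>. The factor \<open>\<epsilon>\<close> is the one in the numerator
  of \<open>theta\<close>.\<close>

lemma theta_lipschitz:
  assumes "r \<in> {0..2}" "x \<in> {-5..5}" "m \<in> {0..2 * c}" "x' \<in> {-5..5}" "m' \<in> {0..2 * c}"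
  shows "\<bar>theta r x m - theta r x' m'\<bar> \<le> \<epsilon> * theta_lip * (\<bar>x - x'\<bar> + \<bar>m - m'\<bar>)"
proof -
  define e where "e = \<epsilon> * (2 - r)"
  define D where "D = denom r x m"
  define D' where "D' = denom r x' m'"
  define d where "d = \<bar>x - x'\<bar> + \<bar>m - m'\<bar>"
  have e: "0 \<le> e" "e \<le> 2 * \<epsilon>" using assms eps by (auto simp: e_def)
  have den: "\<alpha> / 2 \<le> D - e * m" "\<alpha> / 2 \<le> D' - e * m'"
    unfolding D_def D'_def e_def using denom_ge2 assms by auto
  then have pos: "0 < D - e * m" "0 < D' - e * m'" using alpha by linarith+
  have D: "0 \<le> D" "D \<le> 2 * B + 4 * c" "\<bar>D - D'\<bar> \<le> \<epsilon> * (2 * B + 2) * d"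
    using denom_ge[of r x m] denom_le[of r x m] denom_lip[of r x m x' m'] assms alpha
    by (auto simp: D_def D'_def d_def)
  have "\<bar>D - D'\<bar> \<le> (2 * B + 2) * d"
    using D(3) mult_right_mono[of \<epsilon> 1 "(2 * B + 2) * d"] eps B_nonneg by (auto simp: d_def mult_ac)
  have num: "\<bar>m * D' - m' * D\<bar> \<le> (2 * c * (2 * B + 2) + 2 * B + 4 * c) * d"
  proof -
    have "m * D' - m' * D = m * (D' - D) + D * (m - m')" by (simp add: algebra_simps)
    then have "\<bar>m * D' - m' * D\<bar> \<le> \<bar>m * (D' - D)\<bar> + \<bar>D * (m - m')\<bar>" by linarith
    also have "\<dots> = m * \<bar>D - D'\<bar> + D * \<bar>m - m'\<bar>" using assms D by (simp add: abs_mult abs_minus_commute)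
    also have "\<dots> \<le> (2 * c) * ((2 * B + 2) * d) + (2 * B + 4 * c) * d"
      using \<open>\<bar>D - D'\<bar> \<le> (2 * B + 2) * d\<close> assms D c B_nonneg by (intro add_mono mult_mono) (auto simp: d_def)
    finally show ?thesis by (simp add: algebra_simps)
  qed
  have "theta r x m - theta r x' m' = 2 * e * (m * D' - m' * D) / ((D - e * m) * (D' - e * m'))"
  proof -
    have "theta r x m = 2 * (e * m) / (D - e * m)" "theta r x' m' = 2 * (e * m') / (D' - e * m')"
      by (auto simp: theta_def e_def D_def D'_def)
    then show ?thesis using pos by (simp add: diff_frac_eq) (simp add: algebra_simps)
  qed
  then have "\<bar>theta r x m - theta r x' m'\<bar> = 2 * e * \<bar>m * D' - m' * D\<bar> / ((D - e * m) * (D' - e * m'))"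
    using e pos by (simp add: abs_mult)
  also have "\<dots> \<le> 2 * (2 * \<epsilon>) * ((2 * c * (2 * B + 2) + 2 * B + 4 * c) * d) / ((\<alpha> / 2) * (\<alpha> / 2))"
    using e num den pos alpha eps by (intro frac_le mult_mono mult_nonneg_nonneg order_trans[OF abs_ge_zero num]) auto
  also have "\<dots> = \<epsilon> * theta_lip * d"
    using alpha by (simp add: theta_lip_def field_simps power2_eq_square)
  finally show ?thesis by (simp add: d_def)
qed

text \<open>The difference \<open>m - m'\<close> carries no factor \<open>\<epsilon>\<close> of its
  own, but it is multiplied by \<open>theta\<close>, which is of order \<open>\<epsilon>\<close>.
  The terms with \<open>f3\<close> gain theirs from the scaling of \<open>x\<close>.\<close>

lemma rhs_lipschitz:
  assumes "r \<in> {0..2}" "x \<in> {-5..5}" "m \<in> {0..2 * c}" "x' \<in> {-5..5}" "m' \<in> {0..2 * c}"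
  shows "\<bar>rhs r x m - rhs r x' m'\<bar> \<le> \<epsilon> * (2 * B + (B + 1) * (16 * c / \<alpha>) + 2 * c * theta_lip) * (\<bar>x - x'\<bar> + \<bar>m - m'\<bar>)"
proof -
  define d where "d = \<bar>x - x'\<bar> + \<bar>m - m'\<bar>"
  define a where "a = f3 (u0 + \<epsilon> * x)"
  define a' where "a' = f3 (u0 + \<epsilon> * x')"
  define T where "T = theta r x m"
  define T' where "T' = theta r x' m'"
  have d: "0 \<le> d" "\<bar>m - m'\<bar> \<le> d" by (auto simp: d_def)
  have "\<bar>a - a'\<bar> \<le> B * \<bar>\<epsilon> * (x - x')\<bar>"
    using lip[OF mem[of x] mem[of x']] assms by (auto simp: algebra_simps a_def a'_def)
  also have "\<dots> = \<epsilon> * B * \<bar>x - x'\<bar>" using eps by (simp add: abs_mult)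
  also have "\<dots> \<le> \<epsilon> * B * d" using eps B_nonneg by (intro mult_left_mono) (auto simp: d_def)
  finally have a: "\<bar>a - a'\<bar> \<le> \<epsilon> * B * d" .
  also have "\<dots> \<le> 1 * B * d" using eps B_nonneg d by (intro mult_right_mono) auto
  finally have a1: "\<bar>a - a'\<bar> \<le> B * d" by simp
  have T: "0 \<le> T" "T \<le> \<epsilon> * (16 * c / \<alpha>)" using theta_bounds(1,2)[OF assms(1-3)] by (auto simp: T_def mult_ac)
  have dT: "\<bar>T - T'\<bar> \<le> \<epsilon> * theta_lip * d" using theta_lipschitz assms by (auto simp: T_def T'_def d_def)
  have am: "\<bar>a' - m'\<bar> \<le> 2 * c" using bound[OF mem[of x']] assms c by (auto simp: a'_def)
  have eq: "rhs r x m - rhs r x' m' = 2 * (a - a') + ((a - a') - (m - m')) * T + (a' - m') * (T - T')"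
    unfolding rhs_def a_def[symmetric] a'_def[symmetric] T_def[symmetric] T'_def[symmetric]
    by (simp add: algebra_simps)
  have "\<bar>rhs r x m - rhs r x' m'\<bar> \<le> 2 * \<bar>a - a'\<bar> + (\<bar>a - a'\<bar> + \<bar>m - m'\<bar>) * T + \<bar>a' - m'\<bar> * \<bar>T - T'\<bar>"
  proof -
    have q: "\<bar>((a - a') - (m - m')) * T\<bar> \<le> (\<bar>a - a'\<bar> + \<bar>m - m'\<bar>) * T"
      unfolding abs_mult using T by (intro mult_mono) auto
    have "\<bar>2 * p + q + t\<bar> \<le> 2 * \<bar>p\<bar> + \<bar>q\<bar> + \<bar>t\<bar>" for p q t :: real by linarith
    then show ?thesis unfolding eq
      by (rule order_trans) (intro add_mono order_refl q eq_refl[OF abs_mult])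
  qed
  also have "\<dots> \<le> 2 * (\<epsilon> * B * d) + (B * d + d) * (\<epsilon> * (16 * c / \<alpha>)) + 2 * c * (\<epsilon> * theta_lip * d)"
    using a a1 T dT am d c B_nonneg by (intro add_mono mult_mono) auto
  also have "2 * (\<epsilon> * B * d) + (B * d + d) * (\<epsilon> * g) + 2 * c * (\<epsilon> * theta_lip * d)
      = \<epsilon> * (2 * B + (B + 1) * g + 2 * c * theta_lip) * d" for g
    by (simp add: algebra_simps)
  finally show ?thesis by (simp add: d_def)
qed

lemma continuous_theta:
  assumes "continuous_on S r" "continuous_on S x" "continuous_on S m"
    and "\<And>s. s \<in> S \<Longrightarrow> r s \<in> {0..2} \<and> x s \<in> {-5..5} \<and> m s \<in> {0..2 * c}"
  shows "continuous_on S (\<lambda>s. theta (r s) (x s) (m s))"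
proof -
  have "denom (r s) (x s) (m s) - \<epsilon> * (2 - r s) * m s \<noteq> 0" if "s \<in> S" for s
    using denom_ge2[of "r s" "x s" "m s"] assms(4)[OF that] alpha by auto
  then show ?thesis unfolding theta_def denom_def
    by (intro continuous_intros assms continuous_on_compose2[OF cont(1)] continuous_on_compose2[OF cont(3)])
      (use mem mem' assms(4) in \<open>fastforce simp: image_subset_iff\<close>)+
qed

lemma continuous_rhs:
  assumes "continuous_on S r" "continuous_on S x" "continuous_on S m"
    and "\<And>s. s \<in> S \<Longrightarrow> r s \<in> {0..2} \<and> x s \<in> {-5..5} \<and> m s \<in> {0..2 * c}"
  shows "continuous_on S (\<lambda>s. rhs (r s) (x s) (m s))"
  unfolding rhs_def
  by (intro continuous_intros continuous_theta assms continuous_on_compose2[OF cont(2)])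
    (use mem assms(4) in \<open>fastforce simp: image_subset_iff\<close>)+

text \<open>\<open>2 * f3\<close> lies between \<open>c\<close> and \<open>4 * c\<close>, and the
  correction is at most \<open>c / 2\<close>. The positive lower bound is the source of the sign of
  \<open>m\<close>.\<close>

lemma rhs_bounds:
  assumes "r \<in> {0..2}" "x \<in> {-5..5}" "m \<in> {0..2 * c}"
  shows "c / 2 \<le> rhs r x m" "rhs r x m \<le> 9 / 2 * c"
proof -
  have a: "\<bar>f3 (u0 + \<epsilon> * x) - m\<bar> \<le> 2 * c" and b: "c / 2 \<le> f3 (u0 + \<epsilon> * x)" "f3 (u0 + \<epsilon> * x) \<le> 2 * c"
    using bound[OF mem[of x]] assms c by auto
  have "\<bar>(f3 (u0 + \<epsilon> * x) - m) * theta r x m\<bar> \<le> 2 * c * (1 / 4)"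
    unfolding abs_mult using a theta_bounds[OF assms] c by (intro mult_mono) auto
  then show "c / 2 \<le> rhs r x m" "rhs r x m \<le> 9 / 2 * c" using b by (auto simp: rhs_def)
qed

text \<open>The interval for \<open>x1\<close> is the scaled range of
  \<open>u\<^sub>+ + \<epsilon>\<close>. The truncations \<open>cx\<close> and \<open>cm\<close>
  make the operator globally Lipschitz. Since the bounds on \<open>theta\<close> and
  \<open>rhs\<close> hold for truncated arguments, they show afterwards that the solution never
  leaves the box.\<close>

lemma spine_fixed_point:
  assumes x1: "x1 \<in> {1..3}"
  obtains x m where "continuous_on {0..2} x" "continuous_on {0..2} m"
    "\<And>r. r \<in> {0..2} \<Longrightarrow> x r \<in> {-5..5} \<and> m r \<in> {0..2 * c} \<and> 0 < m r"
    "x 0 = x1"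
    "\<And>r. r \<in> {0..2} \<Longrightarrow> (x has_real_derivative - (2 + theta r (x r) (m r))) (at r within {0..2})"
    "\<And>r. 0 < r \<Longrightarrow> r < 2 \<Longrightarrow> (m has_real_derivative (rhs r (x r) (m r) - 3 * m r) / r) (at r)"
proof -
  define cx where "cx x = max (-5) (min x 5)" for x :: real
  define cm where "cm m = max 0 (min m (2 * c))" for m :: real
  have cx: "cx x \<in> {-5..5}" "\<bar>cx x - cx x'\<bar> \<le> \<bar>x - x'\<bar>" for x x' by (auto simp: cx_def)
  have cm: "cm x \<in> {0..2*c}" "\<bar>cm x - cm x'\<bar> \<le> \<bar>x - x'\<bar>" for x x' using c by (auto simp: cm_def)
  \<comment> \<open>Both components are averages over \<open>l\<close>: the first integrates
    \<open>x'\<close> from the value \<open>x1\<close> at \<open>r = 0\<close>, and the weight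
    \<open>l\<^sup>2\<close> of the second selects the \<open>m\<close> that is bounded
    there.\<close>
  define F where "F l r y = (x1 - r * (2 + theta (l * r) (cx (fst y)) (cm (snd y))),
      l\<^sup>2 * rhs (l * r) (cx (fst y)) (cm (snd y)))" for l r and y :: "real \<times> real"
  have lr: "l * r \<in> {0..2}" if "l \<in> {0..1}" "r \<in> {0..2}" for l r :: real
    using that mult_mono[of l 1 r 2] by auto
  have "\<exists>y. continuous_on {0..2} y \<and> (\<forall>s\<in>{0..2}. ((\<lambda>l. F l s (y (l * s))) has_integral y s) {0..1})"
  proof (rule integral_fixed_point[where c = "1/2" and M = "9 + 5 * c"])
    show "continuous_on ({0..1} \<times> {0..2} \<times> UNIV) (\<lambda>(l, s, y). F l s y)"
      unfolding F_def split_def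
      by (intro continuous_intros continuous_theta continuous_rhs)
        (use lr cx cm in \<open>auto intro!: continuous_intros simp: cx_def[abs_def] cm_def[abs_def]\<close>)
    fix l s :: real and y z :: "real \<times> real"
    assume l: "l \<in> {0..1}" and s: "s \<in> {0..2}"
    note ls = lr[OF l s]
    have "\<bar>x1 - s * (2 + theta (l * s) (cx (fst y)) (cm (snd y)))\<bar> \<le> 9"
    proof -
      have "s * (2 + theta (l * s) (cx (fst y)) (cm (snd y))) \<le> 2 * (2 + 1/4)"
        using s theta_bounds[OF ls cx(1) cm(1)] by (intro mult_mono) auto
      moreover have "0 \<le> s * (2 + theta (l * s) (cx (fst y)) (cm (snd y)))"
        using s theta_bounds[OF ls cx(1) cm(1), of "fst y" "snd y"] by auto
      ultimately show ?thesis using x1 by auto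
    qed
    moreover have "\<bar>l\<^sup>2 * rhs (l * s) (cx (fst y)) (cm (snd y))\<bar> \<le> 1 * (5 * c)"
      unfolding abs_mult using l c rhs_bounds[OF ls cx(1) cm(1), of "fst y" "snd y"]
      by (intro mult_mono) (auto simp: power_le_one)
    ultimately show "norm (F l s y) \<le> 9 + 5 * c"
      unfolding F_def by (intro order_trans[OF norm_Pair_le]) auto
    define d where "d = norm (y - z)"
    have "\<bar>fst y - fst z\<bar> \<le> d" "\<bar>snd y - snd z\<bar> \<le> d"
      using norm_fst_le[of "fst (y - z)" "snd (y - z)"] norm_snd_le[of "snd (y - z)" "fst (y - z)"]
      by (simp_all add: d_def minus_prod_def)
    then have yz: "\<bar>cx (fst y) - cx (fst z)\<bar> + \<bar>cm (snd y) - cm (snd z)\<bar> \<le> 2 * d"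
      using cx(2)[of "fst y" "fst z"] cm(2)[of "snd y" "snd z"] by linarith
    define dd where "dd = \<bar>cx (fst y) - cx (fst z)\<bar> + \<bar>cm (snd y) - cm (snd z)\<bar>"
    define C where "C = 2 * B + (B + 1) * (16 * c / \<alpha>) + 2 * c * theta_lip"
    have dd: "dd \<le> 2 * d" using yz by (simp add: dd_def)
    have C: "0 \<le> C" using B_nonneg c alpha theta_lip_nonneg by (simp add: C_def)
    have "\<bar>s * (theta (l * s) (cx (fst y)) (cm (snd y)) - theta (l * s) (cx (fst z)) (cm (snd z)))\<bar>
        \<le> 2 * (\<epsilon> * theta_lip * (2 * d))"
    proof -
      have "\<bar>theta (l * s) (cx (fst y)) (cm (snd y)) - theta (l * s) (cx (fst z)) (cm (snd z))\<bar> \<le> \<epsilon> * theta_lip * dd"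
        unfolding dd_def by (rule theta_lipschitz) (use ls cx cm in auto)
      also have "\<dots> \<le> \<epsilon> * theta_lip * (2 * d)" using dd eps theta_lip_nonneg by (intro mult_left_mono) auto
      finally show ?thesis unfolding abs_mult using s by (intro mult_mono) auto
    qed
    moreover have "\<bar>l\<^sup>2 * (rhs (l * s) (cx (fst y)) (cm (snd y)) - rhs (l * s) (cx (fst z)) (cm (snd z)))\<bar>
        \<le> 1 * (\<epsilon> * C * (2 * d))"
    proof -
      have "\<bar>rhs (l * s) (cx (fst y)) (cm (snd y)) - rhs (l * s) (cx (fst z)) (cm (snd z))\<bar> \<le> \<epsilon> * C * dd"
        unfolding dd_def C_def by (rule rhs_lipschitz) (use ls cx cm in auto)
      also have "\<dots> \<le> \<epsilon> * C * (2 * d)" using dd eps C by (intro mult_left_mono) auto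
      finally show ?thesis unfolding abs_mult using l by (intro mult_mono) (auto simp: power_le_one)
    qed
    moreover have "F l s y - F l s z =
      (- (s * (theta (l * s) (cx (fst y)) (cm (snd y)) - theta (l * s) (cx (fst z)) (cm (snd z)))),
       l\<^sup>2 * (rhs (l * s) (cx (fst y)) (cm (snd y)) - rhs (l * s) (cx (fst z)) (cm (snd z))))"
      by (simp add: F_def algebra_simps)
    ultimately have "norm (F l s y - F l s z) \<le> 2 * (\<epsilon> * theta_lip * (2 * d)) + 1 * (\<epsilon> * C * (2 * d))"
      by (auto intro!: order_trans[OF norm_Pair_le])
    also have "\<dots> = \<epsilon> * contraction_const * d" by (simp add: contraction_const_def C_def algebra_simps)
    also have "\<dots> \<le> 1 / 2 * d" using small(2) by (intro mult_right_mono) (auto simp: d_def)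
    finally show "norm (F l s y - F l s z) \<le> 1 / 2 * norm (y - z)" by (simp add: d_def)
  qed (use c in auto)
  then obtain y where y: "continuous_on {0..2} y"
    "\<And>s. s \<in> {0..2} \<Longrightarrow> ((\<lambda>l. F l s (y (l * s))) has_integral y s) {0..1}" by blast
  define x where "x s = fst (y s)" for s
  define m where "m s = snd (y s)" for s
  define th where "th r = 2 + theta r (cx (x r)) (cm (m r))" for r
  define rh where "rh r = rhs r (cx (x r)) (cm (m r))" for r
  have cont_xm: "continuous_on {0..2} x" "continuous_on {0..2} m"
    unfolding x_def[abs_def] m_def[abs_def] by (intro continuous_intros y)+
  have cont_th: "continuous_on {0..2} th" "continuous_on {0..2} rh"
    unfolding th_def[abs_def] rh_def[abs_def]
    by (intro continuous_intros continuous_theta continuous_rhs;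
      (use cx cm in \<open>auto intro!: continuous_intros cont_xm simp: cx_def[abs_def] cm_def[abs_def]\<close>))+
  have int_x: "((\<lambda>l. x1 - s * th (l * s)) has_integral x s) {0..1}"
    and int_m: "((\<lambda>l. l\<^sup>2 * rh (l * s)) has_integral m s) {0..1}" if "s \<in> {0..2}" for s
    using has_integral_linear[OF y(2)[OF that] bounded_linear_fst] has_integral_linear[OF y(2)[OF that] bounded_linear_snd]
    by (simp_all add: o_def F_def x_def m_def th_def rh_def)
  have int_x': "((\<lambda>l. s * th (l * s)) has_integral x1 - x s) {0..1}" if "s \<in> {0..2}" for s
    using has_integral_diff[OF has_integral_const_real[of x1 0 1] int_x[OF that]] by simp
  have "x1 - x 0 = 0" using int_x'[of 0] by (simp add: has_integral_0_eq)
  then have x0: "x 0 = x1" by simp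
  have x_der: "(x has_real_derivative - th r) (at r within {0..2})" if r: "r \<in> {0..2}" for r
    using DERIV_diff[OF DERIV_const[of x1] scaled_integral_derivative[OF cont_th(1) int_x' r]] by simp
  have xr: "x r \<in> {-5..5}" if r: "r \<in> {0..2}" for r
  proof -
    have "0 \<le> th (l * r)" "th (l * r) \<le> 9 / 4" if "l \<in> {0..1}" for l
      using theta_bounds[OF lr[OF that r] cx(1) cm(1), of "x (l * r)" "m (l * r)"] by (auto simp: th_def)
    then have "0 \<le> r * th (l * r)" and "r * th (l * r) \<le> 2 * (9 / 4)" if "l \<in> {0..1}" for l
      using that r by (simp, intro mult_mono) auto
    then have "0 \<le> x1 - x r" "x1 - x r \<le> (1 - 0) * (2 * (9 / 4))"
      using has_integral_nonneg[OF int_x'[OF r]] has_integral_le[OF int_x'[OF r] has_integral_const_real[of "2 * (9 / 4)" 0 1]]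
      by auto
    then show ?thesis using x1 by auto
  qed
  have mr: "m r \<in> {c / 6..2 * c}" if r: "r \<in> {0..2}" for r
  proof -
    have b: "c / 2 \<le> rh (l * r)" "rh (l * r) \<le> 9 / 2 * c" if "l \<in> {0..1}" for l
      using rhs_bounds[OF lr[OF that r] cx(1) cm(1), of "x (l * r)" "m (l * r)"] by (auto simp: rh_def)
    have sq: "((\<lambda>l. l\<^sup>2 * k) has_integral k / 3) {0..1}" for k :: real
    proof -
      have "((\<lambda>l. l\<^sup>2 * k) has_integral 1 ^ 3 / 3 * k - 0 ^ 3 / 3 * k) {0..1}"
        by (rule fundamental_theorem_of_calculus)
          (auto intro!: derivative_eq_intros simp: has_real_derivative_iff_has_vector_derivative[symmetric])
      then show ?thesis by simp
    qed
    have "l\<^sup>2 * (c / 2) \<le> l\<^sup>2 * rh (l * r)" "l\<^sup>2 * rh (l * r) \<le> l\<^sup>2 * (9 / 2 * c)" if "l \<in> {0..1}" for l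
      using mult_left_mono[OF b(1)[OF that], of "l\<^sup>2"] mult_left_mono[OF b(2)[OF that], of "l\<^sup>2"] by simp_all
    then have "c / 2 / 3 \<le> m r" "m r \<le> 9 / 2 * c / 3"
      using has_integral_le[OF sq int_m[OF r]] has_integral_le[OF int_m[OF r] sq] by blast+
    then show ?thesis using c by auto
  qed
  \<comment> \<open>From here on the truncations are inactive.\<close>
  have cl: "cx (x r) = x r" "cm (m r) = m r" if "r \<in> {0..2}" for r
    using xr[OF that] mr[OF that] c by (auto simp: cx_def cm_def)
  show thesis
  proof (rule that[OF cont_xm _ x0])
    show "x r \<in> {-5..5} \<and> m r \<in> {0..2 * c} \<and> 0 < m r" if "r \<in> {0..2}" for r
      using xr[OF that] mr[OF that] c by auto
    show "(x has_real_derivative - (2 + theta r (x r) (m r))) (at r within {0..2})" if "r \<in> {0..2}" for r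
      using x_der[OF that] cl[OF that] by (simp add: th_def)
    show "(m has_real_derivative (rhs r (x r) (m r) - 3 * m r) / r) (at r)" if "0 < r" "r < 2" for r
      using weighted_scaled_integral_derivative[OF cont_th(2) int_m that] cl[of r] that by (simp add: rh_def)
  qed
qed

text \<open>\<open>X1\<close> stands for \<open>u\<^sub>+ + \<epsilon>\<close>. The strict
  inequalities against \<open>\<kappa>\<close> are what lets concavity survive beyond the ends of
  the spine.\<close>

lemma spine_exists:
  fixes f1 g1 :: "real \<Rightarrow> real"
  assumes f1: "\<And>x. (f1 has_real_derivative f2 x) (at x)" and f2: "\<And>x. (f2 has_real_derivative f3 x) (at x)"
    and g1: "\<And>x. (g1 has_real_derivative g2 x) (at x)"
    and u0: "f1 u0 = g1 u0"
    and X1: "X1 \<in> {u0 + \<epsilon>..u0 + 3 * \<epsilon>}" "f1 X1 - g1 (X1 - 2 * \<epsilon>) - 2 * \<epsilon> * f2 X1 = 0"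
  obtains P P' \<kappa> \<kappa>' where
    "\<And>t. t \<in> {-\<epsilon>..\<epsilon>} \<Longrightarrow> (P has_real_derivative P' t) (at t within {-\<epsilon>..\<epsilon>})"
    "continuous_on {-\<epsilon>..\<epsilon>} P'" "\<And>t. t \<in> {-\<epsilon>..\<epsilon>} \<Longrightarrow> 2 \<le> P' t" "\<And>t. -\<epsilon> < t \<Longrightarrow> t \<le> \<epsilon> \<Longrightarrow> 2 < P' t"
    "continuous_on {-\<epsilon>..\<epsilon>} \<kappa>"
    "\<And>t. -\<epsilon> < t \<Longrightarrow> t < \<epsilon> \<Longrightarrow> (\<kappa> has_real_derivative \<kappa>' t) (at t) \<and> 0 \<le> \<kappa>' t
        \<and> (\<epsilon> - t) * \<kappa>' t = (\<kappa> t - f2 (P t)) * P' t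
        \<and> (\<epsilon> + t) * \<kappa>' t = (\<kappa> t - g2 (P t - 2 * t)) * (P' t - 2)"
    "\<And>t. t \<in> {-\<epsilon>..\<epsilon>} \<Longrightarrow> 2 * t * \<kappa> t = f1 (P t) - g1 (P t - 2 * t)"
    "\<And>t. t \<in> {-\<epsilon>..\<epsilon>} \<Longrightarrow> g2 (P t - 2 * t) < \<kappa> t"
    "f2 (P (-\<epsilon>)) < \<kappa> (-\<epsilon>)" "P \<epsilon> = X1" "P 0 = u0"
proof -
  define x1 where "x1 = (X1 - u0) / \<epsilon>"
  have X1_eq: "u0 + \<epsilon> * x1 = X1" using eps by (simp add: x1_def)
  have "x1 \<in> {1..3}" using X1(1) eps by (auto simp: x1_def field_simps)
  from spine_fixed_point[OF this] obtain x m where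
    cont_x: "continuous_on {0..2} x" and cont_m: "continuous_on {0..2} m"
    and xm: "\<And>r. r \<in> {0..2} \<Longrightarrow> x r \<in> {-5..5} \<and> m r \<in> {0..2 * c} \<and> 0 < m r"
    and x0: "x 0 = x1"
    and x: "\<And>r. r \<in> {0..2} \<Longrightarrow> (x has_real_derivative - (2 + theta r (x r) (m r))) (at r within {0..2})"
    and m: "\<And>r. 0 < r \<Longrightarrow> r < 2 \<Longrightarrow> (m has_real_derivative (rhs r (x r) (m r) - 3 * m r) / r) (at r)"
    by metis
  \<comment> \<open>Time runs backwards: \<open>r = 0\<close> is the singular end
    \<open>t = \<epsilon>\<close> and \<open>r = 2\<close> the end
    \<open>t = -\<epsilon>\<close>.\<close>
  define \<rho> where "\<rho> t = 1 - t / \<epsilon>" for t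
  define M where "M t = m (\<rho> t)" for t
  define \<theta> where "\<theta> t = theta (\<rho> t) (x (\<rho> t)) (M t)" for t
  define P where "P t = u0 + \<epsilon> * x (\<rho> t)" for t
  define P' where "P' t = 2 + \<theta> t" for t
  define \<kappa> where "\<kappa> t = f2 (P t) + (\<epsilon> - t) * M t" for t
  define \<kappa>' where "\<kappa>' t = M t * P' t" for t
  have \<rho>: "\<rho> t \<in> {0..2}" if "t \<in> {-\<epsilon>..\<epsilon>}" for t using that eps by (auto simp: \<rho>_def field_simps)
  have \<rho>': "0 < \<rho> t" "\<rho> t < 2" if "-\<epsilon> < t" "t < \<epsilon>" for t using that eps by (auto simp: \<rho>_def field_simps)
  have \<rho>2: "\<epsilon> * \<rho> t = \<epsilon> - t" "\<epsilon> * (2 - \<rho> t) = \<epsilon> + t" for t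
    using eps by (auto simp: \<rho>_def field_simps)
  have img: "\<rho> ` {-\<epsilon>..\<epsilon>} \<subseteq> {0..2}" using \<rho> by auto
  have \<rho>_der: "(\<rho> has_real_derivative - 1 / \<epsilon>) (at t within A)" for t A
    unfolding \<rho>_def[abs_def] using eps by (auto intro!: derivative_eq_intros)
  have cont_\<rho>: "continuous_on A \<rho>" for A
    unfolding \<rho>_def[abs_def] using eps by (intro continuous_intros) auto
  have cx: "continuous_on {-\<epsilon>..\<epsilon>} (\<lambda>t. x (\<rho> t))" and cM: "continuous_on {-\<epsilon>..\<epsilon>} M"
    unfolding M_def[abs_def]
    by (rule continuous_on_compose2[OF cont_x cont_\<rho> img] continuous_on_compose2[OF cont_m cont_\<rho> img])+
  have c\<theta>: "continuous_on {-\<epsilon>..\<epsilon>} \<theta>"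
    unfolding \<theta>_def[abs_def] using xm[OF \<rho>] \<rho> by (intro continuous_theta cont_\<rho> cx cM) (auto simp: M_def)
  have cP: "continuous_on {-\<epsilon>..\<epsilon>} P" unfolding P_def[abs_def] by (intro continuous_intros cx)
  have f2_cont: "continuous_on A f2" for A
    by (meson DERIV_continuous_on f2 has_field_derivative_at_within)
  have f1_cont: "continuous_on A f1" for A
    by (meson DERIV_continuous_on f1 has_field_derivative_at_within)
  have g1_cont: "continuous_on A g1" for A
    by (meson DERIV_continuous_on g1 has_field_derivative_at_within)
  have c\<kappa>: "continuous_on {-\<epsilon>..\<epsilon>} \<kappa>"
    unfolding \<kappa>_def[abs_def] by (intro continuous_intros cM continuous_on_compose2[OF f2_cont cP]) auto
  have P_der: "(P has_real_derivative P' t) (at t within {-\<epsilon>..\<epsilon>})" if t: "t \<in> {-\<epsilon>..\<epsilon>}" for t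
  proof -
    have "((\<lambda>t. x (\<rho> t)) has_real_derivative - (2 + \<theta> t) * (- 1 / \<epsilon>)) (at t within {-\<epsilon>..\<epsilon>})"
      using DERIV_image_chain[OF has_field_derivative_subset[OF x[OF \<rho>[OF t]] img] \<rho>_der]
      by (simp add: o_def \<theta>_def M_def)
    from DERIV_add[OF DERIV_const[of u0] DERIV_cmult[OF this, of \<epsilon>]] show ?thesis
      using eps by (simp add: P_def[abs_def] P'_def add.commute)
  qed
  have xm': "\<rho> t \<in> {0..2}" "x (\<rho> t) \<in> {-5..5}" "M t \<in> {0..2 * c}" "0 < M t" if "t \<in> {-\<epsilon>..\<epsilon>}" for t
    using xm[OF \<rho>[OF that]] \<rho>[OF that] by (auto simp: M_def)
  have \<theta>0: "0 \<le> \<theta> t" if "t \<in> {-\<epsilon>..\<epsilon>}" for t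
    unfolding \<theta>_def by (rule theta_bounds(1)[OF xm'(1-3)[OF that]])
  have den: "denom (\<rho> t) (x (\<rho> t)) (M t) = \<kappa> t - g2 (P t - 2 * t)" for t
  proof -
    have "\<epsilon> * (x (\<rho> t) - 2 * (1 - \<rho> t)) = \<epsilon> * x (\<rho> t) - 2 * (\<epsilon> - \<epsilon> * \<rho> t)" by (simp add: algebra_simps)
    then have arg: "u0 + \<epsilon> * (x (\<rho> t) - 2 * (1 - \<rho> t)) = P t - 2 * t" unfolding \<rho>2 by (simp add: P_def)
    show ?thesis unfolding denom_def arg by (simp add: \<kappa>_def P_def \<rho>2)
  qed
  have gap_\<kappa>: "\<alpha> \<le> \<kappa> t - g2 (P t - 2 * t)" if "t \<in> {-\<epsilon>..\<epsilon>}" for t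
    using denom_ge[OF xm'(1-3)[OF that]] by (simp add: den)
  have den2: "\<alpha> / 2 \<le> \<kappa> t - g2 (P t - 2 * t) - (\<epsilon> + t) * M t" if "t \<in> {-\<epsilon>..\<epsilon>}" for t
    using denom_ge2[OF xm'(1-3)[OF that]] by (simp add: den \<rho>2)
  have \<theta>_eq: "\<theta> t = 2 * ((\<epsilon> + t) * M t) / (\<kappa> t - g2 (P t - 2 * t) - (\<epsilon> + t) * M t)" for t
    by (simp add: \<theta>_def theta_def den \<rho>2)
  have eq3: "(\<epsilon> + t) * \<kappa>' t = (\<kappa> t - g2 (P t - 2 * t)) * (P' t - 2)" if "t \<in> {-\<epsilon>..\<epsilon>}" for t
  proof -
    define D e where "D = \<kappa> t - g2 (P t - 2 * t)" and "e = (\<epsilon> + t) * M t"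
    have "D - e \<noteq> 0" using den2[OF that] alpha by (simp add: D_def e_def)
    then have "e * (2 + 2 * e / (D - e)) = D * (2 * e / (D - e))" by (simp add: field_simps)
    then show ?thesis unfolding \<kappa>'_def P'_def \<theta>_eq D_def e_def by (simp add: mult.assoc)
  qed
  have eq2: "(\<epsilon> - t) * \<kappa>' t = (\<kappa> t - f2 (P t)) * P' t" for t
    by (simp add: \<kappa>'_def \<kappa>_def)
  have \<kappa>_der: "(\<kappa> has_real_derivative \<kappa>' t) (at t)" if t: "-\<epsilon> < t" "t < \<epsilon>" for t
  proof -
    have "(P has_real_derivative P' t) (at t)" using P_der[of t] at_within_Icc_at[of "-\<epsilon>" t \<epsilon>] t by simp
    then have "((\<lambda>t. f2 (P t)) has_real_derivative f3 (P t) * P' t) (at t)"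
      using DERIV_chain2[OF f2] by blast
    moreover have "(M has_real_derivative (rhs (\<rho> t) (x (\<rho> t)) (M t) - 3 * M t) / \<rho> t * (- 1 / \<epsilon>)) (at t)"
      using DERIV_chain2[OF m[OF \<rho>'[OF t]] \<rho>_der] by (simp add: M_def[abs_def])
    ultimately have "(\<kappa> has_real_derivative f3 (P t) * P' t + ((0 - 1) * M t +
        (rhs (\<rho> t) (x (\<rho> t)) (M t) - 3 * M t) / \<rho> t * (- 1 / \<epsilon>) * (\<epsilon> - t))) (at t)"
      unfolding \<kappa>_def[abs_def]
      by (intro DERIV_add DERIV_mult DERIV_diff DERIV_const DERIV_ident)
    moreover have "(rhs (\<rho> t) (x (\<rho> t)) (M t) - 3 * M t) / \<rho> t * (- 1 / \<epsilon>) * (\<epsilon> - t)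
        = 3 * M t - rhs (\<rho> t) (x (\<rho> t)) (M t)"
      unfolding \<rho>2(1)[symmetric] using \<rho>'[OF t] eps by (simp add: field_simps)
    moreover have "rhs (\<rho> t) (x (\<rho> t)) (M t) = 2 * f3 (P t) + (f3 (P t) - M t) * \<theta> t"
      by (simp add: rhs_def P_def \<theta>_def)
    ultimately show ?thesis by (simp add: \<kappa>'_def P'_def algebra_simps)
  qed
  have eq1: "2 * t * \<kappa> t = f1 (P t) - g1 (P t - 2 * t)" if t: "t \<in> {-\<epsilon>..\<epsilon>}" for t
  proof -
    \<comment> \<open>The defect of the spine relation. Its derivative is the difference of
      \<open>eq2\<close> and \<open>eq3\<close>, so it keeps its value at \<open>\<epsilon>\<close>,
      which is zero by the equation for \<open>X1\<close>.\<close>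
    define E where "E t = 2 * t * \<kappa> t - (f1 (P t) - g1 (P t - 2 * t))" for t
    have cE: "continuous_on {-\<epsilon>..\<epsilon>} E" unfolding E_def[abs_def]
      by (intro continuous_intros c\<kappa> continuous_on_compose2[OF f1_cont] continuous_on_compose2[OF g1_cont] cP) auto
    have E_der: "(E has_real_derivative 0) (at t)" if t: "-\<epsilon> < t" "t < \<epsilon>" for t
    proof -
      have P_t: "(P has_real_derivative P' t) (at t)" using P_der[of t] at_within_Icc_at[of "-\<epsilon>" t \<epsilon>] t by simp
      have Q_t: "((\<lambda>t. P t - 2 * t) has_real_derivative P' t - 2) (at t)"
        by (auto intro!: derivative_eq_intros P_t)
      have "((\<lambda>t. 2 * t * \<kappa> t) has_real_derivative 2 * \<kappa> t + \<kappa>' t * (2 * t)) (at t)"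
        using \<kappa>_der[OF t] by (auto intro!: derivative_eq_intros)
      then have "(E has_real_derivative (2 * \<kappa> t + \<kappa>' t * (2 * t)) - (f2 (P t) * P' t - g2 (P t - 2 * t) * (P' t - 2))) (at t)"
        unfolding E_def[abs_def] by (intro DERIV_diff DERIV_chain2[OF f1 P_t] DERIV_chain2[OF g1 Q_t])
      moreover have "2 * \<kappa> t + \<kappa>' t * (2 * t) - (f2 (P t) * P' t - g2 (P t - 2 * t) * (P' t - 2)) = 0"
        using eq2[of t] eq3[of t] t by (simp add: algebra_simps)
      ultimately show ?thesis by simp
    qed
    have E_const: "E t = E (-\<epsilon>)" if "t \<in> {-\<epsilon>..\<epsilon>}" for t
      by (rule DERIV_isconst2[of "-\<epsilon>" \<epsilon> E t, OF _ cE E_der]) (use that eps in auto)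
    have "E t = E \<epsilon>" using E_const[OF t] E_const[of \<epsilon>] eps by simp
    also have "E \<epsilon> = 0"
    proof -
      have "P \<epsilon> = X1" using eps by (simp add: P_def \<rho>_def x0 X1_eq)
      then show ?thesis using X1(2) by (simp add: E_def \<kappa>_def algebra_simps)
    qed
    finally show ?thesis by (simp add: E_def)
  qed
  \<comment> \<open>\<open>P 0\<close> and \<open>u0\<close> are zeros of \<open>f1 - g1\<close>,
    whose derivative is at least \<open>\<alpha>\<close> throughout the window.\<close>
  have P0: "P 0 = u0"
  proof (rule ccontr)
    assume ne: "P 0 \<noteq> u0"
    define h where "h x = f1 x - g1 x" for x
    have h_der: "(h has_real_derivative f2 x - g2 x) (at x)" for x
      unfolding h_def[abs_def] by (intro DERIV_diff f1 g1)
    have hc: "continuous_on A h" for A by (meson DERIV_continuous_on h_der has_field_derivative_at_within)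
    have h0: "h (P 0) = 0" "h u0 = 0" using eq1[of 0] eps u0 by (auto simp: h_def)
    have P0_mem: "P 0 \<in> {u0 - 8 * \<epsilon>..u0 + 8 * \<epsilon>}"
      unfolding P_def by (rule mem) (use xm'(2)[of 0] eps in auto)
    define a b where "a = min (P 0) u0" and "b = max (P 0) u0"
    have ab: "a < b" "h a = 0" "h b = 0" "{a..b} \<subseteq> {u0 - 8 * \<epsilon>..u0 + 8 * \<epsilon>}"
      using ne h0 P0_mem eps by (auto simp: a_def b_def min_def max_def)
    obtain z where z: "a < z" "z < b" "h b - h a = (b - a) * (f2 z - g2 z)"
      by (rule MVT_real_derivative[OF ab(1) hc h_der])
    have "z \<in> {u0 - 8 * \<epsilon>..u0 + 8 * \<epsilon>}" using z ab(4) by auto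
    then have "0 < f2 z - g2 z" using gap[of z z] alpha by auto
    then show False using z(3) ab by auto
  qed
  show thesis
  proof (rule that)
    show "(P has_real_derivative P' t) (at t within {-\<epsilon>..\<epsilon>})" if "t \<in> {-\<epsilon>..\<epsilon>}" for t by (rule P_der[OF that])
    show "continuous_on {-\<epsilon>..\<epsilon>} P'" unfolding P'_def[abs_def] by (intro continuous_intros c\<theta>)
    show "2 \<le> P' t" if "t \<in> {-\<epsilon>..\<epsilon>}" for t using \<theta>0[OF that] by (simp add: P'_def)
    \<comment> \<open>\<open>P' - 2\<close> carries the factor \<open>(\<epsilon> + t) * M t\<close>
      with \<open>M t\<close> positive, so it vanishes only at the lower end of the spine.\<close>
    show "2 < P' t" if "-\<epsilon> < t" "t \<le> \<epsilon>" for t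
      using den2[of t] xm'(4)[of t] alpha that by (auto simp: P'_def \<theta>_eq intro!: divide_pos_pos mult_pos_pos)
    show "continuous_on {-\<epsilon>..\<epsilon>} \<kappa>" by (rule c\<kappa>)
    show "(\<kappa> has_real_derivative \<kappa>' t) (at t) \<and> 0 \<le> \<kappa>' t
        \<and> (\<epsilon> - t) * \<kappa>' t = (\<kappa> t - f2 (P t)) * P' t
        \<and> (\<epsilon> + t) * \<kappa>' t = (\<kappa> t - g2 (P t - 2 * t)) * (P' t - 2)" if "-\<epsilon> < t" "t < \<epsilon>" for t
      using \<kappa>_der[OF that] eq2[of t] eq3[of t] that \<theta>0[of t] xm'(4)[of t] by (auto simp: \<kappa>'_def P'_def)
    show "2 * t * \<kappa> t = f1 (P t) - g1 (P t - 2 * t)" if "t \<in> {-\<epsilon>..\<epsilon>}" for t by (rule eq1[OF that])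
    show "g2 (P t - 2 * t) < \<kappa> t" if "t \<in> {-\<epsilon>..\<epsilon>}" for t using gap_\<kappa>[OF that] alpha by auto
    show "f2 (P (-\<epsilon>)) < \<kappa> (-\<epsilon>)" using xm'(4)[of "-\<epsilon>"] eps by (simp add: \<kappa>_def)
    show "P \<epsilon> = X1" using eps by (simp add: P_def \<rho>_def x0 X1_eq)
    show "P 0 = u0" by (rule P0)
  qed
qed

end

subsection \<open>The slopes along the ribs\<close>

lemma mem_closed_segment_antidiagonal:
  fixes a b c :: real
  assumes "b \<le> c"
  shows "x \<in> closed_segment (a, b) (a + b - c, c) \<longleftrightarrow> fst x + snd x = a + b \<and> b \<le> snd x \<and> snd x \<le> c"
proof
  assume "x \<in> closed_segment (a, b) (a + b - c, c)"
  then obtain s where s: "0 \<le> s" "s \<le> 1" "x = (1 - s) *\<^sub>R (a, b) + s *\<^sub>R (a + b - c, c)"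
    by (auto simp: in_segment)
  have "snd x = b + s * (c - b)" "fst x + snd x = a + b" using s(3) by (auto simp: algebra_simps)
  moreover have "0 \<le> s * (c - b)" "s * (c - b) \<le> c - b"
    using s assms by (auto intro: mult_left_le_one_le)
  ultimately show "fst x + snd x = a + b \<and> b \<le> snd x \<and> snd x \<le> c" by auto
next
  assume x: "fst x + snd x = a + b \<and> b \<le> snd x \<and> snd x \<le> c"
  show "x \<in> closed_segment (a, b) (a + b - c, c)"
  proof (cases "b = c")
    case True
    then have "x = (a, b)" using x by (auto simp: prod_eq_iff)
    then show ?thesis by simp
  next
    case False
    define s where "s = (snd x - b) / (c - b)"
    have "s * (c - b) = snd x - b" using False by (simp add: s_def)
    then have "x = (1 - s) *\<^sub>R (a, b) + s *\<^sub>R (a + b - c, c)"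
      using x by (auto simp: prod_eq_iff algebra_simps)
    moreover have "0 \<le> s" "s \<le> 1" using x assms False by (auto simp: s_def field_simps)
    ultimately show ?thesis by (auto simp: in_segment)
  qed
qed

lemma mem_closed_segment_diagonal:
  fixes a b c :: real
  assumes "c \<le> b"
  shows "x \<in> closed_segment (a, b) (a - b + c, c) \<longleftrightarrow> fst x - snd x = a - b \<and> c \<le> snd x \<and> snd x \<le> b"
proof
  assume "x \<in> closed_segment (a, b) (a - b + c, c)"
  then obtain s where s: "0 \<le> s" "s \<le> 1" "x = (1 - s) *\<^sub>R (a, b) + s *\<^sub>R (a - b + c, c)"
    by (auto simp: in_segment)
  have "snd x = b - s * (b - c)" "fst x - snd x = a - b" using s(3) by (auto simp: algebra_simps)
  moreover have "0 \<le> s * (b - c)" "s * (b - c) \<le> b - c"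
    using s assms by (auto intro: mult_left_le_one_le)
  ultimately show "fst x - snd x = a - b \<and> c \<le> snd x \<and> snd x \<le> b" by auto
next
  assume x: "fst x - snd x = a - b \<and> c \<le> snd x \<and> snd x \<le> b"
  show "x \<in> closed_segment (a, b) (a - b + c, c)"
  proof (cases "b = c")
    case True
    then have "x = (a, b)" using x by (auto simp: prod_eq_iff)
    then show ?thesis by simp
  next
    case False
    define s where "s = (b - snd x) / (b - c)"
    have "s * (b - c) = b - snd x" using False by (simp add: s_def)
    then have "x = (1 - s) *\<^sub>R (a, b) + s *\<^sub>R (a - b + c, c)"
      using x by (auto simp: prod_eq_iff algebra_simps)
    moreover have "0 \<le> s" "s \<le> 1" using x assms False by (auto simp: s_def field_simps)
    ultimately show ?thesis by (auto simp: in_segment)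
  qed
qed

text \<open>The spine is parametrised by the value \<open>t\<close> of \<open>T\<close>; \<open>pc t\<close> and \<open>pc t - 2 * t\<close> are the values of
  \<open>x\<^sub>1 + x\<^sub>2\<close> and \<open>x\<^sub>1 - x\<^sub>2\<close> at the spine point, and \<open>\<kappa>\<close> is the common derivative of the slopes of
  \<open>B\<close> along the two ribs. The endpoint \<open>t = \<epsilon>\<close> is singular for this system, so
  its equations are only required in the interior.\<close>

locale fissure =
  fixes \<epsilon> :: real and fp fp1 fp2 fm fm1 fm2 pc pc' \<kappa> \<kappa>' :: "real \<Rightarrow> real"
  assumes eps: "0 < \<epsilon>"
    and fp: "\<And>x. (fp has_real_derivative fp1 x) (at x)" and fp1: "\<And>x. (fp1 has_real_derivative fp2 x) (at x)"
    and fm: "\<And>x. (fm has_real_derivative fm1 x) (at x)" and fm1: "\<And>x. (fm1 has_real_derivative fm2 x) (at x)"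
    and pc: "\<And>t. t \<in> {-\<epsilon>..\<epsilon>} \<Longrightarrow> (pc has_real_derivative pc' t) (at t within {-\<epsilon>..\<epsilon>})"
    and pc'_cont: "continuous_on {-\<epsilon>..\<epsilon>} pc'"
    and pc'_ge: "\<And>t. t \<in> {-\<epsilon>..\<epsilon>} \<Longrightarrow> 2 \<le> pc' t" and pc'_gt: "\<And>t. -\<epsilon> < t \<Longrightarrow> t \<le> \<epsilon> \<Longrightarrow> 2 < pc' t"
    and \<kappa>_cont: "continuous_on {-\<epsilon>..\<epsilon>} \<kappa>"
    and \<kappa>: "\<And>t. -\<epsilon> < t \<Longrightarrow> t < \<epsilon> \<Longrightarrow> (\<kappa> has_real_derivative \<kappa>' t) (at t)"
    and \<kappa>'_nonneg: "\<And>t. -\<epsilon> < t \<Longrightarrow> t < \<epsilon> \<Longrightarrow> 0 \<le> \<kappa>' t"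
    and upper: "\<And>t. -\<epsilon> < t \<Longrightarrow> t < \<epsilon> \<Longrightarrow> (\<epsilon> - t) * \<kappa>' t = (\<kappa> t - fp2 (pc t - \<epsilon>)) * pc' t"
    and lower: "\<And>t. -\<epsilon> < t \<Longrightarrow> t < \<epsilon> \<Longrightarrow> (\<epsilon> + t) * \<kappa>' t = (\<kappa> t - fm2 (pc t - 2 * t - \<epsilon>)) * (pc' t - 2)"
    and spine: "\<And>t. t \<in> {-\<epsilon>..\<epsilon>} \<Longrightarrow> 2 * t * \<kappa> t = fp1 (pc t - \<epsilon>) - fm1 (pc t - 2 * t - \<epsilon>)"
begin

definition "qc t = pc t - 2 * t"
text \<open>The first coordinate of the spine point at height \<open>t\<close>; its inverse is the
  spine function.\<close>

definition "uc t = pc t - t"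
definition "vm = pc (-\<epsilon>)"
definition "up = qc \<epsilon>"

text \<open>With \<open>k = (A - f\<^sub>+) / (\<epsilon> - T)\<close> and \<open>l = (A - f\<^sub>-) / (\<epsilon> + T)\<close>, the slopes of \<open>B\<close> along the
  two ribs through a spine point, \<open>\<sigma> = (k + l) / 2\<close> and \<open>\<delta> = (k - l) / 2\<close>.\<close>

definition "\<sigma> t = fp1 (pc t - \<epsilon>) + (\<epsilon> - t) * \<kappa> t"
definition "\<delta> t = (2 * t * \<sigma> t - fp (pc t - \<epsilon>) + fm (qc t - \<epsilon>)) / (2 * \<epsilon>)"

lemma qc_ends: "qc (-\<epsilon>) = vm + 2 * \<epsilon>" "pc \<epsilon> = up + 2 * \<epsilon>"
  by (auto simp: qc_def vm_def up_def)

lemma lower_qc: "-\<epsilon> < t \<Longrightarrow> t < \<epsilon> \<Longrightarrow> (\<epsilon> + t) * \<kappa>' t = (\<kappa> t - fm2 (qc t - \<epsilon>)) * (pc' t - 2)"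
  using lower by (simp add: qc_def)

lemma spine_qc: "t \<in> {-\<epsilon>..\<epsilon>} \<Longrightarrow> 2 * t * \<kappa> t = fp1 (pc t - \<epsilon>) - fm1 (qc t - \<epsilon>)"
  using spine by (simp add: qc_def)

lemma \<sigma>_eq: "t \<in> {-\<epsilon>..\<epsilon>} \<Longrightarrow> \<sigma> t = fm1 (qc t - \<epsilon>) + (\<epsilon> + t) * \<kappa> t"
  using spine_qc by (simp add: \<sigma>_def algebra_simps)

text \<open>Both sides are the value at the spine point, computed along the upper and along the
  lower rib; \<open>\<delta>\<close> is the one number that makes them agree.\<close>

lemma spine_value_eq: "fp (pc t - \<epsilon>) + (\<epsilon> - t) * (\<sigma> t + \<delta> t) = fm (qc t - \<epsilon>) + (\<epsilon> + t) * (\<sigma> t - \<delta> t)"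
  using eps by (simp add: \<delta>_def field_simps)

lemma pc_at: "-\<epsilon> < t \<Longrightarrow> t < \<epsilon> \<Longrightarrow> (pc has_real_derivative pc' t) (at t)"
  using pc[of t] at_within_Icc_at[of "-\<epsilon>" t \<epsilon>] by simp

lemma qc: "t \<in> {-\<epsilon>..\<epsilon>} \<Longrightarrow> (qc has_real_derivative pc' t - 2) (at t within {-\<epsilon>..\<epsilon>})"
  unfolding qc_def[abs_def] by (auto intro!: derivative_eq_intros pc)

lemma qc_at: "-\<epsilon> < t \<Longrightarrow> t < \<epsilon> \<Longrightarrow> (qc has_real_derivative pc' t - 2) (at t)"
  using qc[of t] at_within_Icc_at[of "-\<epsilon>" t \<epsilon>] by simp

lemma uc: "t \<in> {-\<epsilon>..\<epsilon>} \<Longrightarrow> (uc has_real_derivative pc' t - 1) (at t within {-\<epsilon>..\<epsilon>})"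
  unfolding uc_def[abs_def] by (auto intro!: derivative_eq_intros pc)

lemma curve_cont: "continuous_on {-\<epsilon>..\<epsilon>} pc" "continuous_on {-\<epsilon>..\<epsilon>} qc" "continuous_on {-\<epsilon>..\<epsilon>} uc"
  by (rule DERIV_continuous_on, erule pc qc uc)+

lemma f_cont: "continuous_on A fp" "continuous_on A fp1" "continuous_on A fm" "continuous_on A fm1"
  by (meson DERIV_continuous_on fp fp1 fm fm1 has_field_derivative_at_within)+

text \<open>\<open>qc\<close> is the critical curve, because \<open>pc' - 2\<close> may vanish at
  \<open>-\<epsilon>\<close>; the mean value point lies in the interior. The other two curves exceed
  \<open>qc\<close> by a positive multiple of \<open>t\<close>.\<close>

lemma curve_mono:
  assumes "s \<in> {-\<epsilon>..\<epsilon>}" "t \<in> {-\<epsilon>..\<epsilon>}" "s < t"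
  shows "pc s < pc t" "qc s < qc t" "uc s < uc t"
proof -
  obtain z where z: "s < z" "z < t" "qc t - qc s = (t - s) * (pc' z - 2)"
    by (rule MVT_real_derivative[of s t qc "\<lambda>z. pc' z - 2"])
      (use assms qc_at in \<open>auto intro: continuous_on_subset[OF curve_cont(2)]\<close>)
  have "0 < (t - s) * (pc' z - 2)" using pc'_gt[of z] z assms by auto
  then show *: "qc s < qc t" using z(3) by simp
  show "pc s < pc t" "uc s < uc t" using * assms(3) by (auto simp: qc_def uc_def)
qed

lemma curve_strict_mono: "strict_mono_on {-\<epsilon>..\<epsilon>} pc" "strict_mono_on {-\<epsilon>..\<epsilon>} qc" "strict_mono_on {-\<epsilon>..\<epsilon>} uc"
  by (auto intro!: strict_mono_onI curve_mono)

lemma curve_le: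
  assumes "s \<in> {-\<epsilon>..\<epsilon>}" "t \<in> {-\<epsilon>..\<epsilon>}"
  shows "pc s \<le> pc t \<longleftrightarrow> s \<le> t" "qc s \<le> qc t \<longleftrightarrow> s \<le> t" "uc s \<le> uc t \<longleftrightarrow> s \<le> t"
  using curve_strict_mono assms by (auto simp: strict_mono_on_less_eq)

lemma curve_eq:
  assumes "s \<in> {-\<epsilon>..\<epsilon>}" "t \<in> {-\<epsilon>..\<epsilon>}"
  shows "pc s = pc t \<longleftrightarrow> s = t" "qc s = qc t \<longleftrightarrow> s = t" "uc s = uc t \<longleftrightarrow> s = t"
  using inj_onD[OF strict_mono_on_imp_inj_on] curve_strict_mono assms by blast+

lemma curve_bounds:
  assumes "t \<in> {-\<epsilon>..\<epsilon>}"
  shows "vm \<le> pc t" "pc t \<le> up + 2 * \<epsilon>" "vm + 2 * \<epsilon> \<le> qc t" "qc t \<le> up"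
  using curve_le(1)[of "-\<epsilon>" t] curve_le(1)[of t \<epsilon>] curve_le(2)[of "-\<epsilon>" t] curve_le(2)[of t \<epsilon>] assms eps
  by (auto simp: qc_ends[symmetric] simp: vm_def[symmetric] up_def[symmetric])

lemma vm_less_up: "vm + 2 * \<epsilon> < up"
  using curve_mono(2)[of "-\<epsilon>" \<epsilon>] eps by (simp add: qc_ends up_def)

section \<open>Spine height as a function of \<open>x\<^sub>1 + x\<^sub>2\<close>,
  \<open>x\<^sub>1 - x\<^sub>2\<close> and \<open>x\<^sub>1\<close>; slopes prolonged past the
  spine\<close>

definition "TP = clamped_inverse (-\<epsilon>) \<epsilon> pc"
definition "TQ = clamped_inverse (-\<epsilon>) \<epsilon> qc"
definition "TU = clamped_inverse (-\<epsilon>) \<epsilon> uc"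

lemma TP: "continuous_on UNIV TP" "TP p \<in> {-\<epsilon>..\<epsilon>}" "t \<in> {-\<epsilon>..\<epsilon>} \<Longrightarrow> TP (pc t) = t"
    "p \<in> {vm..up + 2 * \<epsilon>} \<Longrightarrow> pc (TP p) = p" "p \<le> vm \<Longrightarrow> TP p = -\<epsilon>" "up + 2 * \<epsilon> \<le> p \<Longrightarrow> TP p = \<epsilon>"
  using clamped_inverse[OF _ curve_cont(1) curve_strict_mono(1)] eps by (simp_all add: TP_def vm_def qc_ends)

lemma TQ: "continuous_on UNIV TQ" "TQ q \<in> {-\<epsilon>..\<epsilon>}" "t \<in> {-\<epsilon>..\<epsilon>} \<Longrightarrow> TQ (qc t) = t"
    "q \<in> {vm + 2 * \<epsilon>..up} \<Longrightarrow> qc (TQ q) = q" "q \<le> vm + 2 * \<epsilon> \<Longrightarrow> TQ q = -\<epsilon>" "up \<le> q \<Longrightarrow> TQ q = \<epsilon>"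
  using clamped_inverse[OF _ curve_cont(2) curve_strict_mono(2)] eps by (simp_all add: TQ_def up_def qc_ends)

lemma TU: "continuous_on UNIV TU" "TU u \<in> {-\<epsilon>..\<epsilon>}" "t \<in> {-\<epsilon>..\<epsilon>} \<Longrightarrow> TU (uc t) = t"
    "u \<in> {vm + \<epsilon>..up + \<epsilon>} \<Longrightarrow> uc (TU u) = u"
  using clamped_inverse[OF _ curve_cont(3) curve_strict_mono(3)] eps
  by (simp_all add: TU_def uc_def up_def qc_def vm_def)

text \<open>\<open>kL\<close> and \<open>lR\<close> are the derivatives, in the coordinate constant
  along the chord, of the slopes of full chords in the left and right tangent domains; see
  \<open>k_left\<close> and \<open>l_right\<close>.\<close>

definition "kL p = (fm1 (p + \<epsilon>) - fp1 (p - \<epsilon>)) / (2 * \<epsilon>)"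
definition "lR q = (fp1 (q + \<epsilon>) - fm1 (q - \<epsilon>)) / (2 * \<epsilon>)"
text \<open>Equals \<open>\<kappa>\<close> along the spine and \<open>kL\<close> left of
  \<open>vm\<close>. Clamping and subtracting \<open>kL vm\<close> replace the case distinction and
  make continuity immediate.\<close>

definition "k' p = \<kappa> (TP p) + kL (min p vm) - kL vm"
definition "l' q = \<kappa> (TQ q) + lR (max q up) - lR up"
definition "k p = antiderivative k' p - antiderivative k' vm + (\<sigma> (-\<epsilon>) + \<delta> (-\<epsilon>))"
definition "l q = antiderivative l' q - antiderivative l' up + (\<sigma> \<epsilon> - \<delta> \<epsilon>)"

lemma k'_cont: "continuous_on A k'" and l'_cont: "continuous_on A l'"
proof -
  have "continuous_on UNIV k'" unfolding k'_def[abs_def] kL_def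
    by (intro continuous_intros continuous_on_compose2[OF \<kappa>_cont TP(1)] continuous_on_compose2[OF f_cont(2)] continuous_on_compose2[OF f_cont(4)])
      (use TP(2) eps in auto)
  then show "continuous_on A k'" by (rule continuous_on_subset) simp
  have "continuous_on UNIV l'" unfolding l'_def[abs_def] lR_def
    by (intro continuous_intros continuous_on_compose2[OF \<kappa>_cont TQ(1)] continuous_on_compose2[OF f_cont(2)] continuous_on_compose2[OF f_cont(4)])
      (use TQ(2) eps in auto)
  then show "continuous_on A l'" by (rule continuous_on_subset) simp
qed

lemma k: "(k has_real_derivative k' p) (at p)" and l: "(l has_real_derivative l' q) (at q)"
  unfolding k_def[abs_def] l_def[abs_def]
  using antiderivative_derivative[OF k'_cont, of p] antiderivative_derivative[OF l'_cont, of q]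
  by (auto intro!: derivative_eq_intros)

lemma k_cont: "continuous_on A k" and l_cont: "continuous_on A l"
  by (meson DERIV_continuous_on k l has_field_derivative_at_within)+

lemma k'_pc: "t \<in> {-\<epsilon>..\<epsilon>} \<Longrightarrow> k' (pc t) = \<kappa> t"
  using curve_bounds[of t] TP(3)[of t] by (simp add: k'_def min_def)

lemma l'_qc: "t \<in> {-\<epsilon>..\<epsilon>} \<Longrightarrow> l' (qc t) = \<kappa> t"
  using curve_bounds[of t] TQ(3)[of t] by (simp add: l'_def max_def)

text \<open>At either end of the spine the spine relation involves the two ends of one full chord.
  It then says that \<open>\<kappa>\<close> continues the derivative of the chord slopes, which
  makes the glued function \<open>C\<^sup>1\<close> across the border with the tangent
  domain.\<close>

lemma \<kappa>_ends: "\<kappa> (-\<epsilon>) = kL vm" "\<kappa> \<epsilon> = lR up"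
proof -
  have "2 * (-\<epsilon>) * \<kappa> (-\<epsilon>) = fp1 (vm - \<epsilon>) - fm1 (vm + \<epsilon>)"
    using spine_qc[of "-\<epsilon>"] eps by (simp add: qc_ends vm_def[symmetric] add.commute)
  then show "\<kappa> (-\<epsilon>) = kL vm" using eps by (simp add: kL_def nonzero_eq_divide_eq mult_ac)
  have "2 * \<epsilon> * \<kappa> \<epsilon> = fp1 (up + \<epsilon>) - fm1 (up - \<epsilon>)"
    using spine_qc[of \<epsilon>] eps by (simp add: qc_ends up_def[symmetric] add.commute)
  then show "\<kappa> \<epsilon> = lR up" using eps by (simp add: lR_def nonzero_eq_divide_eq mult_ac)
qed

lemma k'_left: "p \<le> vm \<Longrightarrow> k' p = kL p"
  using TP(5)[of p] by (simp add: k'_def \<kappa>_ends)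

lemma l'_right: "up \<le> q \<Longrightarrow> l' q = lR q"
  using TQ(6)[of q] by (simp add: l'_def \<kappa>_ends)

text \<open>Hence \<open>\<sigma> + \<delta>\<close> and \<open>\<sigma> - \<delta>\<close> have
  derivatives \<open>\<kappa> * pc'\<close> and \<open>\<kappa> * (pc' - 2)\<close>: both rib slopes
  have derivative \<open>\<kappa>\<close> in their own rib coordinate. The differential equation
  enters through \<open>upper\<close>, the spine relation through
  \<open>\<sigma>_eq\<close>.\<close>

lemma \<sigma>\<delta>_deriv:
  assumes t: "-\<epsilon> < t" "t < \<epsilon>"
  shows "(\<sigma> has_real_derivative \<kappa> t * (pc' t - 1)) (at t)" "(\<delta> has_real_derivative \<kappa> t) (at t)"
proof -
  have p: "((\<lambda>t. pc t - \<epsilon>) has_real_derivative pc' t) (at t)" and q: "((\<lambda>t. qc t - \<epsilon>) has_real_derivative pc' t - 2) (at t)"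
    using pc_at[OF t] qc_at[OF t] by (auto intro!: derivative_eq_intros)
  have "(\<sigma> has_real_derivative fp2 (pc t - \<epsilon>) * pc' t + ((0 - 1) * \<kappa> t + \<kappa>' t * (\<epsilon> - t))) (at t)"
    unfolding \<sigma>_def[abs_def]
    by (intro DERIV_add DERIV_mult DERIV_diff DERIV_const DERIV_ident DERIV_chain2[OF fp1 p] \<kappa>[OF t])
  moreover have "fp2 (pc t - \<epsilon>) * pc' t + ((0 - 1) * \<kappa> t + \<kappa>' t * (\<epsilon> - t)) = \<kappa> t * (pc' t - 1)"
    using upper[OF t] by (simp add: algebra_simps)
  ultimately show \<sigma>: "(\<sigma> has_real_derivative \<kappa> t * (pc' t - 1)) (at t)" by simp
  have "((\<lambda>t. 2 * t * \<sigma> t) has_real_derivative 2 * \<sigma> t + 2 * t * (\<kappa> t * (pc' t - 1))) (at t)"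
    by (auto intro!: derivative_eq_intros \<sigma>)
  then have "(\<delta> has_real_derivative ((2 * \<sigma> t + 2 * t * (\<kappa> t * (pc' t - 1))) - fp1 (pc t - \<epsilon>) * pc' t
      + fm1 (qc t - \<epsilon>) * (pc' t - 2)) / (2 * \<epsilon>)) (at t)"
    unfolding \<delta>_def[abs_def]
    by (intro DERIV_cdivide DERIV_add DERIV_diff DERIV_chain2[OF fp p] DERIV_chain2[OF fm q])
  moreover have "((2 * \<sigma> t + 2 * t * (\<kappa> t * (pc' t - 1))) - fp1 (pc t - \<epsilon>) * pc' t
      + fm1 (qc t - \<epsilon>) * (pc' t - 2)) / (2 * \<epsilon>) = \<kappa> t"
  proof -
    have f: "fp1 (pc t - \<epsilon>) = \<sigma> t - (\<epsilon> - t) * \<kappa> t" "fm1 (qc t - \<epsilon>) = \<sigma> t - (\<epsilon> + t) * \<kappa> t"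
      using \<sigma>_eq[of t] t by (auto simp: \<sigma>_def)
    show ?thesis unfolding f using eps by (simp add: field_simps)
  qed
  ultimately show "(\<delta> has_real_derivative \<kappa> t) (at t)" by simp
qed

lemma \<sigma>\<delta>_cont: "continuous_on {-\<epsilon>..\<epsilon>} \<sigma>" "continuous_on {-\<epsilon>..\<epsilon>} \<delta>"
proof -
  show \<sigma>: "continuous_on {-\<epsilon>..\<epsilon>} \<sigma>" unfolding \<sigma>_def[abs_def]
    by (intro continuous_intros \<kappa>_cont curve_cont continuous_on_compose2[OF f_cont(2)]) auto
  show "continuous_on {-\<epsilon>..\<epsilon>} \<delta>" unfolding \<delta>_def[abs_def]
    by (intro continuous_intros \<sigma> curve_cont continuous_on_compose2[OF f_cont(1)] continuous_on_compose2[OF f_cont(3)])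
      (use eps in auto)
qed

text \<open>The difference has zero derivative along the spine and vanishes at its lower end, the
  base point of \<open>k\<close>; for \<open>l\<close> the base point is the upper end.\<close>

lemma k_pc: assumes t: "t \<in> {-\<epsilon>..\<epsilon>}" shows "k (pc t) = \<sigma> t + \<delta> t"
proof -
  define E where "E t = k (pc t) - (\<sigma> t + \<delta> t)" for t
  have c: "continuous_on {-\<epsilon>..\<epsilon>} E" unfolding E_def[abs_def]
    by (intro continuous_intros \<sigma>\<delta>_cont continuous_on_compose2[OF k_cont curve_cont(1)]) auto
  have d: "(E has_real_derivative 0) (at t)" if t: "-\<epsilon> < t" "t < \<epsilon>" for t
  proof -
    have "(E has_real_derivative k' (pc t) * pc' t - (\<kappa> t * (pc' t - 1) + \<kappa> t)) (at t)"
      unfolding E_def[abs_def] by (intro DERIV_diff DERIV_add \<sigma>\<delta>_deriv t DERIV_chain2[OF k pc_at[OF t]])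
    then show ?thesis using k'_pc[of t] t by (simp add: algebra_simps)
  qed
  have "E t = E (-\<epsilon>)" by (rule DERIV_isconst2[OF _ c d]) (use t eps in auto)
  then show ?thesis by (simp add: E_def k_def vm_def)
qed

lemma l_qc: assumes t: "t \<in> {-\<epsilon>..\<epsilon>}" shows "l (qc t) = \<sigma> t - \<delta> t"
proof -
  define E where "E t = l (qc t) - (\<sigma> t - \<delta> t)" for t
  have c: "continuous_on {-\<epsilon>..\<epsilon>} E" unfolding E_def[abs_def]
    by (intro continuous_intros \<sigma>\<delta>_cont continuous_on_compose2[OF l_cont curve_cont(2)]) auto
  have d: "(E has_real_derivative 0) (at t)" if t: "-\<epsilon> < t" "t < \<epsilon>" for t
  proof -
    have "(E has_real_derivative l' (qc t) * (pc' t - 2) - (\<kappa> t * (pc' t - 1) - \<kappa> t)) (at t)"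
      unfolding E_def[abs_def] by (intro DERIV_diff \<sigma>\<delta>_deriv t DERIV_chain2[OF l qc_at[OF t]])
    then show ?thesis using l'_qc[of t] t by (simp add: algebra_simps)
  qed
  have "E s = E (-\<epsilon>)" if "s \<in> {-\<epsilon>..\<epsilon>}" for s by (rule DERIV_isconst2[OF _ c d]) (use that eps in auto)
  from this[OF t] this[of \<epsilon>] eps have "E t = E \<epsilon>" by simp
  then show ?thesis by (simp add: E_def l_def up_def)
qed

lemma \<sigma>\<delta>_ends:
  "\<sigma> (-\<epsilon>) + \<delta> (-\<epsilon>) = (fm (vm + \<epsilon>) - fp (vm - \<epsilon>)) / (2 * \<epsilon>)"
  "\<sigma> \<epsilon> - \<delta> \<epsilon> = (fp (up + \<epsilon>) - fm (up - \<epsilon>)) / (2 * \<epsilon>)"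
proof -
  have "\<delta> (-\<epsilon>) = - \<sigma> (-\<epsilon>) + (fm (vm + \<epsilon>) - fp (vm - \<epsilon>)) / (2 * \<epsilon>)"
    using eps by (simp add: \<delta>_def qc_ends vm_def[symmetric] add_divide_distrib diff_divide_distrib add.commute)
  then show "\<sigma> (-\<epsilon>) + \<delta> (-\<epsilon>) = (fm (vm + \<epsilon>) - fp (vm - \<epsilon>)) / (2 * \<epsilon>)" by simp
  have "\<delta> \<epsilon> = \<sigma> \<epsilon> - (fp (up + \<epsilon>) - fm (up - \<epsilon>)) / (2 * \<epsilon>)"
    using eps by (simp add: \<delta>_def qc_ends up_def[symmetric] add_divide_distrib diff_divide_distrib add.commute)
  then show "\<sigma> \<epsilon> - \<delta> \<epsilon> = (fp (up + \<epsilon>) - fm (up - \<epsilon>)) / (2 * \<epsilon>)" by simp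
qed

text \<open>Both sides have derivative \<open>kL\<close> up to \<open>vm\<close>, where they agree
  by \<open>\<sigma>\<delta>_ends\<close>.\<close>

lemma k_left: assumes "p \<le> vm" shows "k p = (fm (p + \<epsilon>) - fp (p - \<epsilon>)) / (2 * \<epsilon>)"
proof (cases "p = vm")
  case True
  then show ?thesis by (simp add: k_def \<sigma>\<delta>_ends)
next
  case False
  define E where "E p = k p - (fm (p + \<epsilon>) - fp (p - \<epsilon>)) / (2 * \<epsilon>)" for p
  have d: "(E has_real_derivative k' x - kL x) (at x)" for x
    unfolding E_def[abs_def] kL_def
    by (intro DERIV_diff DERIV_cdivide k DERIV_chain2[OF fm, THEN DERIV_cong] DERIV_chain2[OF fp, THEN DERIV_cong])
      (auto intro!: derivative_eq_intros)
  have c: "continuous_on A E" for A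
    by (meson DERIV_continuous_on d has_field_derivative_at_within)
  have "E vm = E p"
  proof (rule DERIV_isconst_end[OF _ c])
    show "(E has_real_derivative 0) (at x)" if "p < x" "x < vm" for x
      using d[of x] k'_left[of x] that by simp
  qed (use False assms in auto)
  moreover have "E vm = 0" by (simp add: E_def k_def \<sigma>\<delta>_ends)
  ultimately show ?thesis by (simp add: E_def)
qed

lemma l_right: assumes "up \<le> q" shows "l q = (fp (q + \<epsilon>) - fm (q - \<epsilon>)) / (2 * \<epsilon>)"
proof (cases "q = up")
  case True
  then show ?thesis by (simp add: l_def \<sigma>\<delta>_ends)
next
  case False
  define E where "E q = l q - (fp (q + \<epsilon>) - fm (q - \<epsilon>)) / (2 * \<epsilon>)" for q
  have d: "(E has_real_derivative l' x - lR x) (at x)" for x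
    unfolding E_def[abs_def] lR_def
    by (intro DERIV_diff DERIV_cdivide l DERIV_chain2[OF fm, THEN DERIV_cong] DERIV_chain2[OF fp, THEN DERIV_cong])
      (auto intro!: derivative_eq_intros)
  have c: "continuous_on A E" for A
    by (meson DERIV_continuous_on d has_field_derivative_at_within)
  have "E q = E up"
  proof (rule DERIV_isconst_end[OF _ c])
    show "(E has_real_derivative 0) (at x)" if "up < x" "x < q" for x
      using d[of x] l'_right[of x] that by simp
  qed (use False assms in auto)
  moreover have "E up = 0" by (simp add: E_def l_def \<sigma>\<delta>_ends)
  ultimately show ?thesis by (simp add: E_def)
qed

subsection \<open>The glued function\<close>

text \<open>The closed parts of the strip above and below the spine. For \<open>p \<le> vm\<close>
  the clamped \<open>TP\<close> is \<open>-\<epsilon>\<close>, so \<open>U\<close> contains the left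
  tangent domain; likewise \<open>Lo\<close> contains the right one.\<close>

definition "U = {x \<in> strip \<epsilon>. fst x + snd x \<le> up + 2 * \<epsilon> \<and> TP (fst x + snd x) \<le> snd x}"
definition "Lo = {x \<in> strip \<epsilon>. vm + 2 * \<epsilon> \<le> fst x - snd x \<and> snd x \<le> TQ (fst x - snd x)}"

lemma U_cases:
  assumes "x \<in> U"
  obtains "fst x + snd x \<le> vm" | t where "t \<in> {-\<epsilon>..\<epsilon>}" "fst x + snd x = pc t" "t \<le> snd x" "fst x - snd x \<le> qc t"
proof (cases "fst x + snd x \<le> vm")
  case False
  then have "pc (TP (fst x + snd x)) = fst x + snd x" "TP (fst x + snd x) \<le> snd x" using assms
    by (auto simp: U_def intro: TP(4))
  then show ?thesis using that(2)[of "TP (fst x + snd x)"] TP(2) by (auto simp: qc_def)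
qed (rule that(1))

lemma Lo_cases:
  assumes "x \<in> Lo"
  obtains "up \<le> fst x - snd x" | t where "t \<in> {-\<epsilon>..\<epsilon>}" "fst x - snd x = qc t" "snd x \<le> t" "fst x + snd x \<le> pc t"
proof (cases "up \<le> fst x - snd x")
  case False
  then have "qc (TQ (fst x - snd x)) = fst x - snd x" "snd x \<le> TQ (fst x - snd x)" using assms
    by (auto simp: Lo_def intro: TQ(4))
  then show ?thesis using that(2)[of "TQ (fst x - snd x)"] TQ(2) by (auto simp: qc_def)
qed (rule that(1))

lemma U_leftI: "x \<in> strip \<epsilon> \<Longrightarrow> fst x + snd x \<le> vm \<Longrightarrow> x \<in> U"
  using TP(5)[of "fst x + snd x"] vm_less_up eps by (auto simp: U_def strip_def)

lemma U_ribI: "x \<in> strip \<epsilon> \<Longrightarrow> t \<in> {-\<epsilon>..\<epsilon>} \<Longrightarrow> fst x + snd x = pc t \<Longrightarrow> t \<le> snd x \<Longrightarrow> x \<in> U"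
  using TP(3)[of t] curve_bounds[of t] by (auto simp: U_def)

lemma Lo_rightI: "x \<in> strip \<epsilon> \<Longrightarrow> up \<le> fst x - snd x \<Longrightarrow> x \<in> Lo"
  using TQ(6)[of "fst x - snd x"] vm_less_up eps by (auto simp: Lo_def strip_def)

lemma Lo_ribI: "x \<in> strip \<epsilon> \<Longrightarrow> t \<in> {-\<epsilon>..\<epsilon>} \<Longrightarrow> fst x - snd x = qc t \<Longrightarrow> snd x \<le> t \<Longrightarrow> x \<in> Lo"
  using TQ(3)[of t] curve_bounds[of t] by (auto simp: Lo_def)

lemma spine_mem: "t \<in> {-\<epsilon>..\<epsilon>} \<Longrightarrow> (uc t, t) \<in> U \<inter> Lo"
  using U_ribI[of "(uc t, t)" t] Lo_ribI[of "(uc t, t)" t] by (auto simp: strip_def uc_def qc_def)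

text \<open>\<open>U\<close> compares a point with the spine along \<open>p = const\<close> and
  \<open>Lo\<close> along \<open>q = const\<close>. The two tests are compatible by monotonicity: a
  point below the spine on its \<open>p\<close>-line has a larger \<open>q\<close> than the spine
  point there, so the spine point on its \<open>q\<close>-line is higher still.\<close>

lemma strip_cover: "strip \<epsilon> = U \<union> Lo"
proof
  show "strip \<epsilon> \<subseteq> U \<union> Lo"
  proof
    fix x assume x: "x \<in> strip \<epsilon>"
    then have x2: "- \<epsilon> \<le> snd x" "snd x \<le> \<epsilon>" by (auto simp: strip_def)
    consider "fst x + snd x \<le> vm" | "up \<le> fst x - snd x" | "vm < fst x + snd x" "fst x - snd x < up" by linarith
    then show "x \<in> U \<union> Lo"
    proof cases
      case 3
      then have p: "fst x + snd x \<in> {vm..up + 2 * \<epsilon>}" using x2 by auto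
      define t where "t = TP (fst x + snd x)"
      have t: "t \<in> {-\<epsilon>..\<epsilon>}" "pc t = fst x + snd x" using TP(2) TP(4)[OF p] by (auto simp: t_def)
      show ?thesis
      proof (cases "t \<le> snd x")
        case True
        then show ?thesis using U_ribI[OF x t(1)] t by auto
      next
        case False
        then have q: "qc t < fst x - snd x" using t by (simp add: qc_def)
        define s where "s = TQ (fst x - snd x)"
        have s: "s \<in> {-\<epsilon>..\<epsilon>}" "qc s = fst x - snd x"
          using TQ(2) TQ(4)[of "fst x - snd x"] q 3 curve_bounds[OF t(1)] by (auto simp: s_def)
        have "t < s" using q s curve_le(2)[OF s(1) t(1)] by auto
        then have "pc t < pc s" using curve_mono(1)[OF t(1) s(1)] by simp
        then have "snd x \<le> s" using s(2) t(2) by (simp add: qc_def)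
        then show ?thesis using Lo_ribI[OF x s(1)] s by auto
      qed
    qed (use U_leftI Lo_rightI x in auto)
  qed
qed (auto simp: U_def Lo_def)

text \<open>Along a line \<open>q = const\<close> growing \<open>p\<close> leads from
  \<open>Lo\<close> to \<open>U\<close>, and the passage takes place at a spine point; the gradients
  will be matched there.\<close>

lemma separation_q:
  assumes x: "x \<in> U" and y: "y \<in> Lo" and eq: "fst x - snd x = fst y - snd y"
  obtains t where "t \<in> {-\<epsilon>..\<epsilon>}" "fst x - snd x = qc t" "fst y + snd y \<le> pc t" "pc t \<le> fst x + snd x"
proof -
  have x2: "-\<epsilon> \<le> snd x" "vm + 2 * \<epsilon> \<le> fst y - snd y" "snd y \<le> \<epsilon>" using x y by (auto simp: U_def Lo_def strip_def)
  have "\<exists>s\<in>{-\<epsilon>..\<epsilon>}. fst x - snd x \<le> qc s \<and> fst x + snd x = pc s"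
    using x
  proof (cases rule: U_cases)
    case 1
    \<comment> \<open>The left tangent domain shares a line \<open>q = const\<close> with
      \<open>Lo\<close> only at the corner where the spine meets the bottom boundary.\<close>
    then have "fst x + snd x = vm" "snd x = -\<epsilon>" using x2 eq by linarith+
    then show ?thesis using qc_ends eps by (intro bexI[of _ "-\<epsilon>"]) (auto simp: vm_def)
  qed auto
  then obtain s where s: "s \<in> {-\<epsilon>..\<epsilon>}" "fst x - snd x \<le> qc s" "fst x + snd x = pc s" by blast
  have "\<exists>t\<in>{-\<epsilon>..\<epsilon>}. fst y - snd y = qc t \<and> fst y + snd y \<le> pc t"
    using y
  proof (cases rule: Lo_cases)
    case 1
    then have "fst y - snd y = up" using s(2) eq curve_bounds[OF s(1)] by linarith
    then show ?thesis using qc_ends eps x2 by (intro bexI[of _ \<epsilon>]) (auto simp: up_def)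
  qed auto
  then obtain t where t: "t \<in> {-\<epsilon>..\<epsilon>}" "fst y - snd y = qc t" "fst y + snd y \<le> pc t" by blast
  have "t \<le> s" using curve_le(2)[OF t(1) s(1)] t s eq by auto
  then have "pc t \<le> pc s" using curve_le(1)[OF t(1) s(1)] by simp
  then show thesis using that t s eq by auto
qed

text \<open>Along a line \<open>p = const\<close> the order is reversed: growing \<open>q\<close>
  leads from \<open>U\<close> to \<open>Lo\<close>.\<close>

lemma separation_p:
  assumes x: "x \<in> U" and y: "y \<in> Lo" and eq: "fst x + snd x = fst y + snd y"
  obtains t where "t \<in> {-\<epsilon>..\<epsilon>}" "fst x + snd x = pc t" "fst x - snd x \<le> qc t" "qc t \<le> fst y - snd y"
proof -
  have x2: "-\<epsilon> \<le> snd x" "fst x + snd x \<le> up + 2 * \<epsilon>" "vm + 2 * \<epsilon> \<le> fst y - snd y" "snd y \<le> \<epsilon>" "-\<epsilon> \<le> snd y"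
    using x y by (auto simp: U_def Lo_def strip_def)
  have "\<exists>t\<in>{-\<epsilon>..\<epsilon>}. qc t \<le> fst y - snd y \<and> fst y + snd y \<le> pc t"
    using y
  proof (cases rule: Lo_cases)
    case 1
    then show ?thesis using qc_ends eps x2 eq by (intro bexI[of _ \<epsilon>]) (auto simp: up_def)
  qed auto
  then obtain s where s: "s \<in> {-\<epsilon>..\<epsilon>}" "qc s \<le> fst y - snd y" "fst y + snd y \<le> pc s" by blast
  have "\<exists>t\<in>{-\<epsilon>..\<epsilon>}. fst x + snd x = pc t \<and> fst x - snd x \<le> qc t"
    using x
  proof (cases rule: U_cases)
    case 1
    then have "fst y + snd y = vm" "snd y = -\<epsilon>" using x2 eq by linarith+
    then show ?thesis using qc_ends eps x2 eq by (intro bexI[of _ "-\<epsilon>"]) (auto simp: vm_def)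
  qed auto
  then obtain t where t: "t \<in> {-\<epsilon>..\<epsilon>}" "fst x + snd x = pc t" "fst x - snd x \<le> qc t" by blast
  have "t \<le> s" using curve_le(1)[OF t(1) s(1)] t s eq by auto
  then have "qc t \<le> qc s" using curve_le(2)[OF t(1) s(1)] by simp
  then show thesis using that t s by auto
qed

lemma overlap:
  assumes "x \<in> U \<inter> Lo"
  obtains t where "t \<in> {-\<epsilon>..\<epsilon>}" "fst x + snd x = pc t" "fst x - snd x = qc t" "snd x = t"
proof -
  obtain t where t: "t \<in> {-\<epsilon>..\<epsilon>}" "fst x - snd x = qc t" "fst x + snd x = pc t"
    using assms by (auto intro: separation_q[of x x])
  moreover have "snd x = t" using t(2,3) by (simp add: qc_def)
  ultimately show thesis using that by blast
qed

lemma closed_U: "closed U" and closed_Lo: "closed Lo"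
proof -
  have "U = {x. - \<epsilon> \<le> snd x} \<inter> {x. snd x \<le> \<epsilon>} \<inter> {x. fst x + snd x \<le> up + 2 * \<epsilon>} \<inter> {x. TP (fst x + snd x) \<le> snd x}"
    by (auto simp: U_def strip_def)
  then show "closed U"
    by (auto intro!: closed_Int closed_Collect_le continuous_intros continuous_on_compose2[OF TP(1)])
  have "Lo = {x. - \<epsilon> \<le> snd x} \<inter> {x. snd x \<le> \<epsilon>} \<inter> {x. vm + 2 * \<epsilon> \<le> fst x - snd x} \<inter> {x. snd x \<le> TQ (fst x - snd x)}"
    by (auto simp: Lo_def strip_def)
  then show "closed Lo"
    by (auto intro!: closed_Int closed_Collect_le continuous_intros continuous_on_compose2[OF TQ(1)])
qed

text \<open>Boundary value at the end of the rib plus distance times slope. The same expression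
  covers the ribs of the fissure and the chords of the adjacent tangent domain.\<close>

definition "GU x = fp (fst x + snd x - \<epsilon>) + (\<epsilon> - snd x) * k (fst x + snd x)"
definition "GL x = fm (fst x - snd x - \<epsilon>) + (\<epsilon> + snd x) * l (fst x - snd x)"
definition "G x = (if x \<in> U then GU x else GL x)"

text \<open>The partial derivatives in the coordinates \<open>p = x\<^sub>1 + x\<^sub>2\<close> and \<open>q = x\<^sub>1 - x\<^sub>2\<close>, so that
  the gradient in the original coordinates is \<open>(G\<^sub>p + G\<^sub>q, G\<^sub>p - G\<^sub>q)\<close>.\<close>

definition "UP x = fp1 (fst x + snd x - \<epsilon>) - k (fst x + snd x) / 2 + (\<epsilon> - snd x) * k' (fst x + snd x)"
definition "UQ x = k (fst x + snd x) / 2"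
definition "LP x = l (fst x - snd x) / 2"
definition "LQ x = fm1 (fst x - snd x - \<epsilon>) - l (fst x - snd x) / 2 + (\<epsilon> + snd x) * l' (fst x - snd x)"
definition "Gp x = (if x \<in> U then UP x else LP x)"
definition "Gq x = (if x \<in> U then UQ x else LQ x)"

text \<open>Writing \<open>fp1\<close> and \<open>fm1\<close> at the rib ends through
  \<open>\<sigma>\<close> and \<open>\<kappa>\<close> cancels all terms with
  \<open>\<kappa>\<close>: the derivative transversal to one rib is half the slope along the
  other.\<close>

lemma match:
  assumes "x \<in> U" "x \<in> Lo" shows "GU x = GL x" "UP x = LP x" "UQ x = LQ x"
proof -
  obtain t where t: "t \<in> {-\<epsilon>..\<epsilon>}" "fst x + snd x = pc t" "fst x - snd x = qc t" "snd x = t"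
    using overlap assms by blast
  note eqs = t(2,3) k_pc[OF t(1)] l_qc[OF t(1)] k'_pc[OF t(1)] l'_qc[OF t(1)]
  show "GU x = GL x"
    unfolding GU_def GL_def eqs using spine_value_eq[of t] by (simp add: t(4))
  have f: "fp1 (pc t - \<epsilon>) = \<sigma> t - (\<epsilon> - t) * \<kappa> t" "fm1 (qc t - \<epsilon>) = \<sigma> t - (\<epsilon> + t) * \<kappa> t"
    using \<sigma>_eq[OF t(1)] by (simp_all add: \<sigma>_def)
  show "UP x = LP x" "UQ x = LQ x"
    unfolding UP_def LP_def UQ_def LQ_def eqs f by (simp_all add: t(4) field_simps)
qed

lemma G_Lo: "x \<in> Lo \<Longrightarrow> G x = GL x" "x \<in> Lo \<Longrightarrow> Gp x = LP x" "x \<in> Lo \<Longrightarrow> Gq x = LQ x"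
  using match by (auto simp: G_def Gp_def Gq_def)

lemma G_U: "x \<in> U \<Longrightarrow> G x = GU x" "x \<in> U \<Longrightarrow> Gp x = UP x" "x \<in> U \<Longrightarrow> Gq x = UQ x"
  by (auto simp: G_def Gp_def Gq_def)

lemma GU_derivative: "(GU has_derivative (\<lambda>h. (UP x + UQ x, UP x - UQ x) \<bullet> h)) (at x within S)"
proof -
  have p: "((\<lambda>x::real \<times> real. fst x + snd x) has_derivative (\<lambda>h. fst h + snd h)) (at x within S)"
    by (auto intro!: derivative_eq_intros)
  have p': "((\<lambda>x::real \<times> real. fst x + snd x - \<epsilon>) has_derivative (\<lambda>h. fst h + snd h)) (at x within S)"
    by (auto intro!: derivative_eq_intros)
  have "((\<lambda>x. fp (fst x + snd x - \<epsilon>)) has_derivative (\<lambda>h. fp1 (fst x + snd x - \<epsilon>) * (fst h + snd h))) (at x within S)"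
    using has_derivative_compose[OF p' fp[unfolded has_field_derivative_def]] by simp
  moreover have "((\<lambda>x. k (fst x + snd x)) has_derivative (\<lambda>h. k' (fst x + snd x) * (fst h + snd h))) (at x within S)"
    using has_derivative_compose[OF p k[unfolded has_field_derivative_def]] by simp
  moreover have "((\<lambda>x. \<epsilon> - snd x) has_derivative (\<lambda>h. - snd h)) (at x within S)"
    by (auto intro!: derivative_eq_intros)
  ultimately have "(GU has_derivative (\<lambda>h. fp1 (fst x + snd x - \<epsilon>) * (fst h + snd h) +
      ((\<epsilon> - snd x) * (k' (fst x + snd x) * (fst h + snd h)) + (- snd h) * k (fst x + snd x)))) (at x within S)"
    unfolding GU_def[abs_def] by (intro has_derivative_add has_derivative_mult)
  then show ?thesis
    by (rule has_derivative_eq_rhs) (auto simp: fun_eq_iff inner_prod_def UP_def UQ_def algebra_simps)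
qed

lemma GL_derivative: "(GL has_derivative (\<lambda>h. (LP x + LQ x, LP x - LQ x) \<bullet> h)) (at x within S)"
proof -
  have q: "((\<lambda>x::real \<times> real. fst x - snd x) has_derivative (\<lambda>h. fst h - snd h)) (at x within S)"
    by (auto intro!: derivative_eq_intros)
  have q': "((\<lambda>x::real \<times> real. fst x - snd x - \<epsilon>) has_derivative (\<lambda>h. fst h - snd h)) (at x within S)"
    by (auto intro!: derivative_eq_intros)
  have "((\<lambda>x. fm (fst x - snd x - \<epsilon>)) has_derivative (\<lambda>h. fm1 (fst x - snd x - \<epsilon>) * (fst h - snd h))) (at x within S)"
    using has_derivative_compose[OF q' fm[unfolded has_field_derivative_def]] by simp
  moreover have "((\<lambda>x. l (fst x - snd x)) has_derivative (\<lambda>h. l' (fst x - snd x) * (fst h - snd h))) (at x within S)"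
    using has_derivative_compose[OF q l[unfolded has_field_derivative_def]] by simp
  moreover have "((\<lambda>x. \<epsilon> + snd x) has_derivative (\<lambda>h. snd h)) (at x within S)"
    by (auto intro!: derivative_eq_intros)
  ultimately have "(GL has_derivative (\<lambda>h. fm1 (fst x - snd x - \<epsilon>) * (fst h - snd h) +
      ((\<epsilon> + snd x) * (l' (fst x - snd x) * (fst h - snd h)) + snd h * l (fst x - snd x)))) (at x within S)"
    unfolding GL_def[abs_def] by (intro has_derivative_add has_derivative_mult)
  then show ?thesis
    by (rule has_derivative_eq_rhs) (auto simp: fun_eq_iff inner_prod_def LP_def LQ_def algebra_simps)
qed

lemma G_derivative:
  assumes "x \<in> strip \<epsilon>"
  shows "(G has_derivative (\<lambda>h. (Gp x + Gq x, Gp x - Gq x) \<bullet> h)) (at x within strip \<epsilon>)"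
  unfolding strip_cover
proof (rule has_derivative_within_Un)
  have bl: "bounded_linear (\<lambda>h. (Gp x + Gq x, Gp x - Gq x) \<bullet> h)" by (rule bounded_linear_inner_right)
  show "(G has_derivative (\<lambda>h. (Gp x + Gq x, Gp x - Gq x) \<bullet> h)) (at x within U)"
  proof (cases "x \<in> U")
    case True
    have "(GU has_derivative (\<lambda>h. (Gp x + Gq x, Gp x - Gq x) \<bullet> h)) (at x within U)"
      using GU_derivative[of x U] True by (simp add: G_U)
    then show ?thesis using True G_U(1) by (auto intro: has_derivative_transform)
  qed (rule has_derivative_within_not_closure[OF closed_U _ bl])
  show "(G has_derivative (\<lambda>h. (Gp x + Gq x, Gp x - Gq x) \<bullet> h)) (at x within Lo)"
  proof (cases "x \<in> Lo")
    case True
    have "(GL has_derivative (\<lambda>h. (Gp x + Gq x, Gp x - Gq x) \<bullet> h)) (at x within Lo)"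
      using GL_derivative[of x Lo] True by (simp add: G_Lo)
    then show ?thesis using True G_Lo(1) by (auto intro: has_derivative_transform)
  qed (rule has_derivative_within_not_closure[OF closed_Lo _ bl])
qed

lemma G_gradient_cont: "continuous_on (strip \<epsilon>) Gp" "continuous_on (strip \<epsilon>) Gq"
proof -
  note [continuous_intros] = continuous_on_compose2[OF f_cont(2)[of UNIV]] continuous_on_compose2[OF f_cont(4)[of UNIV]]
    continuous_on_compose2[OF k_cont[of UNIV]] continuous_on_compose2[OF k'_cont[of UNIV]]
    continuous_on_compose2[OF l_cont[of UNIV]] continuous_on_compose2[OF l'_cont[of UNIV]]
  have "continuous_on A UP" "continuous_on A UQ" for A
    unfolding UP_def[abs_def] UQ_def[abs_def] by (intro continuous_intros; simp)+
  moreover have "continuous_on A LP" "continuous_on A LQ" for A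
    unfolding LP_def[abs_def] LQ_def[abs_def] by (intro continuous_intros; simp)+
  ultimately show "continuous_on (strip \<epsilon>) Gp" "continuous_on (strip \<epsilon>) Gq"
    unfolding Gp_def[abs_def] Gq_def[abs_def] strip_cover
    by (intro continuous_on_cases closed_U closed_Lo; use match in auto)+
qed

lemma C1_G: "S \<subseteq> strip \<epsilon> \<Longrightarrow> C1_on S G"
  unfolding C1_on_def
  by (rule exI[of _ "\<lambda>x. (Gp x + Gq x, Gp x - Gq x)"])
    (auto intro!: continuous_intros continuous_on_subset[OF G_gradient_cont(1)]
      continuous_on_subset[OF G_gradient_cont(2)] has_derivative_subset[OF G_derivative])

end

subsection \<open>Diagonal concavity\<close>

lemma same_diagonal_cases:
  assumes "same_diagonal a b"
  obtains h where "b = a + (h, h)" | h where "b = a + (h, -h)"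
  using assms that(1)[of "fst b - fst a"] that(2)[of "fst b - fst a"]
  by (force simp: same_diagonal_def prod_eq_iff)

lemma same_diagonal_in_segment:
  assumes "same_diagonal x y" "a \<in> closed_segment x y" "b \<in> closed_segment x y"
  shows "same_diagonal a b"
proof -
  obtain s r where sr: "a = (1 - s) *\<^sub>R x + s *\<^sub>R y" "b = (1 - r) *\<^sub>R x + r *\<^sub>R y"
    using assms(2,3) by (auto simp: in_segment)
  from assms(1) consider h where "y = x + (h, h)" | h where "y = x + (h, -h)"
    by (rule same_diagonal_cases)
  then show ?thesis
    by cases (simp_all add: sr same_diagonal_def algebra_simps)
qed

lemma convex_Omega_SW: "convex (Omega_SW \<epsilon> v u)"
proof -
  have "Omega_SW \<epsilon> v u = {x. (0, 1) \<bullet> x \<le> \<epsilon>} \<inter> {x. (0, 1) \<bullet> x \<ge> -\<epsilon>} \<inter> {x. (1, 1) \<bullet> x \<ge> v} \<inter> {x. (1, -1) \<bullet> x \<le> u}"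
    by (auto simp: Omega_SW_def strip_def inner_prod_def)
  then show ?thesis
    by (auto intro!: convex_Int convex_halfspace_le convex_halfspace_ge)
qed

context fissure
begin

text \<open>The two inequalities on each side are the signs of the second derivative transversal to the
  chords, at the two ends of a chord; in between that derivative is affine.\<close>

definition "admissible d \<longleftrightarrow> 0 \<le> d
  \<and> (\<forall>p\<in>{vm - d..vm}. fp2 (p - \<epsilon>) \<le> kL p \<and> fm2 (p + \<epsilon>) \<le> kL p)
  \<and> (\<forall>q\<in>{up..up + d}. fm2 (q - \<epsilon>) \<le> lR q \<and> fp2 (q + \<epsilon>) \<le> lR q)"

lemma admissible_mono: "admissible d \<Longrightarrow> 0 \<le> d' \<Longrightarrow> d' \<le> d \<Longrightarrow> admissible d'"
  unfolding admissible_def by (auto simp: subset_iff)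

text \<open>The \<open>p\<close>-derivative above the spine with \<open>q\<close> frozen; concavity
  along a line \<open>q = const\<close> means that it decreases in \<open>p\<close>.\<close>

definition "UPq q p = fp1 (p - \<epsilon>) - k p / 2 + (\<epsilon> - (p - q) / 2) * k' p"
definition "LQp p q = fm1 (q - \<epsilon>) - l q / 2 + (\<epsilon> + (p - q) / 2) * l' q"

lemma UP_UPq: "UP x = UPq (fst x - snd x) (fst x + snd x)"
  by (simp add: UP_def UPq_def)

lemma LQ_LQp: "LQ x = LQp (fst x + snd x) (fst x - snd x)"
  by (simp add: LQ_def LQp_def)

text \<open>With \<open>z = x\<^sub>2\<close> the derivative is the mean of \<open>fp2 - kL\<close>
  and \<open>fm2 - kL\<close> at the two ends of the chord with weights
  \<open>\<epsilon> + z\<close> and \<open>\<epsilon> - z\<close>; admissibility makes both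
  nonpositive.\<close>

lemma UPq_antimono_left:
  assumes "admissible d" "vm - d \<le> a" "a \<le> b" "b \<le> vm" "q \<le> a + 2 * \<epsilon>" "b - 2 * \<epsilon> \<le> q"
  shows "UPq q b \<le> UPq q a"
proof -
  define E where "E p = fp1 (p - \<epsilon>) - k p / 2 + (\<epsilon> - (p - q) / 2) * kL p" for p
  have E: "E p = UPq q p" if "p \<le> vm" for p using k'_left[OF that] by (simp add: E_def UPq_def)
  have kL: "(kL has_real_derivative (fm2 (p + \<epsilon>) - fp2 (p - \<epsilon>)) / (2 * \<epsilon>)) (at p)" for p
    unfolding kL_def[abs_def]
    by (intro DERIV_diff DERIV_cdivide DERIV_chain2[OF fm1, THEN DERIV_cong] DERIV_chain2[OF fp1, THEN DERIV_cong])
      (auto intro!: derivative_eq_intros)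
  have "E b \<le> E a"
  proof (rule DERIV_nonpos_imp_nonincreasing[OF \<open>a \<le> b\<close>])
    fix p assume p: "a \<le> p" "p \<le> b"
    define z where "z = (p - q) / 2"
    have z: "0 \<le> \<epsilon> + z" "0 \<le> \<epsilon> - z" using p assms(5,6) by (simp_all add: z_def field_simps)
    have "(E has_real_derivative fp2 (p - \<epsilon>) - k' p / 2 + ((- 1 / 2) * kL p + (fm2 (p + \<epsilon>) - fp2 (p - \<epsilon>)) / (2 * \<epsilon>) * (\<epsilon> - (p - q) / 2))) (at p)"
      unfolding E_def[abs_def]
      by (intro DERIV_diff DERIV_add DERIV_mult DERIV_cdivide kL k DERIV_chain2[OF fp1, THEN DERIV_cong])
        (auto intro!: derivative_eq_intros)
    moreover have "k' p = kL p" using k'_left p assms by auto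
    moreover have "fp2 (p - \<epsilon>) - kL p / 2 + ((- 1 / 2) * kL p + (fm2 (p + \<epsilon>) - fp2 (p - \<epsilon>)) / (2 * \<epsilon>) * (\<epsilon> - (p - q) / 2))
        = ((\<epsilon> + z) * (fp2 (p - \<epsilon>) - kL p) + (\<epsilon> - z) * (fm2 (p + \<epsilon>) - kL p)) / (2 * \<epsilon>)"
      unfolding z_def[symmetric] using eps by (simp add: field_simps)
    moreover have "(\<epsilon> + z) * (fp2 (p - \<epsilon>) - kL p) \<le> 0" "(\<epsilon> - z) * (fm2 (p + \<epsilon>) - kL p) \<le> 0"
      using z assms p by (auto simp: admissible_def intro!: mult_nonneg_nonpos)
    then have "((\<epsilon> + z) * (fp2 (p - \<epsilon>) - kL p) + (\<epsilon> - z) * (fm2 (p + \<epsilon>) - kL p)) / (2 * \<epsilon>) \<le> 0"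
      using eps by (intro divide_nonpos_pos) auto
    ultimately show "\<exists>y. (E has_real_derivative y) (at p) \<and> y \<le> 0" by auto
  qed
  then show ?thesis using E assms by auto
qed

lemma LQp_antimono_right:
  assumes "admissible d" "up \<le> a" "a \<le> b" "b \<le> up + d" "p \<le> a + 2 * \<epsilon>" "b - 2 * \<epsilon> \<le> p"
  shows "LQp p b \<le> LQp p a"
proof -
  define E where "E q = fm1 (q - \<epsilon>) - l q / 2 + (\<epsilon> + (p - q) / 2) * lR q" for q
  have E: "E q = LQp p q" if "up \<le> q" for q using l'_right[OF that] by (simp add: E_def LQp_def)
  have lR: "(lR has_real_derivative (fp2 (q + \<epsilon>) - fm2 (q - \<epsilon>)) / (2 * \<epsilon>)) (at q)" for q
    unfolding lR_def[abs_def]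
    by (intro DERIV_diff DERIV_cdivide DERIV_chain2[OF fm1, THEN DERIV_cong] DERIV_chain2[OF fp1, THEN DERIV_cong])
      (auto intro!: derivative_eq_intros)
  have "E b \<le> E a"
  proof (rule DERIV_nonpos_imp_nonincreasing[OF \<open>a \<le> b\<close>])
    fix q assume q: "a \<le> q" "q \<le> b"
    define z where "z = (p - q) / 2"
    have z: "0 \<le> \<epsilon> + z" "0 \<le> \<epsilon> - z" using q assms(5,6) by (simp_all add: z_def field_simps)
    have "(E has_real_derivative fm2 (q - \<epsilon>) - l' q / 2 + ((- 1 / 2) * lR q + (fp2 (q + \<epsilon>) - fm2 (q - \<epsilon>)) / (2 * \<epsilon>) * (\<epsilon> + (p - q) / 2))) (at q)"
      unfolding E_def[abs_def]
      by (intro DERIV_diff DERIV_add DERIV_mult DERIV_cdivide lR l DERIV_chain2[OF fm1, THEN DERIV_cong])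
        (auto intro!: derivative_eq_intros)
    moreover have "l' q = lR q" using l'_right q assms by auto
    moreover have "fm2 (q - \<epsilon>) - lR q / 2 + ((- 1 / 2) * lR q + (fp2 (q + \<epsilon>) - fm2 (q - \<epsilon>)) / (2 * \<epsilon>) * (\<epsilon> + (p - q) / 2))
        = ((\<epsilon> - z) * (fm2 (q - \<epsilon>) - lR q) + (\<epsilon> + z) * (fp2 (q + \<epsilon>) - lR q)) / (2 * \<epsilon>)"
      unfolding z_def[symmetric] using eps by (simp add: field_simps)
    moreover have "(\<epsilon> - z) * (fm2 (q - \<epsilon>) - lR q) \<le> 0" "(\<epsilon> + z) * (fp2 (q + \<epsilon>) - lR q) \<le> 0"
      using z assms q by (auto simp: admissible_def intro!: mult_nonneg_nonpos)
    then have "((\<epsilon> - z) * (fm2 (q - \<epsilon>) - lR q) + (\<epsilon> + z) * (fp2 (q + \<epsilon>) - lR q)) / (2 * \<epsilon>) \<le> 0"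
      using eps by (intro divide_nonpos_pos) auto
    ultimately show "\<exists>y. (E has_real_derivative y) (at q) \<and> y \<le> 0" by auto
  qed
  then show ?thesis using E assms by auto
qed

text \<open>Moving along the spine in the parameter \<open>r\<close>, the equation
  \<open>upper\<close> reduces the derivative to \<open>- (x\<^sub>2 - r) * \<kappa>' r\<close>, and
  \<open>q \<le> qc r\<close> says that the point is above the spine. An interior derivative and
  continuity suffice, which avoids the singular ends.\<close>

lemma UPq_antimono_spine:
  assumes s: "s \<in> {-\<epsilon>..\<epsilon>}" and t: "t \<in> {-\<epsilon>..\<epsilon>}" and "s \<le> t" "q \<le> qc s"
  shows "UPq q (pc t) \<le> UPq q (pc s)"
proof -
  define E where "E r = fp1 (pc r - \<epsilon>) - (\<sigma> r + \<delta> r) / 2 + (\<epsilon> - (pc r - q) / 2) * \<kappa> r" for r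
  have E: "E r = UPq q (pc r)" if "r \<in> {-\<epsilon>..\<epsilon>}" for r
    using k_pc[OF that] k'_pc[OF that] by (simp add: E_def UPq_def)
  have "continuous_on {-\<epsilon>..\<epsilon>} E" unfolding E_def[abs_def]
    by (intro continuous_intros \<kappa>_cont \<sigma>\<delta>_cont curve_cont continuous_on_compose2[OF f_cont(2)]) auto
  then have c: "continuous_on {s..t} E" by (rule continuous_on_subset) (use s t in auto)
  have "- E s \<le> - E t"
  proof (rule DERIV_nonneg_imp_increasing_open[OF \<open>s \<le> t\<close> _ continuous_on_minus[OF c]])
    fix r assume r: "s < r" "r < t"
    then have r': "-\<epsilon> < r" "r < \<epsilon>" and rI: "r \<in> {-\<epsilon>..\<epsilon>}" using s t by auto
    have p: "((\<lambda>t. pc t - \<epsilon>) has_real_derivative pc' r) (at r)"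
      and z: "((\<lambda>t. \<epsilon> - (pc t - q) / 2) has_real_derivative - pc' r / 2) (at r)"
      using pc_at[OF r'] by (auto intro!: derivative_eq_intros)
    have "(E has_real_derivative fp2 (pc r - \<epsilon>) * pc' r - (\<kappa> r * (pc' r - 1) + \<kappa> r) / 2
        + (- pc' r / 2 * \<kappa> r + \<kappa>' r * (\<epsilon> - (pc r - q) / 2))) (at r)"
      unfolding E_def[abs_def]
      by (intro DERIV_add DERIV_diff DERIV_mult DERIV_cdivide DERIV_chain2[OF fp1 p] \<sigma>\<delta>_deriv r' \<kappa> z)
    moreover have "fp2 (pc r - \<epsilon>) * pc' r - (\<kappa> r * (pc' r - 1) + \<kappa> r) / 2
        + (- pc' r / 2 * \<kappa> r + \<kappa>' r * (\<epsilon> - (pc r - q) / 2)) = - (((pc r - q) / 2 - r) * \<kappa>' r)"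
      using upper[OF r'] by (simp add: field_simps)
    moreover have "q \<le> qc r" using curve_le(2)[OF s rI] r assms(4) by auto
    then have "0 \<le> ((pc r - q) / 2 - r) * \<kappa>' r"
      using \<kappa>'_nonneg[OF r'] by (auto simp: qc_def intro!: mult_nonneg_nonneg)
    ultimately show "\<exists>y. ((\<lambda>r. - E r) has_real_derivative y) (at r) \<and> 0 \<le> y"
      by (metis DERIV_minus minus_minus)
  qed
  then show ?thesis using E[OF s] E[OF t] by simp
qed

lemma LQp_antimono_spine:
  assumes s: "s \<in> {-\<epsilon>..\<epsilon>}" and t: "t \<in> {-\<epsilon>..\<epsilon>}" and "s \<le> t" "p \<le> pc s"
  shows "LQp p (qc t) \<le> LQp p (qc s)"
proof -
  define E where "E r = fm1 (qc r - \<epsilon>) - (\<sigma> r - \<delta> r) / 2 + (\<epsilon> + (p - qc r) / 2) * \<kappa> r" for r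
  have E: "E r = LQp p (qc r)" if "r \<in> {-\<epsilon>..\<epsilon>}" for r
    using l_qc[OF that] l'_qc[OF that] by (simp add: E_def LQp_def)
  have "continuous_on {-\<epsilon>..\<epsilon>} E" unfolding E_def[abs_def]
    by (intro continuous_intros \<kappa>_cont \<sigma>\<delta>_cont curve_cont continuous_on_compose2[OF f_cont(4)]) auto
  then have c: "continuous_on {s..t} E" by (rule continuous_on_subset) (use s t in auto)
  have "- E s \<le> - E t"
  proof (rule DERIV_nonneg_imp_increasing_open[OF \<open>s \<le> t\<close> _ continuous_on_minus[OF c]])
    fix r assume r: "s < r" "r < t"
    then have r': "-\<epsilon> < r" "r < \<epsilon>" and rI: "r \<in> {-\<epsilon>..\<epsilon>}" using s t by auto
    have p: "((\<lambda>t. qc t - \<epsilon>) has_real_derivative pc' r - 2) (at r)"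
      and z: "((\<lambda>t. \<epsilon> + (p - qc t) / 2) has_real_derivative - (pc' r - 2) / 2) (at r)"
      using qc_at[OF r'] by (auto intro!: derivative_eq_intros)
    have "(E has_real_derivative fm2 (qc r - \<epsilon>) * (pc' r - 2) - (\<kappa> r * (pc' r - 1) - \<kappa> r) / 2
        + (- (pc' r - 2) / 2 * \<kappa> r + \<kappa>' r * (\<epsilon> + (p - qc r) / 2))) (at r)"
      unfolding E_def[abs_def]
      by (intro DERIV_add DERIV_diff DERIV_mult DERIV_cdivide DERIV_chain2[OF fm1 p] \<sigma>\<delta>_deriv r' \<kappa> z)
    moreover have "fm2 (qc r - \<epsilon>) * (pc' r - 2) - (\<kappa> r * (pc' r - 1) - \<kappa> r) / 2
        + (- (pc' r - 2) / 2 * \<kappa> r + \<kappa>' r * (\<epsilon> + (p - qc r) / 2)) = - ((r - (p - qc r) / 2) * \<kappa>' r)"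
      using lower_qc[OF r'] by (simp add: field_simps)
    moreover have "p \<le> pc r" using curve_le(1)[OF s rI] r assms(4) by auto
    then have "0 \<le> (r - (p - qc r) / 2) * \<kappa>' r"
      using \<kappa>'_nonneg[OF r'] by (auto simp: qc_def intro!: mult_nonneg_nonneg)
    ultimately show "\<exists>y. ((\<lambda>r. - E r) has_real_derivative y) (at r) \<and> 0 \<le> y"
      by (metis DERIV_minus minus_minus)
  qed
  then show ?thesis using E[OF s] E[OF t] by simp
qed

text \<open>A line \<open>q = const\<close> may pass from the left tangent domain into the region
  above the spine; the two monotonicity statements are then chained at
  \<open>p = vm\<close>.\<close>

lemma UP_antimono:
  assumes "admissible d" and x: "x \<in> U" and y: "y \<in> U" and eq: "fst x - snd x = fst y - snd y"
    and le: "fst x + snd x \<le> fst y + snd y" and d: "vm - d \<le> fst x + snd x"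
  shows "UP y \<le> UP x"
proof -
  define q where "q = fst x - snd x"
  have q: "q \<le> fst x + snd x + 2 * \<epsilon>" "fst y + snd y - 2 * \<epsilon> \<le> q"
    using x y eq by (auto simp: q_def U_def strip_def)
  have left: "UPq q b \<le> UPq q (fst x + snd x)" if "fst x + snd x \<le> b" "b \<le> vm" "b \<le> fst y + snd y" for b
    by (rule UPq_antimono_left[OF assms(1) d]) (use that q in auto)
  have "UPq q (fst y + snd y) \<le> UPq q (fst x + snd x)"
    using y
  proof (cases rule: U_cases)
    case 1
    then show ?thesis using left le by auto
  next
    case t: (2 t)
    show ?thesis using x
    proof (cases rule: U_cases)
      case 1
      have m: "-\<epsilon> \<in> {-\<epsilon>..\<epsilon>}" using eps by auto
      have "UPq q (pc t) \<le> UPq q (pc (-\<epsilon>))"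
        by (rule UPq_antimono_spine[OF m t(1)]) (use t q 1 qc_ends in auto)
      also have "pc (-\<epsilon>) = vm" by (simp add: vm_def)
      also have "UPq q vm \<le> UPq q (fst x + snd x)"
        by (rule left) (use 1 t curve_bounds[OF t(1)] in auto)
      finally show ?thesis using t by simp
    next
      case s: (2 s)
      have "s \<le> t" using curve_le(1)[OF s(1) t(1)] s t le by auto
      then show ?thesis using UPq_antimono_spine[OF s(1) t(1), of q] s t by (simp add: q_def)
    qed
  qed
  then show ?thesis using eq by (simp add: UP_UPq q_def)
qed

lemma LQ_antimono:
  assumes "admissible d" and x: "x \<in> Lo" and y: "y \<in> Lo" and eq: "fst x + snd x = fst y + snd y"
    and le: "fst x - snd x \<le> fst y - snd y" and d: "fst y - snd y \<le> up + d"
  shows "LQ y \<le> LQ x"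
proof -
  define p where "p = fst x + snd x"
  have p: "p \<le> fst x - snd x + 2 * \<epsilon>" "fst y - snd y - 2 * \<epsilon> \<le> p"
    using x y eq by (auto simp: p_def Lo_def strip_def)
  have right: "LQp p (fst y - snd y) \<le> LQp p a" if "fst x - snd x \<le> a" "up \<le> a" "a \<le> fst y - snd y" for a
    by (rule LQp_antimono_right[OF assms(1) that(2,3) d]) (use that p in auto)
  have "LQp p (fst y - snd y) \<le> LQp p (fst x - snd x)"
    using x
  proof (cases rule: Lo_cases)
    case 1
    then show ?thesis using right le by auto
  next
    case s: (2 s)
    show ?thesis using y
    proof (cases rule: Lo_cases)
      case 1
      have m: "\<epsilon> \<in> {-\<epsilon>..\<epsilon>}" using eps by auto
      have "LQp p (fst y - snd y) \<le> LQp p up"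
        by (rule right) (use 1 s curve_bounds[OF s(1)] in auto)
      also have "up = qc \<epsilon>" by (simp add: up_def)
      also have "LQp p (qc \<epsilon>) \<le> LQp p (qc s)"
        by (rule LQp_antimono_spine[OF s(1) m]) (use s p_def in auto)
      finally show ?thesis using s by simp
    next
      case t: (2 t)
      have "s \<le> t" using curve_le(2)[OF s(1) t(1)] s t le by auto
      then show ?thesis using LQp_antimono_spine[OF s(1) t(1), of p] s t by (simp add: p_def)
    qed
  qed
  then show ?thesis using eq by (simp add: LQ_LQp p_def)
qed

text \<open>Below the spine \<open>Gp\<close> depends on \<open>q\<close> only and is constant along
  the line; above the spine it decreases. The passage is at the spine point from
  \<open>separation_q\<close>, where both expressions match. The opposite order, \<open>U\<close>
  before \<open>Lo\<close>, forces \<open>x = y\<close>.\<close>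

lemma Gp_antimono:
  assumes "admissible d" and x: "x \<in> Omega_SW \<epsilon> (vm - d) (up + d)" and y: "y \<in> Omega_SW \<epsilon> (vm - d) (up + d)"
    and eq: "fst x - snd x = fst y - snd y" and le: "fst x + snd x \<le> fst y + snd y"
  shows "Gp y \<le> Gp x"
proof -
  have d: "vm - d \<le> fst x + snd x" and xs: "x \<in> U \<or> x \<in> Lo" and ys: "y \<in> U \<or> y \<in> Lo"
    using x y strip_cover by (auto simp: Omega_SW_def)
  consider "x \<in> U" "y \<in> U" | "x \<in> Lo" "y \<in> Lo" | "x \<in> Lo" "y \<in> U" | "x \<in> U" "y \<in> Lo"
    using xs ys by blast
  then show ?thesis
  proof cases
    case 1
    then show ?thesis using UP_antimono[OF assms(1) 1 eq le d] by (simp add: G_U)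
  next
    case 2
    then show ?thesis using eq by (simp add: G_Lo LP_def)
  next
    case 3
    obtain t where t: "t \<in> {-\<epsilon>..\<epsilon>}" "fst y - snd y = qc t" "fst x + snd x \<le> pc t" "pc t \<le> fst y + snd y"
      using separation_q[OF 3(2,1) eq[symmetric]] by metis
    define z where "z = (uc t, t)"
    have z: "z \<in> U" "z \<in> Lo" "fst z - snd z = qc t" "fst z + snd z = pc t"
      using spine_mem[OF t(1)] by (auto simp: z_def uc_def qc_def)
    have "UP y \<le> UP z"
      by (rule UP_antimono[OF assms(1) z(1) 3(2)]) (use t z d in auto)
    moreover have "LP z = LP x" using t z eq by (simp add: LP_def)
    ultimately show ?thesis using match(2)[OF z(1,2)] 3 by (simp add: G_U G_Lo)
  next
    case 4
    obtain t where "fst y + snd y \<le> pc t" "pc t \<le> fst x + snd x"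
      using separation_q[OF 4 eq] by metis
    then have "x = y" using le eq by (auto simp: prod_eq_iff)
    then show ?thesis by simp
  qed
qed

lemma Gq_antimono:
  assumes "admissible d" and x: "x \<in> Omega_SW \<epsilon> (vm - d) (up + d)" and y: "y \<in> Omega_SW \<epsilon> (vm - d) (up + d)"
    and eq: "fst x + snd x = fst y + snd y" and le: "fst x - snd x \<le> fst y - snd y"
  shows "Gq y \<le> Gq x"
proof -
  have d: "fst y - snd y \<le> up + d" and xs: "x \<in> U \<or> x \<in> Lo" and ys: "y \<in> U \<or> y \<in> Lo"
    using x y strip_cover by (auto simp: Omega_SW_def)
  consider "x \<in> U" "y \<in> U" | "x \<in> Lo" "y \<in> Lo" | "x \<in> U" "y \<in> Lo" | "x \<in> Lo" "y \<in> U"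
    using xs ys by blast
  then show ?thesis
  proof cases
    case 1
    then show ?thesis using eq by (simp add: G_U UQ_def)
  next
    case 2
    then show ?thesis using LQ_antimono[OF assms(1) 2 eq le d] by (simp add: G_Lo)
  next
    case 3
    obtain t where t: "t \<in> {-\<epsilon>..\<epsilon>}" "fst x + snd x = pc t" "fst x - snd x \<le> qc t" "qc t \<le> fst y - snd y"
      using separation_p[OF 3 eq] by metis
    define z where "z = (uc t, t)"
    have z: "z \<in> U" "z \<in> Lo" "fst z - snd z = qc t" "fst z + snd z = pc t"
      using spine_mem[OF t(1)] by (auto simp: z_def uc_def qc_def)
    have "LQ y \<le> LQ z"
      by (rule LQ_antimono[OF assms(1) z(2) 3(2)]) (use t z d eq in auto)
    moreover have "UQ z = UQ x" using t z eq by (simp add: UQ_def)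
    ultimately show ?thesis using match(3)[OF z(1,2)] 3 by (simp add: G_U G_Lo)
  next
    case 4
    obtain t where "fst y - snd y \<le> qc t" "qc t \<le> fst x - snd x"
      using separation_p[OF 4(2,1) eq[symmetric]] by metis
    then have "x = y" using le eq by (auto simp: prod_eq_iff)
    then show ?thesis by simp
  qed
qed

text \<open>The derivative of \<open>G\<close> along the segment is \<open>2 * h\<close> times
  \<open>Gp\<close> or \<open>Gq\<close>. Orienting the segment by \<open>0 \<le> h\<close> turns
  their monotonicity into concavity.\<close>

lemma G_concave_along:
  assumes adm: "admissible d" and a: "a \<in> Omega_SW \<epsilon> (vm - d) (up + d)" and b: "b \<in> Omega_SW \<epsilon> (vm - d) (up + d)"
    and ab: "b = a + h *\<^sub>R (1, 1) \<or> b = a + h *\<^sub>R (1, -1)" and "0 \<le> h" and t: "0 \<le> t" "t \<le> 1"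
  shows "(1 - t) * G a + t * G b \<le> G ((1 - t) *\<^sub>R a + t *\<^sub>R b)"
proof -
  let ?S = "Omega_SW \<epsilon> (vm - d) (up + d)"
  define \<gamma> where "\<gamma> s = (1 - s) *\<^sub>R a + s *\<^sub>R b" for s
  have \<gamma>S: "\<gamma> s \<in> ?S" if "s \<in> {0..1}" for s
    using convexD_alt[OF convex_Omega_SW a b, of s] that by (simp add: \<gamma>_def)
  have \<gamma>_strip: "\<gamma> s \<in> strip \<epsilon>" if "s \<in> {0..1}" for s
    using \<gamma>S[OF that] by (auto simp: Omega_SW_def)
  have \<gamma>_der: "(\<gamma> has_derivative (\<lambda>r. r *\<^sub>R (b - a))) (at s within A)" for s A
  proof -
    have "((\<lambda>s. a + s *\<^sub>R (b - a)) has_derivative (\<lambda>r. r *\<^sub>R (b - a))) (at s within A)"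
      by (auto intro!: derivative_eq_intros)
    moreover have "\<gamma> = (\<lambda>s. a + s *\<^sub>R (b - a))" by (simp add: \<gamma>_def fun_eq_iff algebra_simps)
    ultimately show ?thesis by simp
  qed
  define g where "g s = (Gp (\<gamma> s) + Gq (\<gamma> s), Gp (\<gamma> s) - Gq (\<gamma> s)) \<bullet> (b - a)" for s
  have der: "((\<lambda>s. G (\<gamma> s)) has_real_derivative g s) (at s within {0..1})" if s: "s \<in> {0..1}" for s
  proof -
    have "((G \<circ> \<gamma>) has_derivative ((\<lambda>v. (Gp (\<gamma> s) + Gq (\<gamma> s), Gp (\<gamma> s) - Gq (\<gamma> s)) \<bullet> v) \<circ> (\<lambda>r. r *\<^sub>R (b - a)))) (at s within {0..1})"
      by (rule diff_chain_within[OF \<gamma>_der has_derivative_subset[OF G_derivative]]) (use \<gamma>_strip s in auto)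
    moreover have "((\<lambda>v. (Gp (\<gamma> s) + Gq (\<gamma> s), Gp (\<gamma> s) - Gq (\<gamma> s)) \<bullet> v) \<circ> (\<lambda>r. r *\<^sub>R (b - a))) = (*) (g s)"
      by (simp add: fun_eq_iff g_def)
    ultimately show ?thesis by (simp add: has_field_derivative_def o_def)
  qed
  have anti: "g s' \<le> g s" if "0 \<le> s" "s \<le> s'" "s' \<le> 1" for s s'
  proof -
    have S: "\<gamma> s \<in> ?S" "\<gamma> s' \<in> ?S" using \<gamma>S that by auto
    have \<gamma>: "\<gamma> r = a + r *\<^sub>R (b - a)" for r by (simp add: \<gamma>_def algebra_simps)
    have le: "s * h \<le> s' * h" using that \<open>0 \<le> h\<close> by (intro mult_right_mono) auto
    from ab show ?thesis
    proof
      assume "b = a + h *\<^sub>R (1, 1)"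
      then have ba: "b - a = (h, h)" by simp
      have "Gp (\<gamma> s') \<le> Gp (\<gamma> s)"
        by (rule Gp_antimono[OF adm S]) (use le in \<open>auto simp: \<gamma> ba mult.commute\<close>)
      moreover have "g r = 2 * h * Gp (\<gamma> r)" for r by (simp add: g_def ba inner_prod_def algebra_simps)
      ultimately show ?thesis using \<open>0 \<le> h\<close> by (simp add: mult_left_mono)
    next
      assume "b = a + h *\<^sub>R (1, -1)"
      then have ba: "b - a = (h, -h)" by simp
      have "Gq (\<gamma> s') \<le> Gq (\<gamma> s)"
        by (rule Gq_antimono[OF adm S]) (use le in \<open>auto simp: \<gamma> ba mult.commute\<close>)
      moreover have "g r = 2 * h * Gq (\<gamma> r)" for r by (simp add: g_def ba inner_prod_def algebra_simps)
      ultimately show ?thesis using \<open>0 \<le> h\<close> by (simp add: mult_left_mono)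
    qed
  qed
  have "(1 - t) * G (\<gamma> 0) + t * G (\<gamma> 1) \<le> G (\<gamma> ((1 - t) * 0 + t * 1))"
  proof (rule concave_on_interval_derivI[where f = "\<lambda>s. G (\<gamma> s)" and f' = g])
    show "continuous_on {0..1} (\<lambda>s. G (\<gamma> s))" by (rule DERIV_continuous_on[OF der])
    show "((\<lambda>s. G (\<gamma> s)) has_real_derivative g s) (at s)" if "0 < s" "s < 1" for s
      using der[of s] at_within_Icc_at[of 0 s 1] that by simp
  qed (use anti t in auto)
  then show ?thesis by (simp add: \<gamma>_def)
qed

lemma G_concave:
  assumes adm: "admissible d" and a: "a \<in> Omega_SW \<epsilon> (vm - d) (up + d)" and b: "b \<in> Omega_SW \<epsilon> (vm - d) (up + d)"
    and ab: "same_diagonal a b" and t: "0 \<le> t" "t \<le> 1"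
  shows "(1 - t) * G a + t * G b \<le> G ((1 - t) *\<^sub>R a + t *\<^sub>R b)"
proof -
  obtain h where h: "b = a + h *\<^sub>R (1, 1) \<or> b = a + h *\<^sub>R (1, -1)"
    by (rule same_diagonal_cases[OF ab]) (auto simp: scaleR_Pair)
  show ?thesis
  proof (cases "0 \<le> h")
    case True
    then show ?thesis using G_concave_along[OF adm a b h _ t] by simp
  next
    case False
    then have h': "a = b + (-h) *\<^sub>R (1, 1) \<or> a = b + (-h) *\<^sub>R (1, -1)"
      using h by (auto simp: zero_prod_def)
    show ?thesis using G_concave_along[OF adm b a h', of "1 - t"] False t by (simp add: algebra_simps)
  qed
qed

text \<open>Stated for any \<open>F\<close> that agrees with \<open>G\<close>, to cover the
  herringbone function at margin 0 as well as \<open>G\<close> at margin \<open>d\<close>. Condition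
  (3) holds through its first alternative: points of \<open>U\<close> are joined to the top boundary
  and all others to the bottom.\<close>

lemma bellman_candidate_G:
  assumes adm: "admissible d" and F: "\<And>x. x \<in> Omega_SW \<epsilon> (vm - d) (up + d) \<Longrightarrow> F x = G x"
  shows "bellman_candidate \<epsilon> fp fm (Omega_SW \<epsilon> (vm - d) (up + d)) F"
proof -
  let ?S = "Omega_SW \<epsilon> (vm - d) (up + d)"
  have d: "0 \<le> d" using adm by (simp add: admissible_def)
  have S: "?S \<subseteq> strip \<epsilon>" by (auto simp: Omega_SW_def)
  have conc: "diagonally_concave_on ?S F"
    unfolding diagonally_concave_on_def concave_on_iff
  proof (intro allI impI conjI ballI)
    fix x y a b :: "real \<times> real" and u v :: real
    assume xy: "same_diagonal x y \<and> closed_segment x y \<subseteq> ?S"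
      and a: "a \<in> closed_segment x y" and b: "b \<in> closed_segment x y" and uv: "0 \<le> u" "0 \<le> v" "u + v = 1"
    have mem: "u *\<^sub>R a + v *\<^sub>R b \<in> closed_segment x y"
      by (rule convexD[OF convex_closed_segment a b uv])
    have "same_diagonal a b" using same_diagonal_in_segment xy a b by blast
    then have "(1 - v) * G a + v * G b \<le> G ((1 - v) *\<^sub>R a + v *\<^sub>R b)"
      by (intro G_concave[OF adm]) (use a b xy uv in auto)
    moreover have "1 - v = u" using uv by simp
    moreover have "F a = G a" "F b = G b" "F (u *\<^sub>R a + v *\<^sub>R b) = G (u *\<^sub>R a + v *\<^sub>R b)"
      using a b mem xy by (auto intro!: F)
    ultimately show "u * F a + v * F b \<le> F (u *\<^sub>R a + v *\<^sub>R b)" by simp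
  qed simp
  have top: "F (s, \<epsilon>) = fp s" if "(s, \<epsilon>) \<in> ?S" for s
  proof (cases "(s, \<epsilon>) \<in> U")
    case True
    then show ?thesis using F[OF that] by (simp add: G_U GU_def)
  next
    case False
    then have "(s, \<epsilon>) \<in> Lo" using that S strip_cover by auto
    then show ?thesis
    proof (cases rule: Lo_cases)
      case 1
      then have "l (s - \<epsilon>) = (fp s - fm (s - \<epsilon> - \<epsilon>)) / (2 * \<epsilon>)" using l_right[of "s - \<epsilon>"] by simp
      then show ?thesis using F[OF that] G_Lo(1)[OF \<open>(s, \<epsilon>) \<in> Lo\<close>] eps by (simp add: GL_def)
    next
      case (2 t)
      then have "(s, \<epsilon>) = (uc t, t)" by (auto simp: uc_def qc_def)
      then have "(s, \<epsilon>) \<in> U" using spine_mem[OF 2(1)] by simp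
      then show ?thesis using False by simp
    qed
  qed
  have bottom: "F (s, -\<epsilon>) = fm s" if "(s, -\<epsilon>) \<in> ?S" for s
  proof (cases "(s, -\<epsilon>) \<in> Lo")
    case True
    then show ?thesis using F[OF that] by (simp add: G_Lo GL_def)
  next
    case False
    then have U: "(s, -\<epsilon>) \<in> U" using that S strip_cover by auto
    then show ?thesis
    proof (cases rule: U_cases)
      case 1
      then have "k (s - \<epsilon>) = (fm s - fp (s - \<epsilon> - \<epsilon>)) / (2 * \<epsilon>)" using k_left[of "s - \<epsilon>"] by simp
      then show ?thesis using F[OF that] G_U(1)[OF U] eps by (simp add: GU_def)
    next
      case (2 t)
      then have "(s, -\<epsilon>) = (uc t, t)" by (auto simp: uc_def qc_def)
      then have "(s, -\<epsilon>) \<in> Lo" using spine_mem[OF 2(1)] by simp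
      then show ?thesis using False by simp
    qed
  qed
  have ribs: "\<exists>z\<in>strip_boundary \<epsilon>. same_diagonal y z \<and> closed_segment y z \<subseteq> ?S \<and> linear_on_segment F y z"
    if y: "y \<in> ?S" for y
  proof -
    have ys: "-\<epsilon> \<le> snd y" "snd y \<le> \<epsilon>" using y by (auto simp: Omega_SW_def strip_def)
    have seg: "linear_on_segment F y z"
      if "closed_segment y z \<subseteq> ?S"
        and "\<And>t. t \<in> {0..1} \<Longrightarrow> G ((1 - t) *\<^sub>R y + t *\<^sub>R z) = (1 - t) * G y + t * G z" for z
      unfolding linear_on_segment_def
    proof
      fix t :: real assume t: "t \<in> {0..1}"
      have FG: "F x = G x" if "x \<in> closed_segment y z" for x
        using that \<open>closed_segment y z \<subseteq> ?S\<close> F by blast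
      have "(1 - t) *\<^sub>R y + t *\<^sub>R z \<in> closed_segment y z"
        using t unfolding in_segment atLeastAtMost_iff by blast
      then show "F ((1 - t) *\<^sub>R y + t *\<^sub>R z) = (1 - t) * F y + t * F z"
        using that(2)[OF t] FG FG[OF ends_in_segment(1)] FG[OF ends_in_segment(2)] by simp
    qed
    show ?thesis
    proof (cases "y \<in> U")
      case True
      define z where "z = (fst y + snd y - \<epsilon>, \<epsilon>)"
      have "x \<in> closed_segment y z \<longleftrightarrow> fst x + snd x = fst y + snd y \<and> snd y \<le> snd x \<and> snd x \<le> \<epsilon>" for x
        using mem_closed_segment_antidiagonal[of "snd y" \<epsilon> x "fst y"] ys by (simp add: z_def)
      then have sub: "closed_segment y z \<subseteq> ?S \<inter> U"
        using y True by (auto simp: Omega_SW_def U_def strip_def)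
      have "linear_on_segment F y z"
      proof (rule seg)
        fix t :: real assume t: "t \<in> {0..1}"
        define x where "x = (1 - t) *\<^sub>R y + t *\<^sub>R z"
        have "x \<in> closed_segment y z" using t unfolding x_def in_segment atLeastAtMost_iff by blast
        then have xU: "x \<in> U" "z \<in> U" using sub ends_in_segment(2) by blast+
        have x: "fst x + snd x = fst y + snd y" "\<epsilon> - snd x = (1 - t) * (\<epsilon> - snd y)"
          "fst z + snd z = fst y + snd y" "\<epsilon> - snd z = 0"
          by (auto simp: x_def z_def algebra_simps)
        have "GU x = (1 - t) * GU y + t * GU z" unfolding GU_def x by (simp add: algebra_simps)
        then show "G ((1 - t) *\<^sub>R y + t *\<^sub>R z) = (1 - t) * G y + t * G z"
          using xU True by (simp add: G_U x_def)
      qed (use sub in auto)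
      then show ?thesis using sub
        by (intro bexI[of _ z]) (auto simp: z_def strip_boundary_def same_diagonal_def)
    next
      case False
      then have yL: "y \<in> Lo" using y S strip_cover by auto
      define z where "z = (fst y - snd y - \<epsilon>, -\<epsilon>)"
      have "x \<in> closed_segment y z \<longleftrightarrow> fst x - snd x = fst y - snd y \<and> -\<epsilon> \<le> snd x \<and> snd x \<le> snd y" for x
        using mem_closed_segment_diagonal[of "-\<epsilon>" "snd y" x "fst y"] ys by (simp add: z_def)
      moreover have "vm + 2 * \<epsilon> \<le> fst y - snd y" using yL by (simp add: Lo_def)
      ultimately have sub: "closed_segment y z \<subseteq> ?S \<inter> Lo"
        using y yL d by (auto simp: Omega_SW_def Lo_def strip_def)
      have "linear_on_segment F y z"
      proof (rule seg)
        fix t :: real assume t: "t \<in> {0..1}"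
        define x where "x = (1 - t) *\<^sub>R y + t *\<^sub>R z"
        have "x \<in> closed_segment y z" using t unfolding x_def in_segment atLeastAtMost_iff by blast
        then have xL: "x \<in> Lo" "z \<in> Lo" using sub ends_in_segment(2) by blast+
        have x: "fst x - snd x = fst y - snd y" "\<epsilon> + snd x = (1 - t) * (\<epsilon> + snd y)"
          "fst z - snd z = fst y - snd y" "\<epsilon> + snd z = 0"
          by (auto simp: x_def z_def algebra_simps)
        have "GL x = (1 - t) * GL y + t * GL z" unfolding GL_def x by (simp add: algebra_simps)
        then show "G ((1 - t) *\<^sub>R y + t *\<^sub>R z) = (1 - t) * G y + t * G z"
          using xL yL by (simp add: G_Lo x_def)
      qed (use sub in auto)
      then show ?thesis using sub
        by (intro bexI[of _ z]) (auto simp: z_def strip_boundary_def same_diagonal_def)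
    qed
  qed
  show ?thesis unfolding bellman_candidate_def
    using S conc top bottom ribs by blast
qed

subsection \<open>The foliation\<close>

definition "spine_interval = {vm + \<epsilon>..up + \<epsilon>}"
text \<open>In terms of \<open>\<sigma>\<close> and \<open>\<delta>\<close> there is no division by
  \<open>T\<close>, so this is the continuous extension through the zero of
  \<open>T\<close>.\<close>

definition "A u = fp (pc (TU u) - \<epsilon>) + (\<epsilon> - TU u) * (\<sigma> (TU u) + \<delta> (TU u))"

lemma uc_ends: "uc (-\<epsilon>) = vm + \<epsilon>" "uc \<epsilon> = up + \<epsilon>"
  by (auto simp: uc_def vm_def up_def qc_def)

lemma uc_image: "uc ` {-\<epsilon>..\<epsilon>} = spine_interval"
proof
  show "uc ` {-\<epsilon>..\<epsilon>} \<subseteq> spine_interval"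
  proof
    fix u assume "u \<in> uc ` {-\<epsilon>..\<epsilon>}"
    then obtain t where t: "t \<in> {-\<epsilon>..\<epsilon>}" "u = uc t" by auto
    then show "u \<in> spine_interval"
      using curve_le(3)[of "-\<epsilon>" t] curve_le(3)[of t \<epsilon>] eps by (auto simp: spine_interval_def uc_ends)
  qed
  show "spine_interval \<subseteq> uc ` {-\<epsilon>..\<epsilon>}"
  proof
    fix u assume "u \<in> spine_interval"
    then have "uc (TU u) = u" using TU(4) by (simp add: spine_interval_def)
    then show "u \<in> uc ` {-\<epsilon>..\<epsilon>}" using TU(2) by (metis imageI)
  qed
qed

lemma in_spine_interval:
  assumes "u \<in> spine_interval"
  obtains t where "t \<in> {-\<epsilon>..\<epsilon>}" "u = uc t" "TU u = t"
  using assms TU(3) unfolding uc_image[symmetric] by blast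

lemma uc_mem: "t \<in> {-\<epsilon>..\<epsilon>} \<Longrightarrow> uc t \<in> spine_interval"
  using uc_image by blast

lemma TU_derivative:
  assumes "u \<in> spine_interval"
  shows "(TU has_real_derivative inverse (pc' (TU u) - 1)) (at u within spine_interval)"
proof -
  obtain t where t: "t \<in> {-\<epsilon>..\<epsilon>}" "u = uc t" "TU u = t" by (rule in_spine_interval[OF assms])
  have "(TU has_real_derivative inverse (pc' t - 1)) (at (uc t) within uc ` {-\<epsilon>..\<epsilon>})"
  proof (rule has_real_derivative_inverse_within[OF uc[OF t(1)]])
    show "pc' t - 1 \<noteq> 0" using pc'_ge[OF t(1)] by simp
    show "continuous (at (uc t) within uc ` {-\<epsilon>..\<epsilon>}) TU"
      using TU(1) by (meson continuous_at_imp_continuous_at_within continuous_on_eq_continuous_at open_UNIV UNIV_I)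
  qed (use t TU(3) in auto)
  then show ?thesis using t uc_image by simp
qed

text \<open>The spine has slope \<open>1 / (pc' - 1)\<close>, so \<open>pc' \<ge> 2\<close> is the
  slope condition. Equality is possible only at the bottom end, the one exceptional point.\<close>

lemma SW_fissure_TU: "SW_fissure \<epsilon> (vm + \<epsilon>) (up + \<epsilon>) TU"
  unfolding SW_fissure_def spine_function_def spine_interval_def[symmetric]
proof (intro conjI exI[of _ "\<lambda>u. inverse (pc' (TU u) - 1)"] ballI)
  show "vm + \<epsilon> < up + \<epsilon>" using vm_less_up eps by simp
  show "TU ` spine_interval \<subseteq> {-\<epsilon>..\<epsilon>}" using TU(2) by blast
  show "TU (vm + \<epsilon>) = -\<epsilon>" "TU (up + \<epsilon>) = \<epsilon>"
    using TU(3)[of "-\<epsilon>"] TU(3)[of \<epsilon>] eps by (auto simp: uc_ends)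
  show "continuous_on spine_interval (\<lambda>u. inverse (pc' (TU u) - 1))"
  proof (intro continuous_intros continuous_on_compose2[OF pc'_cont continuous_on_subset[OF TU(1)]] ballI)
    show "pc' (TU u) - 1 \<noteq> 0" for u using pc'_ge[OF TU(2), of u] by simp
  qed (use TU(2) in auto)
  show "(TU has_real_derivative inverse (pc' (TU u) - 1)) (at u within spine_interval)"
    if "u \<in> spine_interval" for u by (rule TU_derivative[OF that])
  show "\<bar>inverse (pc' (TU u) - 1)\<bar> \<le> 1" if "u \<in> spine_interval" for u
    using pc'_ge[OF TU(2), of u] by (simp add: abs_if inverse_le_1_iff)
  have "{u \<in> spine_interval. \<not> \<bar>inverse (pc' (TU u) - 1)\<bar> < 1} \<subseteq> {vm + \<epsilon>}"
  proof
    fix u assume u: "u \<in> {u \<in> spine_interval. \<not> \<bar>inverse (pc' (TU u) - 1)\<bar> < 1}"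
    then obtain t where t: "t \<in> {-\<epsilon>..\<epsilon>}" "u = uc t" "TU u = t" using in_spine_interval by blast
    have "t = -\<epsilon>"
    proof (rule ccontr)
      assume "t \<noteq> -\<epsilon>"
      then have "2 < pc' t" using pc'_gt[of t] t by auto
      then show False using u t by (auto simp: abs_if inverse_less_1_iff)
    qed
    then show "u \<in> {vm + \<epsilon>}" using t by (simp add: uc_ends)
  qed
  then show "finite {u \<in> spine_interval. \<not> \<bar>inverse (pc' (TU u) - 1)\<bar> < 1}"
    using finite_subset by blast
qed

text \<open>By the spine relation the bracket in the formula equals \<open>2 * T * \<sigma>\<close>,
  which cancels the \<open>T\<close> in the denominator.\<close>

lemma spine_value_A: "spine_value \<epsilon> fp fm TU spine_interval A"
  unfolding spine_value_def
proof (intro conjI ballI impI)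
  show "continuous_on spine_interval A" unfolding A_def[abs_def]
    by (intro continuous_intros continuous_on_compose2[OF f_cont(1)[of UNIV]] continuous_on_compose2[OF curve_cont(1)]
        continuous_on_compose2[OF \<sigma>\<delta>_cont(1)] continuous_on_compose2[OF \<sigma>\<delta>_cont(2)] continuous_on_subset[OF TU(1)])
      (use TU(2) in auto)
  fix u assume "u \<in> spine_interval" "TU u \<noteq> 0"
  then obtain t where t: "t \<in> {-\<epsilon>..\<epsilon>}" "u = uc t" "TU u = t" "t \<noteq> 0" using in_spine_interval by metis
  have d: "deriv fp = fp1" "deriv fm = fm1" using DERIV_imp_deriv[OF fp] DERIV_imp_deriv[OF fm] by auto
  have args: "u + TU u - \<epsilon> = pc t - \<epsilon>" "u - TU u - \<epsilon> = qc t - \<epsilon>"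
    using t by (auto simp: uc_def qc_def)
  have *: "(\<epsilon> + t) * fp1 (pc t - \<epsilon>) - (\<epsilon> - t) * fm1 (qc t - \<epsilon>) = 2 * t * \<sigma> t"
  proof -
    have f: "fm1 (qc t - \<epsilon>) = fp1 (pc t - \<epsilon>) - 2 * t * \<kappa> t" using spine_qc[OF t(1)] by simp
    show ?thesis unfolding f by (simp add: \<sigma>_def algebra_simps)
  qed
  have 1: "(\<epsilon>\<^sup>2 - t\<^sup>2) / (2 * \<epsilon> * t) * (2 * t * \<sigma> t) = (\<epsilon>\<^sup>2 - t\<^sup>2) * \<sigma> t / \<epsilon>"
    using t(4) eps by simp
  have "\<epsilon> * (2 * \<epsilon> * \<delta> t) = \<epsilon> * (2 * t * \<sigma> t - fp (pc t - \<epsilon>) + fm (qc t - \<epsilon>))"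
    using eps by (simp add: \<delta>_def)
  then have 2: "fp (pc t - \<epsilon>) + (\<epsilon> - t) * (\<sigma> t + \<delta> t) =
      (\<epsilon>\<^sup>2 - t\<^sup>2) * \<sigma> t / \<epsilon> + ((\<epsilon> + t) * fp (pc t - \<epsilon>) + (\<epsilon> - t) * fm (qc t - \<epsilon>)) / (2 * \<epsilon>)"
    using eps by (simp add: \<delta>_def field_simps power2_eq_square)
  show "A u = (\<epsilon>\<^sup>2 - (TU u)\<^sup>2) / (2 * \<epsilon> * TU u) *
      ((\<epsilon> + TU u) * deriv fp (u + TU u - \<epsilon>) - (\<epsilon> - TU u) * deriv fm (u - TU u - \<epsilon>)) +
      ((\<epsilon> + TU u) * fp (u + TU u - \<epsilon>) + (\<epsilon> - TU u) * fm (u - TU u - \<epsilon>)) / (2 * \<epsilon>)"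
    unfolding d args unfolding t(3) * 1 by (simp add: A_def t(3) 2)
qed

lemma mem_upper_rib:
  "t \<in> {-\<epsilon>..\<epsilon>} \<Longrightarrow> x \<in> upper_rib \<epsilon> TU (uc t) \<longleftrightarrow> fst x + snd x = pc t \<and> t \<le> snd x \<and> snd x \<le> \<epsilon>"
  using mem_closed_segment_antidiagonal[of t \<epsilon> x "uc t"] TU(3)[of t] by (simp add: upper_rib_def uc_def)

lemma mem_lower_rib:
  assumes "t \<in> {-\<epsilon>..\<epsilon>}"
  shows "x \<in> lower_rib \<epsilon> TU (uc t) \<longleftrightarrow> fst x - snd x = qc t \<and> -\<epsilon> \<le> snd x \<and> snd x \<le> t"
proof -
  have "uc t - t = qc t" by (simp add: uc_def qc_def)
  then show ?thesis
    using mem_closed_segment_diagonal[of "-\<epsilon>" t x "uc t"] TU(3)[of t] assms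
    by (simp add: lower_rib_def)
qed

text \<open>Ribs on the same side differ in \<open>p\<close> or \<open>q\<close>. If an upper rib
  from height \<open>s\<close> meets a lower rib from height \<open>t\<close>, then
  \<open>s \<le> x\<^sub>2 \<le> t\<close>, while comparing \<open>q\<close> gives
  \<open>t \<le> s\<close>.\<close>

lemma rib_unique:
  assumes s: "s \<in> {-\<epsilon>..\<epsilon>}" "x \<in> ribs \<epsilon> TU (uc s)" and t: "t \<in> {-\<epsilon>..\<epsilon>}" "x \<in> ribs \<epsilon> TU (uc t)"
  shows "s = t"
proof -
  have mixed: "s = t" if s: "s \<in> {-\<epsilon>..\<epsilon>}" "x \<in> upper_rib \<epsilon> TU (uc s)"
    and t: "t \<in> {-\<epsilon>..\<epsilon>}" "x \<in> lower_rib \<epsilon> TU (uc t)" for s t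
  proof -
    have xs: "fst x + snd x = pc s" "s \<le> snd x" using mem_upper_rib[OF s(1)] s(2) by auto
    have xt: "fst x - snd x = qc t" "snd x \<le> t" using mem_lower_rib[OF t(1)] t(2) by auto
    have "qc t \<le> qc s" using xs xt unfolding qc_def by linarith
    then have "t \<le> s" using curve_le(2)[OF t(1) s(1)] by simp
    then show ?thesis using xs xt by linarith
  qed
  from s(2) t(2) show ?thesis unfolding ribs_def
  proof (elim UnE)
    assume "x \<in> upper_rib \<epsilon> TU (uc s)" "x \<in> upper_rib \<epsilon> TU (uc t)"
    then have "pc s = pc t" using mem_upper_rib[OF s(1), of x] mem_upper_rib[OF t(1), of x] by simp
    then show ?thesis using curve_eq(1)[OF s(1) t(1)] by simp
  next
    assume "x \<in> lower_rib \<epsilon> TU (uc s)" "x \<in> lower_rib \<epsilon> TU (uc t)"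
    then have "qc s = qc t" using mem_lower_rib[OF s(1), of x] mem_lower_rib[OF t(1), of x] by simp
    then show ?thesis using curve_eq(2)[OF s(1) t(1)] by simp
  qed (use mixed s(1) t(1) in blast)+
qed

lemma rib_parameter_unique:
  assumes "t \<in> {-\<epsilon>..\<epsilon>}" "x \<in> ribs \<epsilon> TU (uc t)" "u \<in> spine_interval" "x \<in> ribs \<epsilon> TU u"
  shows "u = uc t"
proof -
  obtain s where s: "s \<in> {-\<epsilon>..\<epsilon>}" "u = uc s" by (rule in_spine_interval[OF assms(3)])
  then show ?thesis using rib_unique[OF s(1) _ assms(1,2)] assms(4) by simp
qed

lemma on_rib:
  assumes "x \<in> Omega_SW \<epsilon> vm up"
  obtains t where "t \<in> {-\<epsilon>..\<epsilon>}" "x \<in> ribs \<epsilon> TU (uc t)"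
proof -
  have x: "-\<epsilon> \<le> snd x" "snd x \<le> \<epsilon>" "vm \<le> fst x + snd x" "fst x - snd x \<le> up" and xs: "x \<in> strip \<epsilon>"
    using assms by (auto simp: Omega_SW_def strip_def)
  have e: "-\<epsilon> \<in> {-\<epsilon>..\<epsilon>}" "\<epsilon> \<in> {-\<epsilon>..\<epsilon>}" using eps by auto
  from xs consider "x \<in> U" | "x \<in> Lo" using strip_cover by blast
  then have "\<exists>t\<in>{-\<epsilon>..\<epsilon>}. x \<in> ribs \<epsilon> TU (uc t)"
  proof cases
    case 1
    then show ?thesis
    proof (cases rule: U_cases)
      case 1
      then have "x \<in> upper_rib \<epsilon> TU (uc (-\<epsilon>))" using mem_upper_rib[OF e(1), of x] x by (simp add: vm_def)
      then show ?thesis using e by (auto simp: ribs_def)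
    next
      case (2 t)
      then have "x \<in> upper_rib \<epsilon> TU (uc t)" using mem_upper_rib[OF 2(1), of x] x by simp
      then show ?thesis using 2(1) by (auto simp: ribs_def)
    qed
  next
    case 2
    then show ?thesis
    proof (cases rule: Lo_cases)
      case 1
      then have "x \<in> lower_rib \<epsilon> TU (uc \<epsilon>)" using mem_lower_rib[OF e(2), of x] x by (simp add: up_def)
      then show ?thesis using e by (auto simp: ribs_def)
    next
      case (2 t)
      then have "x \<in> lower_rib \<epsilon> TU (uc t)" using mem_lower_rib[OF 2(1), of x] x by simp
      then show ?thesis using 2(1) by (auto simp: ribs_def)
    qed
  qed
  then show thesis using that by blast
qed

lemma ribs_subset:
  assumes t: "t \<in> {-\<epsilon>..\<epsilon>}" shows "ribs \<epsilon> TU (uc t) \<subseteq> Omega_SW \<epsilon> vm up"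
proof
  fix x assume "x \<in> ribs \<epsilon> TU (uc t)"
  then consider "fst x + snd x = pc t \<and> t \<le> snd x \<and> snd x \<le> \<epsilon>" | "fst x - snd x = qc t \<and> -\<epsilon> \<le> snd x \<and> snd x \<le> t"
    using mem_upper_rib[OF t] mem_lower_rib[OF t] by (auto simp: ribs_def)
  then show "x \<in> Omega_SW \<epsilon> vm up"
    by cases (use curve_bounds[OF t] t in \<open>auto simp: Omega_SW_def strip_def qc_def\<close>)
qed

lemma foliates_TU: "foliates \<epsilon> TU spine_interval (Omega_SW \<epsilon> vm up)"
  unfolding foliates_def
proof (intro conjI ballI)
  show "(\<Union>u\<in>spine_interval. ribs \<epsilon> TU u) = Omega_SW \<epsilon> vm up"
  proof
    show "(\<Union>u\<in>spine_interval. ribs \<epsilon> TU u) \<subseteq> Omega_SW \<epsilon> vm up"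
    proof (rule UN_least)
      fix u assume "u \<in> spine_interval"
      then obtain t where "t \<in> {-\<epsilon>..\<epsilon>}" "u = uc t" by (rule in_spine_interval)
      then show "ribs \<epsilon> TU u \<subseteq> Omega_SW \<epsilon> vm up" using ribs_subset by simp
    qed
    show "Omega_SW \<epsilon> vm up \<subseteq> (\<Union>u\<in>spine_interval. ribs \<epsilon> TU u)"
    proof
      fix x assume "x \<in> Omega_SW \<epsilon> vm up"
      then obtain t where "t \<in> {-\<epsilon>..\<epsilon>}" "x \<in> ribs \<epsilon> TU (uc t)" by (rule on_rib)
      then show "x \<in> (\<Union>u\<in>spine_interval. ribs \<epsilon> TU u)" by (intro UN_I[OF uc_mem])
    qed
  qed
  show "\<exists>!u. u \<in> spine_interval \<and> x \<in> ribs \<epsilon> TU u" if x: "x \<in> Omega_SW \<epsilon> vm up" for x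
  proof -
    obtain t where t: "t \<in> {-\<epsilon>..\<epsilon>}" "x \<in> ribs \<epsilon> TU (uc t)"
      using on_rib[OF x] by blast
    show ?thesis
      by (rule ex1I[of _ "uc t"]) (use t uc_mem rib_parameter_unique in auto)
  qed
qed

lemma rib_interpolation:
  fixes a e f s :: real
  assumes "e \<noteq> 0"
  shows "a / e * (f + e * s) + (e - a) / e * f = f + a * s"
  using assms by (simp add: field_simps)

lemma chord_interpolation:
  fixes y f g :: real
  shows "g + (\<epsilon> + y) * ((f - g) / (2 * \<epsilon>)) = (\<epsilon> + y) / (2 * \<epsilon>) * f + (\<epsilon> - y) / (2 * \<epsilon>) * g"
    and "f + (\<epsilon> - y) * ((g - f) / (2 * \<epsilon>)) = (\<epsilon> + y) / (2 * \<epsilon>) * f + (\<epsilon> - y) / (2 * \<epsilon>) * g"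
  using eps by (simp_all add: field_simps)

lemma herringbone_fun_G:
  assumes x: "x \<in> Omega_SW \<epsilon> vm up"
  shows "herringbone_fun \<epsilon> fp fm TU spine_interval A x = G x"
proof -
  obtain t where t: "t \<in> {-\<epsilon>..\<epsilon>}" "x \<in> ribs \<epsilon> TU (uc t)" by (rule on_rib[OF x])
  have x2: "-\<epsilon> \<le> snd x" "snd x \<le> \<epsilon>" and xs: "x \<in> strip \<epsilon>" using x by (auto simp: Omega_SW_def strip_def)
  have "rib_parameter \<epsilon> TU spine_interval x = uc t"
    unfolding rib_parameter_def
  proof (rule the_equality)
    show "uc t \<in> spine_interval \<and> x \<in> ribs \<epsilon> TU (uc t)" using t uc_mem by blast
    show "u = uc t" if "u \<in> spine_interval \<and> x \<in> ribs \<epsilon> TU u" for u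
      using that rib_parameter_unique[OF t] by simp
  qed
  then have u: "rib_parameter \<epsilon> TU spine_interval x = uc t" "TU (uc t) = t" using TU(3)[OF t(1)] by auto
  have args: "uc t + t - \<epsilon> = pc t - \<epsilon>" "uc t - t - \<epsilon> = qc t - \<epsilon>" by (auto simp: uc_def qc_def)
  have A_t: "A (uc t) = fp (pc t - \<epsilon>) + (\<epsilon> - t) * (\<sigma> t + \<delta> t)" by (simp add: A_def u)
  have A_t': "A (uc t) = fm (qc t - \<epsilon>) + (\<epsilon> + t) * (\<sigma> t - \<delta> t)" by (simp add: A_t spine_value_eq)
  show ?thesis
  proof (cases "t \<le> snd x")
    case True
    have p: "fst x + snd x = pc t"
      using t(2) mem_upper_rib[OF t(1), of x] mem_lower_rib[OF t(1), of x] True by (auto simp: ribs_def qc_def)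
    have "G x = fp (pc t - \<epsilon>) + (\<epsilon> - snd x) * (\<sigma> t + \<delta> t)"
      using G_U(1)[OF U_ribI[OF xs t(1) p True]] by (simp add: GU_def p k_pc[OF t(1)])
    \<comment> \<open>At \<open>t = \<epsilon>\<close> the upper rib is a single boundary point; the
      separate branch of \<open>herringbone_fun\<close> must return the value of \<open>G\<close>
      there.\<close>
    moreover have "fst x = pc t - \<epsilon>" "snd x = \<epsilon>" if "t = \<epsilon>" using True p x2 that by auto
    moreover have "(\<epsilon> - snd x) / (\<epsilon> - t) * A (uc t) + (snd x - t) / (\<epsilon> - t) * fp (pc t - \<epsilon>)
        = fp (pc t - \<epsilon>) + (\<epsilon> - snd x) * (\<sigma> t + \<delta> t)" if "t \<noteq> \<epsilon>"
      unfolding A_t using rib_interpolation[of "\<epsilon> - t" "\<epsilon> - snd x"] that by simp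
    ultimately show ?thesis
      unfolding herringbone_fun_def Let_def u args using True by simp
  next
    case False
    have q: "fst x - snd x = qc t"
      using t(2) mem_upper_rib[OF t(1), of x] mem_lower_rib[OF t(1), of x] False by (auto simp: ribs_def)
    have "G x = fm (qc t - \<epsilon>) + (\<epsilon> + snd x) * (\<sigma> t - \<delta> t)"
      using G_Lo(1)[OF Lo_ribI[OF xs t(1) q]] False by (simp add: GL_def q l_qc[OF t(1)])
    moreover have "t \<noteq> -\<epsilon>" using False x2 by auto
    moreover have "(\<epsilon> + snd x) / (\<epsilon> + t) * A (uc t) + (t - snd x) / (\<epsilon> + t) * fm (qc t - \<epsilon>)
        = fm (qc t - \<epsilon>) + (\<epsilon> + snd x) * (\<sigma> t - \<delta> t)" if "t \<noteq> -\<epsilon>"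
    proof -
      have "\<epsilon> + t \<noteq> 0" using that by auto
      then show ?thesis unfolding A_t' using rib_interpolation[of "\<epsilon> + t" "\<epsilon> + snd x"] by simp
    qed
    ultimately show ?thesis
      unfolding herringbone_fun_def Let_def u args using False by simp
  qed
qed

lemma G_tangent_R:
  assumes "x \<in> Omega_R \<epsilon> up b"
  shows "G x = tangent_R \<epsilon> fp fm x"
proof -
  have x: "x \<in> strip \<epsilon>" "up \<le> fst x - snd x" using assms by (auto simp: Omega_R_def)
  show ?thesis
    unfolding G_Lo(1)[OF Lo_rightI[OF x]] GL_def tangent_R_def l_right[OF x(2)]
    by (rule chord_interpolation(1))
qed

lemma G_tangent_L:
  assumes "x \<in> Omega_L \<epsilon> a vm"
  shows "G x = tangent_L \<epsilon> fp fm x"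
proof -
  have x: "x \<in> strip \<epsilon>" "fst x + snd x \<le> vm" using assms by (auto simp: Omega_L_def)
  show ?thesis
    unfolding G_U(1)[OF U_leftI[OF x]] GU_def tangent_L_def k_left[OF x(2)]
    by (rule chord_interpolation(2))
qed

text \<open>The enlarged region has the same shape because
  \<open>q \<le> vm + 2 * \<epsilon> < up\<close> in the left tangent domain and
  \<open>p \<ge> up - 2 * \<epsilon> > vm\<close> in the right one.\<close>

lemma Omega_union:
  assumes "0 \<le> d"
  shows "Omega_R \<epsilon> up (up + d) \<union> Omega_L \<epsilon> (vm - d) vm \<union> Omega_SW \<epsilon> vm up = Omega_SW \<epsilon> (vm - d) (up + d)"
proof (rule set_eqI)
  fix x :: "real \<times> real"
  show "x \<in> Omega_R \<epsilon> up (up + d) \<union> Omega_L \<epsilon> (vm - d) vm \<union> Omega_SW \<epsilon> vm up \<longleftrightarrow> x \<in> Omega_SW \<epsilon> (vm - d) (up + d)"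
    unfolding Omega_R_def Omega_L_def Omega_SW_def strip_def Un_iff mem_Collect_eq
    using vm_less_up assms eps by linarith
qed

lemma fissure_candidate:
  assumes "admissible d" "0 < d"
  defines "B \<equiv> herringbone_fun \<epsilon> fp fm TU spine_interval A"
  shows "bellman_candidate \<epsilon> fp fm (Omega_SW \<epsilon> vm up) B"
    and "\<exists>\<delta>>0. \<exists>G.
          (\<forall>x\<in>Omega_R \<epsilon> up (up + \<delta>). G x = tangent_R \<epsilon> fp fm x) \<and>
          (\<forall>x\<in>Omega_L \<epsilon> (vm - \<delta>) vm. G x = tangent_L \<epsilon> fp fm x) \<and>
          (\<forall>x\<in>Omega_SW \<epsilon> vm up. G x = B x) \<and>
          (let S = Omega_R \<epsilon> up (up + \<delta>) \<union> Omega_L \<epsilon> (vm - \<delta>) vm \<union> Omega_SW \<epsilon> vm up in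
             C1_on S G \<and> bellman_candidate \<epsilon> fp fm S G)"
proof -
  have "admissible 0" using admissible_mono[OF assms(1)] assms(2) by simp
  then show "bellman_candidate \<epsilon> fp fm (Omega_SW \<epsilon> vm up) B"
    using bellman_candidate_G[of 0 B] herringbone_fun_G by (simp add: B_def)
  have "C1_on (Omega_SW \<epsilon> (vm - d) (up + d)) G" by (rule C1_G) (auto simp: Omega_SW_def)
  moreover have "bellman_candidate \<epsilon> fp fm (Omega_SW \<epsilon> (vm - d) (up + d)) G"
    by (rule bellman_candidate_G[OF assms(1)]) simp
  ultimately show "\<exists>\<delta>>0. \<exists>G.
          (\<forall>x\<in>Omega_R \<epsilon> up (up + \<delta>). G x = tangent_R \<epsilon> fp fm x) \<and>
          (\<forall>x\<in>Omega_L \<epsilon> (vm - \<delta>) vm. G x = tangent_L \<epsilon> fp fm x) \<and>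
          (\<forall>x\<in>Omega_SW \<epsilon> vm up. G x = B x) \<and>
          (let S = Omega_R \<epsilon> up (up + \<delta>) \<union> Omega_L \<epsilon> (vm - \<delta>) vm \<union> Omega_SW \<epsilon> vm up in
             C1_on S G \<and> bellman_candidate \<epsilon> fp fm S G)"
    using assms(2) G_tangent_R G_tangent_L herringbone_fun_G Omega_union[of d]
    by (intro exI[of _ d] conjI exI[of _ G]) (auto simp: B_def Let_def)
qed

end

subsection \<open>The endpoint of the spine\<close>

lemma isCont_near:
  fixes h :: "real \<Rightarrow> real"
  assumes "isCont h a" "0 < e"
  obtains d where "0 < d" "\<And>x. \<bar>x - a\<bar> < d \<Longrightarrow> \<bar>h x - h a\<bar> < e"
  using assms unfolding continuous_at_eps_delta dist_real_def by blast

locale fissure_data = small_spine_equation f2 f3 g2 u0 \<epsilon> \<alpha> B c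
  for f2 f3 g2 :: "real \<Rightarrow> real" and u0 \<epsilon> \<alpha> B c +
  fixes f f1 g g1 :: "real \<Rightarrow> real"
  assumes f: "\<And>x. (f has_real_derivative f1 x) (at x)" and f1: "\<And>x. (f1 has_real_derivative f2 x) (at x)"
    and f2: "\<And>x. (f2 has_real_derivative f3 x) (at x)"
    and g: "\<And>x. (g has_real_derivative g1 x) (at x)" and g1: "\<And>x. (g1 has_real_derivative g2 x) (at x)"
    and g2_cont: "continuous_on UNIV g2"
    and u0: "f1 u0 = g1 u0"
begin

text \<open>Its zero is \<open>u\<^sub>+\<close>. It also equals \<open>2 * \<epsilon>\<close> times
  \<open>lR u - f2 (u + \<epsilon>)\<close>, so its sign right of \<open>u\<^sub>+\<close> is one of
  the admissibility conditions.\<close>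

definition "\<psi> u = f1 (u + \<epsilon>) - g1 (u - \<epsilon>) - 2 * \<epsilon> * f2 (u + \<epsilon>)"

lemma f2_cont: "continuous_on A f2" and f1_cont: "continuous_on A f1" and g1_cont: "continuous_on A g1"
  by (meson DERIV_continuous_on f1 f2 g1 has_field_derivative_at_within)+

lemma \<psi>_derivative: "(\<psi> has_real_derivative f2 (u + \<epsilon>) - g2 (u - \<epsilon>) - 2 * \<epsilon> * f3 (u + \<epsilon>)) (at u)"
proof -
  have p: "((\<lambda>u. u + \<epsilon>) has_real_derivative 1) (at u)" and m: "((\<lambda>u. u - \<epsilon>) has_real_derivative 1) (at u)"
    by (auto intro!: derivative_eq_intros)
  show ?thesis
    using DERIV_diff[OF DERIV_diff[OF DERIV_chain2[OF f1 p] DERIV_chain2[OF g1 m]] DERIV_cmult[OF DERIV_chain2[OF f2 p], of "2 * \<epsilon>"]]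
    unfolding \<psi>_def[abs_def] by simp
qed

lemma \<psi>_slope:
  assumes "u \<in> {u0 - 4 * \<epsilon>..u0 + 4 * \<epsilon>}"
  shows "0 < f2 (u + \<epsilon>) - g2 (u - \<epsilon>) - 2 * \<epsilon> * f3 (u + \<epsilon>)"
proof -
  have m: "u + \<epsilon> \<in> {u0 - 8 * \<epsilon>..u0 + 8 * \<epsilon>}" "u - \<epsilon> \<in> {u0 - 8 * \<epsilon>..u0 + 8 * \<epsilon>}" using assms eps by auto
  have "2 * \<epsilon> * f3 (u + \<epsilon>) \<le> 2 * \<epsilon> * (2 * c)" using bound[OF m(1)] eps by (intro mult_left_mono) auto
  moreover have "0 < \<epsilon> * c" using eps c by simp
  ultimately show ?thesis using gap[OF m] small(1) alpha by auto
qed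

lemma \<psi>_increasing:
  assumes "u0 \<le> a" "a < b" "b \<le> u0 + 2 * \<epsilon>"
  shows "\<psi> a < \<psi> b"
proof (rule DERIV_pos_imp_increasing[OF assms(2)])
  fix x assume "a \<le> x" "x \<le> b"
  then have "x \<in> {u0 - 4 * \<epsilon>..u0 + 4 * \<epsilon>}" using assms eps by auto
  then show "\<exists>y. (\<psi> has_real_derivative y) (at x) \<and> 0 < y" using \<psi>_derivative \<psi>_slope by blast
qed

lemma f2_mono:
  assumes "u0 - 8 * \<epsilon> \<le> a" "a \<le> b" "b \<le> u0 + 8 * \<epsilon>"
  shows "f2 a \<le> f2 b"
proof (rule DERIV_nonneg_imp_nondecreasing[OF assms(2)])
  fix x assume "a \<le> x" "x \<le> b"
  then have "c / 2 \<le> f3 x" using bound[of x] assms by auto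
  then show "\<exists>y. (f2 has_real_derivative y) (at x) \<and> 0 \<le> y" using f2 c by (intro exI[of _ "f3 x"]) auto
qed

text \<open>To leading order \<open>\<psi> (u0 + s)\<close> is
  \<open>(s - \<epsilon>) * (f2 u0 - g2 u0)\<close>: the root lies near
  \<open>u0 + \<epsilon>\<close>, and the two ends of the interval have opposite signs. Mean values
  make this exact at both ends.\<close>

lemma \<psi>_left: "\<psi> u0 < 0"
proof -
  have lt: "u0 < u0 + \<epsilon>" "u0 - \<epsilon> < u0" using eps by auto
  obtain y where y: "u0 < y" "y < u0 + \<epsilon>" "f1 (u0 + \<epsilon>) - f1 u0 = (u0 + \<epsilon> - u0) * f2 y"
    by (rule MVT_real_derivative[OF lt(1) f1_cont f1])
  obtain z where z: "u0 - \<epsilon> < z" "z < u0" "g1 u0 - g1 (u0 - \<epsilon>) = (u0 - (u0 - \<epsilon>)) * g2 z"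
    by (rule MVT_real_derivative[OF lt(2) g1_cont g1])
  have "f2 y \<le> f2 (u0 + \<epsilon>)" by (rule f2_mono) (use y eps in auto)
  moreover have "\<alpha> \<le> f2 (u0 + \<epsilon>) - g2 z" by (rule gap) (use z eps in auto)
  ultimately have "\<epsilon> * (f2 y + g2 z - 2 * f2 (u0 + \<epsilon>)) < 0" using eps alpha by (intro mult_pos_neg) auto
  moreover have "\<psi> u0 = \<epsilon> * (f2 y + g2 z - 2 * f2 (u0 + \<epsilon>))" using y(3) z(3) u0 by (simp add: \<psi>_def algebra_simps)
  ultimately show ?thesis by simp
qed

lemma \<psi>_right: "0 < \<psi> (u0 + 2 * \<epsilon>)"
proof -
  have lt: "u0 < u0 + 3 * \<epsilon>" "u0 < u0 + \<epsilon>" using eps by auto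
  obtain y where y: "u0 < y" "y < u0 + 3 * \<epsilon>" "f1 (u0 + 3 * \<epsilon>) - f1 u0 = (u0 + 3 * \<epsilon> - u0) * f2 y"
    by (rule MVT_real_derivative[OF lt(1) f1_cont f1])
  obtain z where z: "u0 < z" "z < u0 + \<epsilon>" "g1 (u0 + \<epsilon>) - g1 u0 = (u0 + \<epsilon> - u0) * g2 z"
    by (rule MVT_real_derivative[OF lt(2) g1_cont g1])
  obtain w where w: "y < w" "w < u0 + 3 * \<epsilon>" "f2 (u0 + 3 * \<epsilon>) - f2 y = (u0 + 3 * \<epsilon> - y) * f3 w"
    by (rule MVT_real_derivative[OF y(2) f2_cont f2])
  have "(u0 + 3 * \<epsilon> - y) * f3 w \<le> (3 * \<epsilon>) * (2 * c)"
    using y w bound[of w] eps c by (intro mult_mono) auto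
  then have "f2 (u0 + 3 * \<epsilon>) - f2 y \<le> 6 * (\<epsilon> * c)" using w(3) by simp
  moreover have "\<alpha> \<le> f2 y - g2 z" by (rule gap) (use y z eps in auto)
  moreover have "0 < \<epsilon> * c" using eps c by simp
  ultimately have "0 < \<epsilon> * (3 * f2 y - g2 z - 2 * f2 (u0 + 3 * \<epsilon>))"
    using eps small(1) by (intro mult_pos_pos) auto
  moreover have "\<psi> (u0 + 2 * \<epsilon>) = \<epsilon> * (3 * f2 y - g2 z - 2 * f2 (u0 + 3 * \<epsilon>))"
  proof -
    have "u0 + 2 * \<epsilon> + \<epsilon> = u0 + 3 * \<epsilon>" "u0 + 2 * \<epsilon> - \<epsilon> = u0 + \<epsilon>" by auto
    then show ?thesis using y(3) z(3) u0 by (simp add: \<psi>_def algebra_simps)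
  qed
  ultimately show ?thesis by simp
qed

lemma unique_root:
  obtains v where "u0 < v" "v < u0 + 2 * \<epsilon>" "\<psi> v = 0"
    "\<And>u. u0 < u \<Longrightarrow> u < u0 + 2 * \<epsilon> \<Longrightarrow> \<psi> u = 0 \<Longrightarrow> u = v"
proof -
  have "continuous_on {u0..u0 + 2 * \<epsilon>} \<psi>"
    by (meson DERIV_continuous_on \<psi>_derivative has_field_derivative_at_within)
  then obtain v where v: "u0 \<le> v" "v \<le> u0 + 2 * \<epsilon>" "\<psi> v = 0"
    using IVT'[of \<psi> u0 0 "u0 + 2 * \<epsilon>"] \<psi>_left \<psi>_right eps by auto
  have "u0 < v" "v < u0 + 2 * \<epsilon>" using v \<psi>_left \<psi>_right by (auto simp: order_less_le)
  moreover have "u = v" if "u0 < u" "u < u0 + 2 * \<epsilon>" "\<psi> u = 0" for u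
    using \<psi>_increasing[of u v] \<psi>_increasing[of v u] that v by (cases u v rule: linorder_cases) auto
  ultimately show thesis using that v by blast
qed

lemma fissure_exists:
  assumes up: "u0 < up" "up < u0 + 2 * \<epsilon>" "\<psi> up = 0"
  shows "\<exists>vm T A. let I = {vm + \<epsilon>..up + \<epsilon>}; B = herringbone_fun \<epsilon> f g T I A in
        SW_fissure \<epsilon> (vm + \<epsilon>) (up + \<epsilon>) T \<and>
        u0 + \<epsilon> \<in> I \<and> T (u0 + \<epsilon>) = 0 \<and> T (up + \<epsilon>) = \<epsilon> \<and>
        vm < u0 - \<epsilon> \<and> T (vm + \<epsilon>) = - \<epsilon> \<and>
        (\<forall>u\<in>I. T u = 0 \<longrightarrow> u = u0 + \<epsilon>) \<and> spine_value \<epsilon> f g T I A \<and>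
        foliates \<epsilon> T I (Omega_SW \<epsilon> vm up) \<and>
        bellman_candidate \<epsilon> f g (Omega_SW \<epsilon> vm up) B \<and>
        (\<exists>\<delta>>0. \<exists>G.
          (\<forall>x\<in>Omega_R \<epsilon> up (up + \<delta>). G x = tangent_R \<epsilon> f g x) \<and>
          (\<forall>x\<in>Omega_L \<epsilon> (vm - \<delta>) vm. G x = tangent_L \<epsilon> f g x) \<and>
          (\<forall>x\<in>Omega_SW \<epsilon> vm up. G x = B x) \<and>
          (let S = Omega_R \<epsilon> up (up + \<delta>) \<union> Omega_L \<epsilon> (vm - \<delta>) vm \<union> Omega_SW \<epsilon> vm up in
             C1_on S G \<and> bellman_candidate \<epsilon> f g S G))"
proof -
  define X1 where "X1 = up + \<epsilon>"
  have X1: "X1 \<in> {u0 + \<epsilon>..u0 + 3 * \<epsilon>}" "f1 X1 - g1 (X1 - 2 * \<epsilon>) - 2 * \<epsilon> * f2 X1 = 0"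
    using up by (auto simp: X1_def \<psi>_def)
  obtain P P' \<kappa> \<kappa>' where
    P: "\<And>t. t \<in> {-\<epsilon>..\<epsilon>} \<Longrightarrow> (P has_real_derivative P' t) (at t within {-\<epsilon>..\<epsilon>})"
    "continuous_on {-\<epsilon>..\<epsilon>} P'" "\<And>t. t \<in> {-\<epsilon>..\<epsilon>} \<Longrightarrow> 2 \<le> P' t" "\<And>t. -\<epsilon> < t \<Longrightarrow> t \<le> \<epsilon> \<Longrightarrow> 2 < P' t"
    and \<kappa>: "continuous_on {-\<epsilon>..\<epsilon>} \<kappa>"
    and \<kappa>': "\<And>t. -\<epsilon> < t \<Longrightarrow> t < \<epsilon> \<Longrightarrow> (\<kappa> has_real_derivative \<kappa>' t) (at t) \<and> 0 \<le> \<kappa>' t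
        \<and> (\<epsilon> - t) * \<kappa>' t = (\<kappa> t - f2 (P t)) * P' t
        \<and> (\<epsilon> + t) * \<kappa>' t = (\<kappa> t - g2 (P t - 2 * t)) * (P' t - 2)"
    and spine: "\<And>t. t \<in> {-\<epsilon>..\<epsilon>} \<Longrightarrow> 2 * t * \<kappa> t = f1 (P t) - g1 (P t - 2 * t)"
    and g2_less: "\<And>t. t \<in> {-\<epsilon>..\<epsilon>} \<Longrightarrow> g2 (P t - 2 * t) < \<kappa> t"
    and f2_less: "f2 (P (-\<epsilon>)) < \<kappa> (-\<epsilon>)" and P_ends: "P \<epsilon> = X1" "P 0 = u0"
    by (rule spine_exists[OF f1 f2 g1 u0 X1]) (rule that)
  \<comment> \<open>\<open>P t\<close> is the first coordinate of the upper end of the rib, hence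
    \<open>x\<^sub>1 + x\<^sub>2 = P t + \<epsilon>\<close> along it.\<close>
  interpret F: fissure \<epsilon> f f1 f2 g g1 g2 "\<lambda>t. P t + \<epsilon>" P' \<kappa> \<kappa>'
  proof
    show "((\<lambda>t. P t + \<epsilon>) has_real_derivative P' t) (at t within {-\<epsilon>..\<epsilon>})" if "t \<in> {-\<epsilon>..\<epsilon>}" for t
      by (auto intro!: derivative_eq_intros P(1) that)
    show "(\<epsilon> - t) * \<kappa>' t = (\<kappa> t - f2 (P t + \<epsilon> - \<epsilon>)) * P' t"
      "(\<epsilon> + t) * \<kappa>' t = (\<kappa> t - g2 (P t + \<epsilon> - 2 * t - \<epsilon>)) * (P' t - 2)" if "-\<epsilon> < t" "t < \<epsilon>" for t
      using \<kappa>'[OF that] by (simp_all add: algebra_simps)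
    show "2 * t * \<kappa> t = f1 (P t + \<epsilon> - \<epsilon>) - g1 (P t + \<epsilon> - 2 * t - \<epsilon>)" if "t \<in> {-\<epsilon>..\<epsilon>}" for t
      using spine[OF that] by (simp add: algebra_simps)
  qed (use eps f f1 g g1 P \<kappa> \<kappa>' in auto)
  have ends: "-\<epsilon> \<in> {-\<epsilon>..\<epsilon>}" "0 \<in> {-\<epsilon>..\<epsilon>}" "\<epsilon> \<in> {-\<epsilon>..\<epsilon>}" using eps by auto
  have up_eq: "F.up = up" by (simp add: F.up_def F.qc_def P_ends X1_def)
  have vm_eq: "F.vm = P (-\<epsilon>) + \<epsilon>" by (simp add: F.vm_def)
  have uc0: "F.uc 0 = u0 + \<epsilon>" by (simp add: F.uc_def P_ends)
  have interval: "F.spine_interval = {F.vm + \<epsilon>..up + \<epsilon>}" by (simp add: F.spine_interval_def up_eq)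
  have cont_kL: "isCont (\<lambda>p. F.kL p - f2 (p - \<epsilon>)) F.vm" "isCont (\<lambda>p. F.kL p - g2 (p + \<epsilon>)) F.vm"
    "isCont (\<lambda>q. F.lR q - g2 (q - \<epsilon>)) up"
  proof -
    note [continuous_intros] = continuous_on_compose2[OF f2_cont[of UNIV]] continuous_on_compose2[OF f1_cont[of UNIV]]
      continuous_on_compose2[OF g1_cont[of UNIV]] continuous_on_compose2[OF g2_cont]
    have "continuous_on UNIV (\<lambda>p. F.kL p - f2 (p - \<epsilon>))" "continuous_on UNIV (\<lambda>p. F.kL p - g2 (p + \<epsilon>))"
      "continuous_on UNIV (\<lambda>q. F.lR q - g2 (q - \<epsilon>))"
      unfolding F.kL_def F.lR_def using eps by (auto intro!: continuous_intros)
    then show "isCont (\<lambda>p. F.kL p - f2 (p - \<epsilon>)) F.vm" "isCont (\<lambda>p. F.kL p - g2 (p + \<epsilon>)) F.vm"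
      "isCont (\<lambda>q. F.lR q - g2 (q - \<epsilon>)) up"
      by (auto simp: continuous_on_eq_continuous_at)
  qed
  have near: "\<exists>d>0. \<forall>x. \<bar>x - a\<bar> < d \<longrightarrow> 0 < h x" if h: "isCont h a" "0 < h a" for h :: "real \<Rightarrow> real" and a
  proof -
    obtain d where d: "0 < d" "\<And>x. \<bar>x - a\<bar> < d \<Longrightarrow> \<bar>h x - h a\<bar> < h a" by (rule isCont_near[OF h]) (rule that)
    have "0 < h x" if "\<bar>x - a\<bar> < d" for x using d(2)[OF that] by linarith
    then show ?thesis using d(1) by blast
  qed
  have args: "F.vm - \<epsilon> = P (-\<epsilon>)" "F.vm + \<epsilon> = P (-\<epsilon>) - 2 * (-\<epsilon>)" "up - \<epsilon> = P \<epsilon> - 2 * \<epsilon>"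
    by (simp_all add: vm_eq P_ends X1_def)
  \<comment> \<open>At the ends of the spine \<open>kL\<close> and \<open>lR\<close> coincide with
    \<open>\<kappa>\<close>, so these three conditions inherit strictness and hold in a
    neighbourhood.\<close>
  have pos: "0 < F.kL F.vm - f2 (F.vm - \<epsilon>)" "0 < F.kL F.vm - g2 (F.vm + \<epsilon>)" "0 < F.lR up - g2 (up - \<epsilon>)"
    using f2_less g2_less[OF ends(1)] g2_less[OF ends(3)] F.\<kappa>_ends unfolding args up_eq by simp_all
  obtain d1 where d1: "0 < d1" "\<And>p. \<bar>p - F.vm\<bar> < d1 \<Longrightarrow> f2 (p - \<epsilon>) < F.kL p"
    using near[OF cont_kL(1) pos(1)] unfolding diff_gt_0_iff_gt by blast
  obtain d2 where d2: "0 < d2" "\<And>p. \<bar>p - F.vm\<bar> < d2 \<Longrightarrow> g2 (p + \<epsilon>) < F.kL p"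
    using near[OF cont_kL(2) pos(2)] unfolding diff_gt_0_iff_gt by blast
  obtain d3 where d3: "0 < d3" "\<And>q. \<bar>q - up\<bar> < d3 \<Longrightarrow> g2 (q - \<epsilon>) < F.lR q"
    using near[OF cont_kL(3) pos(3)] unfolding diff_gt_0_iff_gt by blast
  \<comment> \<open>The fourth condition is an equality at \<open>up\<close>, so continuity is not
    enough; it holds to the right because \<open>\<psi>\<close> increases from its zero.\<close>
  have lR_ge: "f2 (q + \<epsilon>) \<le> F.lR q" if q: "up \<le> q" "q \<le> up + \<epsilon>" for q
  proof -
    have \<psi>_q: "F.lR q - f2 (q + \<epsilon>) = \<psi> q / (2 * \<epsilon>)" using eps by (simp add: F.lR_def \<psi>_def field_simps)
    have "\<psi> up \<le> \<psi> q"
    proof (rule DERIV_nonneg_imp_nondecreasing[OF q(1)])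
      fix x assume "up \<le> x" "x \<le> q"
      then have "x \<in> {u0 - 4 * \<epsilon>..u0 + 4 * \<epsilon>}" using up q eps by auto
      then show "\<exists>y. (\<psi> has_real_derivative y) (at x) \<and> 0 \<le> y"
        using \<psi>_derivative \<psi>_slope less_imp_le by blast
    qed
    then have "0 \<le> \<psi> q / (2 * \<epsilon>)" using up(3) eps by simp
    then show ?thesis using \<psi>_q by simp
  qed
  define d where "d = min (min (d1 / 2) (d2 / 2)) (min (d3 / 2) \<epsilon>)"
  have d: "0 < d" "d < d1" "d < d2" "d < d3" "d \<le> \<epsilon>" using d1 d2 d3 eps by (auto simp: d_def)
  have adm: "F.admissible d"
    unfolding F.admissible_def up_eq
  proof (intro conjI ballI)
    show "f2 (p - \<epsilon>) \<le> F.kL p" "g2 (p + \<epsilon>) \<le> F.kL p" if "p \<in> {F.vm - d..F.vm}" for p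
      using d1(2)[of p] d2(2)[of p] d that by auto
    show "g2 (q - \<epsilon>) \<le> F.lR q" "f2 (q + \<epsilon>) \<le> F.lR q" if "q \<in> {up..up + d}" for q
      using d3(2)[of q] lR_ge[of q] d that by auto
  qed (use d in simp)
  have fiss: "SW_fissure \<epsilon> (F.vm + \<epsilon>) (up + \<epsilon>) F.TU" using F.SW_fissure_TU by (simp add: up_eq)
  \<comment> \<open>\<open>qc\<close> increases from \<open>vm + 2 * \<epsilon>\<close> at the lower
    end of the spine to \<open>u0 + \<epsilon>\<close> at height 0.\<close>
  have vm_less: "F.vm < u0 - \<epsilon>"
    using F.curve_mono(2)[OF ends(1,2)] eps by (simp add: F.qc_ends F.qc_def[of 0] P_ends)
  have u0_mem: "u0 + \<epsilon> \<in> F.spine_interval" using F.uc_mem[OF ends(2)] by (simp add: uc0)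
  have T0: "F.TU (u0 + \<epsilon>) = 0" using F.TU(3)[OF ends(2)] by (simp add: uc0)
  have zeros: "u = u0 + \<epsilon>" if "u \<in> F.spine_interval" "F.TU u = 0" for u
    using F.in_spine_interval[OF that(1)] that(2) uc0 by metis
  note cand = F.fissure_candidate[OF adm d(1), unfolded up_eq]
  have T_ends: "F.TU (F.vm + \<epsilon>) = - \<epsilon>" "F.TU (up + \<epsilon>) = \<epsilon>" using fiss by (auto simp: SW_fissure_def)
  show ?thesis
    unfolding Let_def
    by (rule exI[of _ F.vm], rule exI[of _ F.TU], rule exI[of _ F.A], unfold interval[symmetric])
      (intro conjI ballI impI fiss u0_mem T0 T_ends vm_less F.spine_value_A F.foliates_TU[unfolded up_eq]
        cand(1) cand(2)[unfolded Let_def]; rule zeros; assumption)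
qed

end

section \<open>Choice of the constants for smooth data\<close>

lemma smooth_derivative:
  assumes "smooth f"
  shows "((deriv ^^ n) f has_real_derivative (deriv ^^ Suc n) f x) (at x)"
proof -
  have "(deriv ^^ n) f differentiable (at x)"
    using assms by (auto simp: smooth_def differentiable_on_def)
  then show ?thesis by (simp add: DERIV_deriv_iff_real_differentiable[symmetric])
qed

lemma bounded_near:
  fixes h :: "real \<Rightarrow> real"
  assumes "continuous_on UNIV h"
  obtains B where "\<And>x. x \<in> {a..b} \<Longrightarrow> \<bar>h x\<bar> \<le> B"
proof -
  have "bounded (h ` {a..b})"
    by (intro compact_imp_bounded compact_continuous_image continuous_on_subset[OF assms]) auto
  then show thesis using that unfolding bounded_iff by (metis image_eqI real_norm_def)
qed

theorem proposition6p1: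
  fixes fp fm :: "real \<Rightarrow> real" and u0 :: real
  assumes "smooth fp" and "smooth fm"
    and "deriv fp u0 = deriv fm u0"
    and "(deriv ^^ 2) fp u0 > (deriv ^^ 2) fm u0"
    and "(deriv ^^ 3) fp u0 > 0"
  shows "\<forall>\<^sub>F \<epsilon> in at_right 0.
    \<exists>up. is_u_plus fp fm u0 \<epsilon> up \<and> (\<forall>u. is_u_plus fp fm u0 \<epsilon> u \<longrightarrow> u = up) \<and>
      (\<exists>vm T A. let I = {vm + \<epsilon>..up + \<epsilon>}; B = herringbone_fun \<epsilon> fp fm T I A in
        SW_fissure \<epsilon> (vm + \<epsilon>) (up + \<epsilon>) T \<and>
        u0 + \<epsilon> \<in> I \<and> T (u0 + \<epsilon>) = 0 \<and> T (up + \<epsilon>) = \<epsilon> \<and>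
        vm < u0 - \<epsilon> \<and> T (vm + \<epsilon>) = - \<epsilon> \<and>
        (\<forall>u\<in>I. T u = 0 \<longrightarrow> u = u0 + \<epsilon>) \<and> spine_value \<epsilon> fp fm T I A \<and>
        foliates \<epsilon> T I (Omega_SW \<epsilon> vm up) \<and>
        bellman_candidate \<epsilon> fp fm (Omega_SW \<epsilon> vm up) B \<and>
        (\<exists>\<delta>>0. \<exists>G.
          (\<forall>x\<in>Omega_R \<epsilon> up (up + \<delta>). G x = tangent_R \<epsilon> fp fm x) \<and>
          (\<forall>x\<in>Omega_L \<epsilon> (vm - \<delta>) vm. G x = tangent_L \<epsilon> fp fm x) \<and>
          (\<forall>x\<in>Omega_SW \<epsilon> vm up. G x = B x) \<and>
          (let S = Omega_R \<epsilon> up (up + \<delta>) \<union> Omega_L \<epsilon> (vm - \<delta>) vm \<union> Omega_SW \<epsilon> vm up in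
             C1_on S G \<and> bellman_candidate \<epsilon> fp fm S G)))"
proof -
  define f where "f n = (deriv ^^ n) fp" for n
  define g where "g n = (deriv ^^ n) fm" for n
  have f: "(f n has_real_derivative f (Suc n) x) (at x)" and g: "(g n has_real_derivative g (Suc n) x) (at x)" for n x
    unfolding f_def g_def using assms(1,2) smooth_derivative by blast+
  have num: "Suc (Suc 0) = 2" "Suc 2 = 3" "Suc 3 = 4" by auto
  note f' = f[of 0] f[of "Suc 0"] f[of 2] f[of 3] and g' = g[of 0] g[of "Suc 0"] g[of 2]
  have f0: "f 0 = fp" "g 0 = fm" "f (Suc 0) = deriv fp" "g (Suc 0) = deriv fm"
    by (simp_all add: f_def g_def)
  have contf: "continuous_on S (f n)" and contg: "continuous_on S (g n)" for S n
    by (meson DERIV_continuous_on f g has_field_derivative_at_within)+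
  have isf: "isCont (f n) x" and isg: "isCont (g n) x" for n x
    using f g DERIV_isCont by blast+
  \<comment> \<open>Half the gap at \<open>u0\<close>: \<open>f 2\<close> and \<open>g 2\<close> may
    then each vary by \<open>\<alpha> / 2\<close> on the window.\<close>
  define \<alpha> where "\<alpha> = (f 2 u0 - g 2 u0) / 2"
  define c where "c = f 3 u0"
  have \<alpha>: "0 < \<alpha>" and c: "0 < c" using assms(4,5) by (auto simp: \<alpha>_def c_def f_def g_def)
  obtain r1 where r1: "0 < r1" "\<And>x. \<bar>x - u0\<bar> < r1 \<Longrightarrow> \<bar>f 2 x - f 2 u0\<bar> < \<alpha> / 2"
    using isCont_near[OF isf, of "\<alpha> / 2"] \<alpha> by auto
  obtain r2 where r2: "0 < r2" "\<And>x. \<bar>x - u0\<bar> < r2 \<Longrightarrow> \<bar>g 2 x - g 2 u0\<bar> < \<alpha> / 2"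
    using isCont_near[OF isg, of "\<alpha> / 2"] \<alpha> by auto
  obtain r3 where r3: "0 < r3" "\<And>x. \<bar>x - u0\<bar> < r3 \<Longrightarrow> \<bar>f 3 x - f 3 u0\<bar> < c / 2"
    using isCont_near[OF isf, of "c / 2"] c by auto
  \<comment> \<open>\<open>f 3\<close>, \<open>g 3\<close> and \<open>f 4\<close> are included as
    derivatives: their bounds are Lipschitz constants of \<open>f 2\<close>, \<open>g 2\<close> and
    \<open>f 3\<close>.\<close>
  have "continuous_on UNIV (\<lambda>x. \<bar>f 2 x\<bar> + \<bar>g 2 x\<bar> + \<bar>f 3 x\<bar> + \<bar>g 3 x\<bar> + \<bar>f 4 x\<bar>)"
    by (intro continuous_intros contf contg)
  then obtain B where "\<And>x. x \<in> {u0 - 1..u0 + 1} \<Longrightarrow> \<bar>\<bar>f 2 x\<bar> + \<bar>g 2 x\<bar> + \<bar>f 3 x\<bar> + \<bar>g 3 x\<bar> + \<bar>f 4 x\<bar>\<bar> \<le> B"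
    using bounded_near by blast
  then have B: "\<bar>f 2 x\<bar> \<le> B \<and> \<bar>g 2 x\<bar> \<le> B \<and> \<bar>f 3 x\<bar> \<le> B \<and> \<bar>g 3 x\<bar> \<le> B \<and> \<bar>f 4 x\<bar> \<le> B"
    if "x \<in> {u0 - 1..u0 + 1}" for x
    using that by (smt (verit) abs_ge_zero)
  \<comment> \<open>The contraction constant depends on \<open>\<alpha>\<close>, \<open>B\<close>
    and \<open>c\<close> but not on \<open>\<epsilon>\<close>, so it can be fixed before
    \<open>\<epsilon>\<close> is made small.\<close>
  define C where "C = \<bar>spine_equation.contraction_const \<alpha> B c\<bar>"
  define r where "r = min (min (r1 / 8) (r2 / 8)) (min (min (r3 / 8) (1 / 8)) (min (\<alpha> / (64 * c)) (1 / (2 * (C + 1)))))"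
  have "0 < r" using r1 r2 r3 \<alpha> c by (auto simp: r_def C_def)
  show ?thesis
  proof (rule eventually_at_rightI[OF _ \<open>0 < r\<close>])
    fix \<epsilon> assume "\<epsilon> \<in> {0<..<r}"
    then have \<epsilon>: "0 < \<epsilon>" "8 * \<epsilon> < r1" "8 * \<epsilon> < r2" "8 * \<epsilon> < r3" "8 * \<epsilon> < 1" "\<epsilon> < \<alpha> / (64 * c)" "\<epsilon> < 1 / (2 * (C + 1))"
      by (auto simp: r_def)
    let ?J = "{u0 - 8 * \<epsilon>..u0 + 8 * \<epsilon>}"
    have J: "\<bar>x - u0\<bar> < r1" "\<bar>x - u0\<bar> < r2" "\<bar>x - u0\<bar> < r3" "x \<in> {u0 - 1..u0 + 1}" if "x \<in> ?J" for x
      using that \<epsilon> by (auto simp: abs_le_iff abs_less_iff)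
    have lip: "\<bar>h x - h y\<bar> \<le> B * \<bar>x - y\<bar>"
      if h: "\<And>x. (h has_real_derivative h' x) (at x)" "\<And>x. x \<in> ?J \<Longrightarrow> \<bar>h' x\<bar> \<le> B" "x \<in> ?J" "y \<in> ?J"
      for h h' :: "real \<Rightarrow> real" and x y
      using field_differentiable_bound[OF convex_real_interval(5) has_field_derivative_at_within[OF h(1)], of "u0 - 8 * \<epsilon>" "u0 + 8 * \<epsilon>" B x y]
        h(2-4) by auto
    interpret fissure_data "f 2" "f 3" "g 2" u0 \<epsilon> \<alpha> B c fp "f (Suc 0)" fm "g (Suc 0)"
    proof
      show "\<bar>f 2 x - f 2 y\<bar> \<le> B * \<bar>x - y\<bar> \<and> \<bar>g 2 x - g 2 y\<bar> \<le> B * \<bar>x - y\<bar> \<and> \<bar>f 3 x - f 3 y\<bar> \<le> B * \<bar>x - y\<bar>"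
        if "x \<in> ?J" "y \<in> ?J" for x y
        using f'(3,4) g'(3) B J(4) that unfolding num by (intro conjI lip) auto
      show "\<bar>f 2 x\<bar> \<le> B \<and> \<bar>g 2 x\<bar> \<le> B \<and> c / 2 \<le> f 3 x \<and> f 3 x \<le> 2 * c" if "x \<in> ?J" for x
      proof -
        have "\<bar>f 3 x - c\<bar> < c / 2" using r3(2)[OF J(3)[OF that]] by (simp add: c_def)
        then have "c / 2 \<le> f 3 x \<and> f 3 x \<le> 2 * c" using c by arith
        then show ?thesis using B[OF J(4)[OF that]] by blast
      qed
      show "\<alpha> \<le> f 2 x - g 2 y" if "x \<in> ?J" "y \<in> ?J" for x y
      proof -
        have "\<bar>f 2 x - f 2 u0\<bar> < \<alpha> / 2" "\<bar>g 2 y - g 2 u0\<bar> < \<alpha> / 2" using r1(2) r2(2) J that by auto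
        moreover have "f 2 u0 - g 2 u0 = 2 * \<alpha>" by (simp add: \<alpha>_def)
        ultimately show ?thesis by linarith
      qed
      show "64 * \<epsilon> * c \<le> \<alpha>" using \<epsilon>(6) c by (simp add: field_simps)
      have "\<epsilon> * C \<le> 1 / (2 * (C + 1)) * C" using \<epsilon>(7) by (intro mult_right_mono) (auto simp: C_def)
      also have "\<dots> \<le> 1 / 2" by (simp add: C_def field_simps)
      finally have "\<epsilon> * C \<le> 1 / 2" .
      moreover have "\<epsilon> * spine_equation.contraction_const \<alpha> B c \<le> \<epsilon> * C"
        using \<epsilon>(1) by (intro mult_left_mono) (auto simp: C_def)
      ultimately show "\<epsilon> * spine_equation.contraction_const \<alpha> B c \<le> 1 / 2" by linarith
      show "f (Suc 0) u0 = g (Suc 0) u0" using assms(3) by (simp add: f0)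
    qed (use \<epsilon> \<alpha> c contf contg f' g' f0 num in auto)
    have root: "is_u_plus fp fm u0 \<epsilon> u \<longleftrightarrow> u0 < u \<and> u < u0 + 2 * \<epsilon> \<and> \<psi> u = 0" for u
      unfolding is_u_plus_def \<psi>_def unfolding f0 by (simp add: f_def)
    obtain v where v: "u0 < v" "v < u0 + 2 * \<epsilon>" "\<psi> v = 0"
      "\<And>u. u0 < u \<Longrightarrow> u < u0 + 2 * \<epsilon> \<Longrightarrow> \<psi> u = 0 \<Longrightarrow> u = v"
      by (rule unique_root) (rule that)
    show "\<exists>up. is_u_plus fp fm u0 \<epsilon> up \<and> (\<forall>u. is_u_plus fp fm u0 \<epsilon> u \<longrightarrow> u = up) \<and>
      (\<exists>vm T A. let I = {vm + \<epsilon>..up + \<epsilon>}; B = herringbone_fun \<epsilon> fp fm T I A in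
        SW_fissure \<epsilon> (vm + \<epsilon>) (up + \<epsilon>) T \<and>
        u0 + \<epsilon> \<in> I \<and> T (u0 + \<epsilon>) = 0 \<and> T (up + \<epsilon>) = \<epsilon> \<and>
        vm < u0 - \<epsilon> \<and> T (vm + \<epsilon>) = - \<epsilon> \<and>
        (\<forall>u\<in>I. T u = 0 \<longrightarrow> u = u0 + \<epsilon>) \<and> spine_value \<epsilon> fp fm T I A \<and>
        foliates \<epsilon> T I (Omega_SW \<epsilon> vm up) \<and>
        bellman_candidate \<epsilon> fp fm (Omega_SW \<epsilon> vm up) B \<and>
        (\<exists>\<delta>>0. \<exists>G.
          (\<forall>x\<in>Omega_R \<epsilon> up (up + \<delta>). G x = tangent_R \<epsilon> fp fm x) \<and>
          (\<forall>x\<in>Omega_L \<epsilon> (vm - \<delta>) vm. G x = tangent_L \<epsilon> fp fm x) \<and>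
          (\<forall>x\<in>Omega_SW \<epsilon> vm up. G x = B x) \<and>
          (let S = Omega_R \<epsilon> up (up + \<delta>) \<union> Omega_L \<epsilon> (vm - \<delta>) vm \<union> Omega_SW \<epsilon> vm up in
             C1_on S G \<and> bellman_candidate \<epsilon> fp fm S G)))"
    proof (rule exI[of _ v], rule conjI[OF _ conjI])
      show "is_u_plus fp fm u0 \<epsilon> v" "\<forall>u. is_u_plus fp fm u0 \<epsilon> u \<longrightarrow> u = v" using v root by blast+
    qed (rule fissure_exists[OF v(1-3)])
  qed
qed

end
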